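(* Let $(G,J,g)$ be a Lie-Hermitian manifold of complex dimension $n$, i.e. $G$ is a Lie group of real dimension $2n$ equipped with a left invariant complex structure $J$ and a left invariant metric $g$ compatible with $J$. Let $\mathfrak{g}$ be the Lie algebra of $G$ and $\mathfrak{n}=[\mathfrak{g},\mathfrak{g}]$. Assume that $G$ is nilpotent. Then $(G,J,g)$ is Strominger Kähler-like if and only if $\mathfrak{g}$ is an at most $2$-step nilpotent Lie algebra of the following type: there exist integers $0\le r\le n$ and $s\ge 0$, an orthonormal basis $\{X_1,\ldots,X_s\}$ of $\mathfrak{n}$, an orthonormal basis $\{\varepsilon_1,\ldots,\varepsilon_{2n}\}$ of $\mathfrak{g}$ with $J\varepsilon_i=\varepsilon_{n+i}$ for each $1\le i\le n$, such that $$\mathfrak{n}+J\mathfrak{n}=\mathrm{span}\{\varepsilon_{r+1},\ldots,\varepsilon_n;\ \varepsilon_{n+r+1},\ldots,\varepsilon_{2n}\},$$ and positive constants $\lambda_1,\ldots,\lambda_s$ such that the only non-trivial Lie brackets under the basis $\{\varepsilon_1,\ldots,\varepsilon_{2n}\}$ are $$[\varepsilon_i,\varepsilon_{n+i}]=\lambda_iX_i,\qquad 1\le i\le s.$$ Moreover, in this case $s$ satisfies $n-r\le s\le \min\{r,2(n-r)\}$, the complex structure $J$ is abelian, and the case when $g$ is Kähler corresponds to $s=0$ and $r=n$.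
   Context: For a metric connection $D$ (that is, $Dg=0$) on a Hermitian manifold $(M,g)$ with complex structure $J$, write $R^D(X,Y,Z,W)=\langle D_XD_YZ-D_YD_XZ-D_{[X,Y]}Z,\,W\rangle$, where $\langle\,,\rangle=g$. $D$ is called Kähler-like if $R^D$ has all the symmetries of the curvature tensor of a Kähler metric, i.e. for all tangent vectors $X,Y,Z,W$: $R^D(X,Y,Z,W)+R^D(Y,Z,X,W)+R^D(Z,X,Y,W)=0$ and $R^D(X,Y,JZ,JW)=R^D(X,Y,Z,W)$. Equivalently, extending $R^D$ complex multilinearly, for all $X,Y,Z,W$ of type $(1,0)$: $R^D(X,Y,\cdot,\cdot)=0$, $R^D(\cdot,\cdot,Z,W)=0$ and $R^D(X,\overline{Y},Z,\overline{W})=R^D(Z,\overline{Y},X,\overline{W})$. The Strominger (also called Bismut) connection $\nabla^s$ is the unique connection with $\nabla^sg=0$, $\nabla^sJ=0$ whose torsion is totally skew-symmetric. The manifold is Strominger Kähler-like if $\nabla^s$ is Kähler-like. The complex structure $J$ is abelian if $[JX,JY]=[X,Y]$ for all $X,Y\in\mathfrak{g}$, equivalently $[\mathfrak{g}^{1,0},\mathfrak{g}^{1,0}]=0$, where $\mathfrak{g}^{1,0}$ is the $(1,0)$-part of $\mathfrak{g}\otimes\mathbb{C}$. *)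

theory Defs
  imports "HOL-Analysis.Analysis" "HOL-Library.Function_Algebras"
begin

text \<open>
  Functions into a real vector space form a real vector space under the pointwise operations
  (addition and multiplication are those of \<^theory>\<open>HOL-Library.Function_Algebras\<close>). This is used both for
  real-valued functions on a manifold and for vector fields, which are operators on such functions.
\<close>

instantiation "fun" :: (type, real_vector) real_vector
begin

definition scaleR_fun :: "real \<Rightarrow> ('a \<Rightarrow> 'b) \<Rightarrow> 'a \<Rightarrow> 'b"
  where "scaleR_fun c f = (\<lambda>x. c *\<^sub>R f x)"

instance
  by standard (simp_all add: scaleR_fun_def plus_fun_def fun_eq_iff algebra_simps)

end


section \<open>Smooth manifolds\<close>

text \<open>
  For open \<open>S\<close> in a Euclidean space: all iterated directional derivatives of order less than
  \<open>k\<close> are differentiable on \<open>S\<close>, and those of order \<open>k\<close> are continuous, i.e. \<open>f\<close> is of class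
  \<open>C\<^sup>k\<close> on \<open>S\<close>.
\<close>

primrec C_k_on :: "nat \<Rightarrow> 'a::euclidean_space set \<Rightarrow> ('a \<Rightarrow> 'b::real_normed_vector) \<Rightarrow> bool" where
  "C_k_on 0 S f \<longleftrightarrow> continuous_on S f"
| "C_k_on (Suc k) S f \<longleftrightarrow>
     (\<forall>x\<in>S. f differentiable (at x)) \<and>
     (\<forall>v. C_k_on k S (\<lambda>x. frechet_derivative f (at x) v))"

definition smooth_on :: "'a::euclidean_space set \<Rightarrow> ('a \<Rightarrow> 'b::real_normed_vector) \<Rightarrow> bool"
  where "smooth_on S f \<longleftrightarrow> (\<forall>k. C_k_on k S f)"

text \<open>A chart is a pair of its domain and a coordinate map; values of the coordinate map outside
  the domain are irrelevant.\<close>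

type_synonym ('m, 'e) chart = "'m set \<times> ('m \<Rightarrow> 'e)"

definition smooth_atlas :: "('m::topological_space, 'e::euclidean_space) chart set \<Rightarrow> bool" where
  "smooth_atlas A \<longleftrightarrow>
     (\<Union>(U, \<phi>)\<in>A. U) = UNIV \<and>
     (\<forall>(U, \<phi>)\<in>A. open U \<and> open (\<phi> ` U) \<and> homeomorphism U (\<phi> ` U) \<phi> (inv_into U \<phi>)) \<and>
     (\<forall>(U, \<phi>)\<in>A. \<forall>(V, \<psi>)\<in>A. smooth_on (\<phi> ` (U \<inter> V)) (\<psi> \<circ> inv_into U \<phi>))"

definition prod_atlas :: "('m, 'e) chart set \<Rightarrow> ('n, 'f) chart set \<Rightarrow> ('m \<times> 'n, 'e \<times> 'f) chart set"
  where "prod_atlas A B = {(U \<times> V, map_prod \<phi> \<psi>) |U \<phi> V \<psi>. (U, \<phi>) \<in> A \<and> (V, \<psi>) \<in> B}"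

definition smooth_map ::
  "('m::topological_space, 'e::euclidean_space) chart set \<Rightarrow>
   ('n::topological_space, 'f::euclidean_space) chart set \<Rightarrow> ('m \<Rightarrow> 'n) \<Rightarrow> bool" where
  "smooth_map A B F \<longleftrightarrow>
     continuous_on UNIV F \<and>
     (\<forall>(U, \<phi>)\<in>A. \<forall>(V, \<psi>)\<in>B. smooth_on (\<phi> ` (U \<inter> F -` V)) (\<psi> \<circ> F \<circ> inv_into U \<phi>))"

definition smooth_functions ::
  "('m::topological_space, 'e::euclidean_space) chart set \<Rightarrow> ('m \<Rightarrow> real) set" where
  "smooth_functions A = {f. \<forall>(U, \<phi>)\<in>A. smooth_on (\<phi> ` U) (f \<circ> inv_into U \<phi>)}"


section \<open>Vector fields\<close>

text \<open>
  Smooth vector fields are the derivations of the algebra of smooth functions. The last clause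
  fixes the irrelevant values on non-smooth functions, so that equality of vector fields is
  equality in HOL.
\<close>

type_synonym 'm vfield = "('m \<Rightarrow> real) \<Rightarrow> ('m \<Rightarrow> real)"

definition vector_fields ::
  "('m::topological_space, 'e::euclidean_space) chart set \<Rightarrow> 'm vfield set" where
  "vector_fields A = {X.
     (\<forall>f\<in>smooth_functions A. X f \<in> smooth_functions A) \<and>
     (\<forall>f\<in>smooth_functions A. \<forall>h\<in>smooth_functions A. X (f + h) = X f + X h) \<and>
     (\<forall>c. \<forall>f\<in>smooth_functions A. X (c *\<^sub>R f) = c *\<^sub>R X f) \<and>
     (\<forall>f\<in>smooth_functions A. \<forall>h\<in>smooth_functions A. X (f * h) = f * X h + h * X f) \<and>
     (\<forall>f. f \<notin> smooth_functions A \<longrightarrow> X f = 0)}"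

definition fscale :: "('m \<Rightarrow> real) \<Rightarrow> 'm vfield \<Rightarrow> 'm vfield"
  where "fscale f X = (\<lambda>h. f * X h)"

definition lie_bracket :: "'m vfield \<Rightarrow> 'm vfield \<Rightarrow> 'm vfield"
  where "lie_bracket X Y = (\<lambda>f. X (Y f) - Y (X f))"

definition pushforward :: "('m \<Rightarrow> 'm) \<Rightarrow> 'm vfield \<Rightarrow> 'm vfield"
  where "pushforward F X = (\<lambda>f. X (f \<circ> F) \<circ> inv F)"


section \<open>Hermitian geometry\<close>

text \<open>
  Tensor fields are given as \<open>C\<^sup>\<infinity>\<close>-multilinear maps on vector fields. A complex structure is an
  integrable almost complex structure, i.e. one with vanishing Nijenhuis tensor.
\<close>

definition complex_structure ::
  "('m::topological_space, 'e::euclidean_space) chart set \<Rightarrow> ('m vfield \<Rightarrow> 'm vfield) \<Rightarrow> bool" where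
  "complex_structure A J \<longleftrightarrow>
     (\<forall>X\<in>vector_fields A. J X \<in> vector_fields A) \<and>
     (\<forall>X\<in>vector_fields A. \<forall>Y\<in>vector_fields A. J (X + Y) = J X + J Y) \<and>
     (\<forall>f\<in>smooth_functions A. \<forall>X\<in>vector_fields A. J (fscale f X) = fscale f (J X)) \<and>
     (\<forall>X\<in>vector_fields A. J (J X) = - X) \<and>
     (\<forall>X\<in>vector_fields A. \<forall>Y\<in>vector_fields A.
        lie_bracket (J X) (J Y) =
          lie_bracket X Y + J (lie_bracket (J X) Y) + J (lie_bracket X (J Y)))"

text \<open>In the last clause, \<open>\<forall>f\<in>smooth_functions A. X f p = 0\<close> says that \<open>X\<close> vanishes at \<open>p\<close>.\<close>

definition riemannian_metric ::
  "('m::topological_space, 'e::euclidean_space) chart set \<Rightarrow>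
   ('m vfield \<Rightarrow> 'm vfield \<Rightarrow> 'm \<Rightarrow> real) \<Rightarrow> bool" where
  "riemannian_metric A g \<longleftrightarrow>
     (\<forall>X\<in>vector_fields A. \<forall>Y\<in>vector_fields A. g X Y \<in> smooth_functions A) \<and>
     (\<forall>X\<in>vector_fields A. \<forall>Y\<in>vector_fields A. g X Y = g Y X) \<and>
     (\<forall>X\<in>vector_fields A. \<forall>Y\<in>vector_fields A. \<forall>Z\<in>vector_fields A.
        g (X + Y) Z = g X Z + g Y Z) \<and>
     (\<forall>f\<in>smooth_functions A. \<forall>X\<in>vector_fields A. \<forall>Y\<in>vector_fields A.
        g (fscale f X) Y = f * g X Y) \<and>
     (\<forall>X\<in>vector_fields A. \<forall>p. g X X p \<ge> 0 \<and>
        (g X X p = 0 \<longleftrightarrow> (\<forall>f\<in>smooth_functions A. X f p = 0)))"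

definition hermitian ::
  "('m::topological_space, 'e::euclidean_space) chart set \<Rightarrow> ('m vfield \<Rightarrow> 'm vfield) \<Rightarrow>
   ('m vfield \<Rightarrow> 'm vfield \<Rightarrow> 'm \<Rightarrow> real) \<Rightarrow> bool" where
  "hermitian A J g \<longleftrightarrow>
     complex_structure A J \<and> riemannian_metric A g \<and>
     (\<forall>X\<in>vector_fields A. \<forall>Y\<in>vector_fields A. g (J X) (J Y) = g X Y)"

definition connection ::
  "('m::topological_space, 'e::euclidean_space) chart set \<Rightarrow>
   ('m vfield \<Rightarrow> 'm vfield \<Rightarrow> 'm vfield) \<Rightarrow> bool" where
  "connection A D \<longleftrightarrow>
     (\<forall>X\<in>vector_fields A. \<forall>Y\<in>vector_fields A. D X Y \<in> vector_fields A) \<and>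
     (\<forall>X\<in>vector_fields A. \<forall>Y\<in>vector_fields A. \<forall>Z\<in>vector_fields A.
        D (X + Y) Z = D X Z + D Y Z \<and> D X (Y + Z) = D X Y + D X Z) \<and>
     (\<forall>f\<in>smooth_functions A. \<forall>X\<in>vector_fields A. \<forall>Y\<in>vector_fields A.
        D (fscale f X) Y = fscale f (D X Y) \<and>
        D X (fscale f Y) = fscale (X f) Y + fscale f (D X Y))"

definition metric_connection ::
  "('m::topological_space, 'e::euclidean_space) chart set \<Rightarrow>
   ('m vfield \<Rightarrow> 'm vfield \<Rightarrow> 'm \<Rightarrow> real) \<Rightarrow> ('m vfield \<Rightarrow> 'm vfield \<Rightarrow> 'm vfield) \<Rightarrow> bool" where
  "metric_connection A g D \<longleftrightarrow>
     connection A D \<and>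
     (\<forall>X\<in>vector_fields A. \<forall>Y\<in>vector_fields A. \<forall>Z\<in>vector_fields A.
        X (g Y Z) = g (D X Y) Z + g Y (D X Z))"

definition torsion ::
  "('m vfield \<Rightarrow> 'm vfield \<Rightarrow> 'm vfield) \<Rightarrow> 'm vfield \<Rightarrow> 'm vfield \<Rightarrow> 'm vfield"
  where "torsion D X Y = D X Y - D Y X - lie_bracket X Y"

definition curvature ::
  "('m vfield \<Rightarrow> 'm vfield \<Rightarrow> 'm \<Rightarrow> real) \<Rightarrow> ('m vfield \<Rightarrow> 'm vfield \<Rightarrow> 'm vfield) \<Rightarrow>
   'm vfield \<Rightarrow> 'm vfield \<Rightarrow> 'm vfield \<Rightarrow> 'm vfield \<Rightarrow> 'm \<Rightarrow> real" where
  "curvature g D X Y Z W = g (D X (D Y Z) - D Y (D X Z) - D (lie_bracket X Y) Z) W"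

definition kahler_like ::
  "('m::topological_space, 'e::euclidean_space) chart set \<Rightarrow> ('m vfield \<Rightarrow> 'm vfield) \<Rightarrow>
   ('m vfield \<Rightarrow> 'm vfield \<Rightarrow> 'm \<Rightarrow> real) \<Rightarrow> ('m vfield \<Rightarrow> 'm vfield \<Rightarrow> 'm vfield) \<Rightarrow> bool" where
  "kahler_like A J g D \<longleftrightarrow>
     metric_connection A g D \<and>
     (\<forall>X\<in>vector_fields A. \<forall>Y\<in>vector_fields A. \<forall>Z\<in>vector_fields A. \<forall>W\<in>vector_fields A.
        curvature g D X Y Z W + curvature g D Y Z X W + curvature g D Z X Y W = 0 \<and>
        curvature g D X Y (J Z) (J W) = curvature g D X Y Z W)"

text \<open>The torsion is always skew in its two arguments, so total skew-symmetry amounts to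
  skew-symmetry in the last two slots of \<open>g (T X Y) Z\<close>.\<close>

definition strominger_connection ::
  "('m::topological_space, 'e::euclidean_space) chart set \<Rightarrow> ('m vfield \<Rightarrow> 'm vfield) \<Rightarrow>
   ('m vfield \<Rightarrow> 'm vfield \<Rightarrow> 'm \<Rightarrow> real) \<Rightarrow> ('m vfield \<Rightarrow> 'm vfield \<Rightarrow> 'm vfield) \<Rightarrow> bool" where
  "strominger_connection A J g D \<longleftrightarrow>
     metric_connection A g D \<and>
     (\<forall>X\<in>vector_fields A. \<forall>Y\<in>vector_fields A. D X (J Y) = J (D X Y)) \<and>
     (\<forall>X\<in>vector_fields A. \<forall>Y\<in>vector_fields A. \<forall>Z\<in>vector_fields A.
        g (torsion D X Y) Z = - g (torsion D X Z) Y)"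

text \<open>A Strominger connection exists and is unique as a map on pairs of vector fields; as its
  values elsewhere are arbitrary, it is introduced by an existential quantifier.\<close>

definition strominger_kahler_like ::
  "('m::topological_space, 'e::euclidean_space) chart set \<Rightarrow> ('m vfield \<Rightarrow> 'm vfield) \<Rightarrow>
   ('m vfield \<Rightarrow> 'm vfield \<Rightarrow> 'm \<Rightarrow> real) \<Rightarrow> bool" where
  "strominger_kahler_like A J g \<longleftrightarrow>
     (\<exists>D. strominger_connection A J g D \<and> kahler_like A J g D)"

text \<open>The fundamental form \<open>\<omega> X Y = g (J X) Y\<close> is closed; the formula is the invariant expression
  for its exterior derivative.\<close>

definition kahler ::
  "('m::topological_space, 'e::euclidean_space) chart set \<Rightarrow> ('m vfield \<Rightarrow> 'm vfield) \<Rightarrow>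
   ('m vfield \<Rightarrow> 'm vfield \<Rightarrow> 'm \<Rightarrow> real) \<Rightarrow> bool" where
  "kahler A J g \<longleftrightarrow>
     hermitian A J g \<and>
     (\<forall>X\<in>vector_fields A. \<forall>Y\<in>vector_fields A. \<forall>Z\<in>vector_fields A.
        X (g (J Y) Z) + Y (g (J Z) X) + Z (g (J X) Y)
        - g (J (lie_bracket X Y)) Z - g (J (lie_bracket Y Z)) X - g (J (lie_bracket Z X)) Y = 0)"


section \<open>Lie groups with left invariant Hermitian structure\<close>

definition lie_group ::
  "('m::{t2_space, second_countable_topology}, 'e::euclidean_space) chart set \<Rightarrow>
   ('m \<Rightarrow> 'm \<Rightarrow> 'm) \<Rightarrow> 'm \<Rightarrow> ('m \<Rightarrow> 'm) \<Rightarrow> bool" where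
  "lie_group A mul one ginv \<longleftrightarrow>
     smooth_atlas A \<and> Groups.group mul one ginv \<and>
     smooth_map (prod_atlas A A) A (\<lambda>(x, y). mul x y) \<and> smooth_map A A ginv"

text \<open>Here \<open>n\<close> is the complex dimension.\<close>

definition lie_hermitian ::
  "nat \<Rightarrow> ('m::{t2_space, second_countable_topology}, 'e::euclidean_space) chart set \<Rightarrow>
   ('m \<Rightarrow> 'm \<Rightarrow> 'm) \<Rightarrow> 'm \<Rightarrow> ('m \<Rightarrow> 'm) \<Rightarrow> ('m vfield \<Rightarrow> 'm vfield) \<Rightarrow>
   ('m vfield \<Rightarrow> 'm vfield \<Rightarrow> 'm \<Rightarrow> real) \<Rightarrow> bool" where
  "lie_hermitian n A mul one ginv J g \<longleftrightarrow>
     lie_group A mul one ginv \<and> DIM('e) = 2 * n \<and> hermitian A J g \<and>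
     (\<forall>a. \<forall>X\<in>vector_fields A. J (pushforward (mul a) X) = pushforward (mul a) (J X)) \<and>
     (\<forall>a. \<forall>X\<in>vector_fields A. \<forall>Y\<in>vector_fields A.
        g (pushforward (mul a) X) (pushforward (mul a) Y) \<circ> mul a = g X Y)"

definition lie_algebra ::
  "('m::topological_space, 'e::euclidean_space) chart set \<Rightarrow> ('m \<Rightarrow> 'm \<Rightarrow> 'm) \<Rightarrow> 'm vfield set"
  where "lie_algebra A mul = {X\<in>vector_fields A. \<forall>a. pushforward (mul a) X = X}"

definition bracket_space :: "'m vfield set \<Rightarrow> 'm vfield set \<Rightarrow> 'm vfield set"
  where "bracket_space S T = span {lie_bracket X Y |X Y. X \<in> S \<and> Y \<in> T}"

primrec lower_central :: "'m vfield set \<Rightarrow> nat \<Rightarrow> 'm vfield set" where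
  "lower_central L 0 = L"
| "lower_central L (Suc k) = bracket_space L (lower_central L k)"

text \<open>As in Knapp's \<^emph>\<open>Lie Groups Beyond an Introduction\<close>, a Lie group is called nilpotent if its Lie
  algebra is; connectedness is not required.\<close>

definition nilpotent_lie_group ::
  "('m::topological_space, 'e::euclidean_space) chart set \<Rightarrow> ('m \<Rightarrow> 'm \<Rightarrow> 'm) \<Rightarrow> bool" where
  "nilpotent_lie_group A mul \<longleftrightarrow> (\<exists>k. lower_central (lie_algebra A mul) k = {0})"

definition at_most_2_step_nilpotent :: "'m vfield set \<Rightarrow> bool"
  where "at_most_2_step_nilpotent L \<longleftrightarrow> lower_central L 2 = {0}"

definition abelian_complex_structure :: "'m vfield set \<Rightarrow> ('m vfield \<Rightarrow> 'm vfield) \<Rightarrow> bool" where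
  "abelian_complex_structure L J \<longleftrightarrow>
     (\<forall>X\<in>L. \<forall>Y\<in>L. lie_bracket (J X) (J Y) = lie_bracket X Y)"

text \<open>\<open>b 1, \<dots>, b m\<close> is an orthonormal basis of the space \<open>V\<close> of left invariant vector fields. Their
  inner products with respect to a left invariant metric are constant functions on the group.\<close>

definition orthonormal_basis ::
  "('m vfield \<Rightarrow> 'm vfield \<Rightarrow> 'm \<Rightarrow> real) \<Rightarrow> nat \<Rightarrow> (nat \<Rightarrow> 'm vfield) \<Rightarrow> 'm vfield set \<Rightarrow> bool" where
  "orthonormal_basis g m b V \<longleftrightarrow>
     (\<forall>i\<in>{1..m}. \<forall>j\<in>{1..m}. g (b i) (b j) = (\<lambda>_. if i = j then 1 else 0)) \<and>
     span (b ` {1..m}) = V"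

text \<open>The bracket clause lists all pairs \<open>i < j\<close>; the others follow by antisymmetry. It forces
  \<open>s \<le> n\<close>, since the \<open>s\<close>-dimensional space spanned by the brackets has at most \<open>n\<close> generators.\<close>

definition skl_nilpotent_type ::
  "nat \<Rightarrow> 'm vfield set \<Rightarrow> ('m vfield \<Rightarrow> 'm vfield) \<Rightarrow> ('m vfield \<Rightarrow> 'm vfield \<Rightarrow> 'm \<Rightarrow> real) \<Rightarrow>
   nat \<Rightarrow> nat \<Rightarrow> (nat \<Rightarrow> 'm vfield) \<Rightarrow> (nat \<Rightarrow> 'm vfield) \<Rightarrow> (nat \<Rightarrow> real) \<Rightarrow> bool" where
  "skl_nilpotent_type n L J g r s X \<epsilon> l \<longleftrightarrow>
     at_most_2_step_nilpotent L \<and>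
     r \<le> n \<and>
     orthonormal_basis g s X (bracket_space L L) \<and>
     orthonormal_basis g (2 * n) \<epsilon> L \<and>
     (\<forall>i\<in>{1..n}. J (\<epsilon> i) = \<epsilon> (n + i)) \<and>
     {Y + J Z |Y Z. Y \<in> bracket_space L L \<and> Z \<in> bracket_space L L} =
       span (\<epsilon> ` ({r + 1..n} \<union> {n + r + 1..2 * n})) \<and>
     (\<forall>i\<in>{1..s}. l i > 0) \<and>
     (\<forall>i\<in>{1..2 * n}. \<forall>j\<in>{1..2 * n}. i < j \<longrightarrow>
        lie_bracket (\<epsilon> i) (\<epsilon> j) = (if i \<le> s \<and> j = n + i then l i *\<^sub>R X i else 0))"

end

theory Submission
  imports Defs "HOL-Analysis.Analysis"
begin

text \<open>
The geometry reduces to algebra on one tangent space. Left invariant fields are determined by their values at the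
identity and provide an orthonormal frame of the manifold (\<open>frame_expansion\<close>); behind this is the fact that
derivations of the smooth functions are directional derivatives (\<open>point_derivation\<close>). The equations for a
Strominger connection have at most one solution at each point (\<open>strominger_form_unique\<close>), and for left invariant fields they do
not depend on the point, so the connection maps left invariant fields to left invariant ones. An isometry \<open>\<Phi>\<close> from a
Euclidean space onto the Lie algebra then transports the bracket, \<open>J\<close> and the connection, now a bilinear map
\<open>nb x y = \<nabla>\<^sub>x y\<close>, to that space. Conversely, tensoriality extends algebraic identities for \<open>nb\<close> from the frame to all
vector fields.

Suppose the connection is Kaehler-like and \<open>z\<close> is central. The Ricci form of \<open>(z, J z)\<close> is the trace of \<open>J\<close> times a
commutator, so it vanishes. Computed instead from the derivatives of \<open>z\<close>, the Ricci curvature of \<open>J z\<close> involves a sum of squares measuring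
how far \<open>w \<mapsto> \<nabla>\<^sub>w z\<close> is from anticommuting with \<open>J\<close>. These squares vanish; hence \<open>ad (J z)\<close> is skew, and being
nilpotent it is zero (\<open>J_center\<close>). The same trace is then a sum of the \<open>\<parallel>\<nabla>\<^sub>w z\<parallel>\<^sup>2\<close>, so central vectors are parallel
(\<open>center_parallel\<close>). It follows that the operators \<open>\<nabla>\<^sub>z\<close>, for central \<open>z\<close>, commute with \<open>J\<close>, with each other and
with every \<open>\<nabla>\<^sub>x\<close>, and that they are derivations of the torsion. They decompose the orthogonal complement of the center into
joint eigenspaces \<open>E \<kappa>\<close>, on which \<open>\<nabla>\<^sub>z\<close> is the rotation \<open>- (\<kappa> \<bullet> z) J\<close>. The weight 0 does not occur, since its eigenspace
would be an ideal that misses the center (\<open>flat_part_trivial\<close>).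

Nilpotency of step two comes from elements \<open>y\<close> of the second center. If \<open>y\<close> has a component \<open>u\<close> in \<open>E \<kappa>\<close>, the
Jacobi and Bianchi identities show that all other weights are orthogonal to \<open>\<kappa>\<close> and that \<open>E \<kappa>\<close> is the complex line of
\<open>u\<close> (\<open>E_complex_line\<close>), and then that \<open>u\<close> is orthogonal to the derived algebra (\<open>derived_perp_u\<close>). So the second
center meets the derived algebra only in the center, which forces \<open>[\<gg>, [\<gg>, \<gg>]] = 0\<close> (\<open>two_step\<close>). Now every vector
orthogonal to the center lies in the second center; a unitary basis of eigenvectors has pairwise orthogonal nonzero weights, and these
are the brackets \<open>[\<epsilon>\<^sub>i, J \<epsilon>\<^sub>i] = \<lambda>\<^sub>i X\<^sub>i\<close> (\<open>structure_theorem\<close>).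

For the converse, the normal form has an abelian complex structure, and \<open>\<nabla>\<^sub>x y = - (ad y)\<^sup>* x\<close> is the Strominger connection.
Its operators are commuting rotations in the planes of \<open>\<epsilon>\<^sub>i\<close> and \<open>J \<epsilon>\<^sub>i\<close>, so the Bianchi identity amounts to
\<open>\<Sum> \<lambda>\<^sub>i\<^sup>2 \<alpha>\<^sub>i \<and> \<alpha>\<^sub>i = 0\<close> for the area forms \<open>\<alpha>\<^sub>i\<close> of these planes (\<open>nb_bianchi\<close>). The bounds on \<open>s\<close> compare the dimensions of \<open>\<nn>\<close>,
\<open>J \<nn>\<close> and the center, and closedness of the fundamental form, evaluated on \<open>\<epsilon>\<^sub>1, J \<epsilon>\<^sub>1, J X\<^sub>1\<close>, excludes \<open>s > 0\<close>.
\<close>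

section \<open>Traces, common eigenvectors and orthonormalisation\<close>

definition tr :: "('e::euclidean_space \<Rightarrow> 'e) \<Rightarrow> real"
  where "tr f = (\<Sum>b\<in>Basis. f b \<bullet> b)"

lemma tr_add: "tr (\<lambda>x. f x + g x) = tr f + tr g"
  by (simp add: tr_def inner_add_left sum.distrib)

lemma tr_minus: "tr (\<lambda>x. - f x) = - tr f"
  by (simp add: tr_def sum_negf)

text \<open>
This carries most of the curvature arguments below: traces of commutators vanish, and operators may be moved
cyclically under a trace.
\<close>
lemma tr_commute:
  fixes f g :: "'e::euclidean_space \<Rightarrow> 'e"
  assumes "linear f" "linear g"
  shows "tr (\<lambda>x. f (g x)) = tr (\<lambda>x. g (f x))"
proof -
  have expand: "f' (g' b) \<bullet> b = (\<Sum>c\<in>Basis. (g' b \<bullet> c) * (f' c \<bullet> b))"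
    if "linear f'" for f' g' :: "'e \<Rightarrow> 'e" and b
  proof -
    have "f' (g' b) = f' (\<Sum>c\<in>Basis. (g' b \<bullet> c) *\<^sub>R c)"
      by (simp add: euclidean_representation)
    also have "\<dots> = (\<Sum>c\<in>Basis. (g' b \<bullet> c) *\<^sub>R f' c)"
      using that by (simp add: linear_sum linear_scale)
    finally show ?thesis by (simp add: inner_sum_left)
  qed
  have "tr (\<lambda>x. f (g x)) = (\<Sum>b\<in>Basis. \<Sum>c\<in>Basis. (g b \<bullet> c) * (f c \<bullet> b))"
    unfolding tr_def by (intro sum.cong refl expand[of f g] assms)
  also have "\<dots> = (\<Sum>c\<in>Basis. \<Sum>b\<in>Basis. (f c \<bullet> b) * (g b \<bullet> c))"
    by (subst sum.swap) (simp add: mult.commute)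
  also have "\<dots> = tr (\<lambda>x. g (f x))"
    unfolding tr_def by (intro sum.cong refl expand[of g f, symmetric] assms)
  finally show ?thesis .
qed

lemma orthogonal_projection_exists:
  fixes S :: "'e::euclidean_space set"
  assumes "subspace S"
  obtains P where "linear P" "\<And>x. P x \<in> S" "\<And>x. x \<in> S \<Longrightarrow> P x = x"
    "\<And>x y. y \<in> S \<Longrightarrow> (x - P x) \<bullet> y = 0"
proof -
  obtain B where B: "B \<subseteq> S" "pairwise orthogonal B" "\<And>x. x \<in> B \<Longrightarrow> norm x = 1"
    "independent B" "span B = S"
    using orthonormal_basis_subspace[OF assms] by metis
  have fin: "finite B" using B(4) independent_imp_finite by blast
  define P where "P x = (\<Sum>b\<in>B. (x \<bullet> b) *\<^sub>R b)" for x
  have lin: "linear P"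
    by (rule linearI) (simp_all add: P_def inner_add_left scaleR_add_left sum.distrib scaleR_sum_right)
  have PS: "P x \<in> S" for x
    unfolding P_def using B(1) assms by (intro subspace_sum subspace_scale) auto
  have Pb: "(x - P x) \<bullet> b = 0" if "b \<in> B" for x b
  proof -
    have "P x \<bullet> b = (\<Sum>c\<in>B. (x \<bullet> c) * (c \<bullet> b))" by (simp add: P_def inner_sum_left)
    also have "\<dots> = (\<Sum>c\<in>B. if c = b then x \<bullet> b else 0)"
    proof (rule sum.cong[OF refl])
      fix c assume c: "c \<in> B"
      show "(x \<bullet> c) * (c \<bullet> b) = (if c = b then x \<bullet> b else 0)"
        using B(2,3) c that unfolding pairwise_def orthogonal_def
        by (cases "c = b") (auto simp: dot_square_norm)
    qed
    also have "\<dots> = x \<bullet> b" using fin that by simp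
    finally show ?thesis by (simp add: inner_diff_left)
  qed
  have orth: "(x - P x) \<bullet> y = 0" if "y \<in> S" for x y
  proof -
    have "y \<in> span B" using B(5) that by simp
    then show ?thesis
      by (induction rule: span_induct_alt) (auto simp: inner_add_right Pb)
  qed
  have fixed: "P x = x" if "x \<in> S" for x
  proof -
    have "x - P x \<in> S" using that PS assms by (simp add: subspace_diff)
    then have "(x - P x) \<bullet> (x - P x) = 0" by (rule orth)
    then show ?thesis by simp
  qed
  show thesis using that[OF lin PS fixed orth] by blast
qed

text \<open>
Compressing \<open>f\<close> to successive members of the flag does not change the trace: the orthogonal projection onto
the next member can be inserted after \<open>f\<close> and then moved around cyclically. At the end of the flag the
compression is zero.
\<close>
lemma tr_nilpotent:
  fixes f :: "'e::euclidean_space \<Rightarrow> 'e"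
  assumes lin: "linear f" and sub: "\<And>k. subspace (S k)" and S0: "S 0 = UNIV"
    and desc: "\<And>k. S (Suc k) \<subseteq> S k" and step: "\<And>k x. x \<in> S k \<Longrightarrow> f x \<in> S (Suc k)"
    and "S K = {0}"
  shows "tr f = 0"
proof -
  have "\<forall>k. \<exists>P. linear P \<and> (\<forall>x. P x \<in> S k) \<and> (\<forall>x\<in>S k. P x = x)"
    using orthogonal_projection_exists[OF sub] by metis
  then obtain P where P: "\<And>k. linear (P k)" "\<And>k x. P k x \<in> S k" "\<And>k x. x \<in> S k \<Longrightarrow> P k x = x"
    by metis
  have "tr (\<lambda>x. f (P k x)) = tr f" for k
  proof (induction k)
    case 0
    have "P 0 x = x" for x using P(3) S0 by auto
    then show ?case by simp
  next
    case (Suc k)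
    have "tr (\<lambda>x. f (P k x)) = tr (\<lambda>x. P (Suc k) (f (P k x)))"
      using P(3)[OF step[OF P(2)]] by simp
    also have "\<dots> = tr (\<lambda>x. f (P k (P (Suc k) x)))"
      using tr_commute[OF P(1)[of "Suc k"], of "\<lambda>x. f (P k x)"] lin P(1)
      by (simp add: linear_compose[unfolded o_def])
    also have "\<dots> = tr (\<lambda>x. f (P (Suc k) x))"
      using P(2,3) desc by (metis subsetD)
    finally show ?case using Suc by simp
  qed
  from this[of K] have "tr f = tr (\<lambda>x. f (P K x))" by simp
  also have "P K x = 0" for x using P(2)[of K x] assms(6) by simp
  then have "tr (\<lambda>x. f (P K x)) = 0" using lin by (simp add: tr_def linear_0)
  finally show ?thesis .
qed

text \<open>
If \<open>f (f v) = 0\<close> then \<open>\<parallel>f v\<parallel>\<^sup>2 = - v \<bullet> f (f v) = 0\<close>, so the exponent can be lowered one by one.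
\<close>
lemma skew_nilpotent_eq_0:
  fixes f :: "'e::euclidean_space \<Rightarrow> 'e"
  assumes skew: "\<And>x y. f x \<bullet> y = - (x \<bullet> f y)" and "(f ^^ k) x = 0" "k > 0"
  shows "f x = 0"
proof -
  have "(f ^^ Suc j) x = 0 \<Longrightarrow> f x = 0" for j
  proof (induction j)
    case (Suc j)
    have "f ((f ^^ j) x) \<bullet> f ((f ^^ j) x) = - ((f ^^ j) x \<bullet> f (f ((f ^^ j) x)))"
      by (rule skew)
    also have "\<dots> = 0" using Suc.prems by simp
    finally have "(f ^^ Suc j) x = 0" by simp
    then show ?case by (rule Suc.IH)
  qed simp
  then show ?thesis using assms(2,3) by (cases k) auto
qed

text \<open>
The first-order condition at a minimum, in a form that needs no differentiation. It serves both the variational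
proof of the spectral theorem and the proof that a metric is tensorial.
\<close>
lemma nonneg_quadratic_linear_coeff_0:
  fixes b c :: real
  assumes q: "\<And>t. 0 \<le> 2 * t * b + t\<^sup>2 * c"
  shows "b = 0"
proof (rule ccontr)
  assume "b \<noteq> 0"
  show False
  proof (cases "c > 0")
    case True
    have "2 * (- b / c) * b + (- b / c)\<^sup>2 * c = - (b\<^sup>2 / c)"
      using True by (simp add: power2_eq_square)
    moreover have "b\<^sup>2 / c > 0" using True \<open>b \<noteq> 0\<close> by simp
    ultimately show False using q[of "- b / c"] by linarith
  next
    case False
    have "2 * (- b) * b + (- b)\<^sup>2 * c \<le> - 2 * b\<^sup>2"
      using False by (simp add: power2_eq_square mult_nonneg_nonpos)
    moreover have "b\<^sup>2 > 0" using \<open>b \<noteq> 0\<close> by simp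
    ultimately show False using q[of "- b"] by linarith
  qed
qed

text \<open>
A maximiser of the quadratic form on the unit sphere of \<open>M\<close> is an eigenvector, by the first-order condition in
every direction of \<open>M\<close>.
\<close>
lemma symmetric_eigenvector:
  fixes f :: "'e::euclidean_space \<Rightarrow> 'e"
  assumes lin: "linear f" and sym: "\<And>x y. f x \<bullet> y = x \<bullet> f y"
    and M: "subspace M" "M \<noteq> {0}" and inv: "\<And>x. x \<in> M \<Longrightarrow> f x \<in> M"
  obtains w \<mu> where "w \<in> M" "norm w = 1" "f w = \<mu> *\<^sub>R w"
proof -
  let ?K = "M \<inter> sphere 0 1"
  have comp: "compact ?K"
    using closed_subspace[OF M(1)] by (simp add: closed_Int_compact)
  obtain v where v: "v \<in> M" "v \<noteq> 0" using M subspace_0 by blast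
  have "(1 / norm v) *\<^sub>R v \<in> ?K" using v M(1) by (simp add: subspace_scale)
  then have ne: "?K \<noteq> {}" by blast
  have "bounded_linear f" using lin by (simp add: linear_conv_bounded_linear)
  then have "continuous_on ?K (\<lambda>x. f x \<bullet> x)"
    by (intro continuous_intros linear_continuous_on)
  from continuous_attains_sup[OF comp ne this] obtain w
    where w: "w \<in> ?K" and max: "\<And>x. x \<in> ?K \<Longrightarrow> f x \<bullet> x \<le> f w \<bullet> w" by blast
  define \<mu> where "\<mu> = f w \<bullet> w"
  have wM: "w \<in> M" and nw: "norm w = 1" using w by auto
  \<comment> \<open>homogeneity extends the maximality from the sphere to all of M\<close>
  have le: "f x \<bullet> x \<le> \<mu> * (x \<bullet> x)" if "x \<in> M" for x
  proof (cases "x = 0")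
    case False
    have "f ((1 / norm x) *\<^sub>R x) \<bullet> ((1 / norm x) *\<^sub>R x) \<le> \<mu>"
      unfolding \<mu>_def using that False M(1) by (intro max) (simp add: subspace_scale)
    then show ?thesis using False lin
      by (simp add: linear_scale dot_square_norm power2_eq_square field_simps)
  qed (simp add: lin linear_0)
  have "(\<mu> *\<^sub>R w - f w) \<bullet> h = 0" if h: "h \<in> M" for h
  proof -
    define b where "b = (\<mu> *\<^sub>R w - f w) \<bullet> h"
    define c where "c = \<mu> * (h \<bullet> h) - f h \<bullet> h"
    have q: "0 \<le> 2 * t * b + t\<^sup>2 * c" for t
    proof -
      have "f (w + t *\<^sub>R h) \<bullet> (w + t *\<^sub>R h) \<le> \<mu> * ((w + t *\<^sub>R h) \<bullet> (w + t *\<^sub>R h))"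
        using wM h M(1) by (intro le) (simp add: subspace_add subspace_scale)
      moreover have "f h \<bullet> w = f w \<bullet> h" using sym[of h w] by (simp add: inner_commute)
      moreover have "w \<bullet> w = 1" using nw by (simp add: dot_square_norm)
      ultimately show ?thesis using lin unfolding b_def c_def
        by (simp add: linear_add linear_scale inner_add_left inner_add_right inner_diff_left
            \<mu>_def[symmetric] power2_eq_square algebra_simps inner_commute[of h w])
    qed
    show "b = 0" by (rule nonneg_quadratic_linear_coeff_0[OF q])
  qed
  moreover have "\<mu> *\<^sub>R w - f w \<in> M" using wM M(1) inv by (simp add: subspace_diff subspace_scale)
  ultimately have "f w = \<mu> *\<^sub>R w" by (metis inner_eq_zero_iff right_minus_eq)
  then show thesis using that wM nw by blast
qed

text \<open>
If some operator of the family is not a scalar on \<open>M\<close>, then one of its eigenspaces is smaller than \<open>M\<close> and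
invariant under the whole family because the family commutes; induction on the dimension finishes.
\<close>
lemma common_eigenvector:
  fixes A :: "'i \<Rightarrow> 'e::euclidean_space \<Rightarrow> 'e"
  assumes lin: "\<And>i. i \<in> I \<Longrightarrow> linear (A i)"
    and sym: "\<And>i x y. i \<in> I \<Longrightarrow> A i x \<bullet> y = x \<bullet> A i y"
    and comm: "\<And>i j x. i \<in> I \<Longrightarrow> j \<in> I \<Longrightarrow> A i (A j x) = A j (A i x)"
    and M: "subspace M" "M \<noteq> {0}" and inv: "\<And>i x. i \<in> I \<Longrightarrow> x \<in> M \<Longrightarrow> A i x \<in> M"
  shows "\<exists>w\<in>M. norm w = 1 \<and> (\<forall>i\<in>I. \<exists>\<mu>. A i w = \<mu> *\<^sub>R w)"
  using M inv
proof (induction "dim M" arbitrary: M rule: less_induct)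
  case less
  show ?case
  proof (cases "\<exists>i\<in>I. \<nexists>\<mu>. \<forall>w\<in>M. A i w = \<mu> *\<^sub>R w")
    case True
    then obtain i where i: "i \<in> I" "\<And>\<mu>. \<exists>w\<in>M. A i w \<noteq> \<mu> *\<^sub>R w" by blast
    obtain v \<mu> where v: "v \<in> M" "norm v = 1" "A i v = \<mu> *\<^sub>R v"
      using symmetric_eigenvector[OF lin[OF i(1)] sym[OF i(1)] less.prems(1,2)] less.prems(3) i(1)
      by metis
    define N where "N = {w\<in>M. A i w = \<mu> *\<^sub>R w}"
    have subN: "subspace N" using less.prems(1) lin[OF i(1)]
      by (auto simp: N_def subspace_def linear_add linear_scale linear_0 scaleR_add_right)
    have "N \<noteq> M" using i(2)[of \<mu>] by (auto simp: N_def)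
    moreover have "N \<subseteq> M" by (auto simp: N_def)
    ultimately have "dim N < dim M"
      using subspace_dim_equal[OF subN less.prems(1)] dim_subset[of N M] by force
    moreover have "v \<in> N" "v \<noteq> 0" using v by (auto simp: N_def)
    then have "N \<noteq> {0}" by blast
    moreover have "A j x \<in> N" if "j \<in> I" "x \<in> N" for j x
    proof -
      have x: "x \<in> M" "A i x = \<mu> *\<^sub>R x" using that(2) by (auto simp: N_def)
      have "A i (A j x) = \<mu> *\<^sub>R A j x"
        unfolding comm[OF i(1) that(1)] x(2) using lin[OF that(1)] by (simp add: linear_scale)
      then show ?thesis using less.prems(3)[OF that(1) x(1)] by (simp add: N_def)
    qed
    ultimately obtain w where "w \<in> N" "norm w = 1" "\<forall>i\<in>I. \<exists>\<mu>. A i w = \<mu> *\<^sub>R w"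
      using less.hyps[OF _ subN] by blast
    then show ?thesis using \<open>N \<subseteq> M\<close> by blast
  next
    case False
    obtain v where v: "v \<in> M" "v \<noteq> 0" using less.prems(1,2) subspace_0 by blast
    have "(1 / norm v) *\<^sub>R v \<in> M" "norm ((1 / norm v) *\<^sub>R v) = 1"
      using v less.prems(1) by (simp_all add: subspace_scale)
    then show ?thesis using False by blast
  qed
qed

text \<open>
Gram--Schmidt, phrased as a change of variables that turns an arbitrary scalar product into the standard one.
\<close>
lemma orthonormalizing_map_exists:
  fixes B :: "'e::euclidean_space \<Rightarrow> 'e \<Rightarrow> real"
  assumes bil: "bilinear B" and sym: "\<And>x y. B x y = B y x" and pos: "\<And>x. x \<noteq> 0 \<Longrightarrow> B x x > 0"
  obtains T :: "'e \<Rightarrow> 'e" where "linear T" "bij T" "\<And>x y. B (T x) (T y) = x \<bullet> y"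
proof -
  note B_simps = bilinear_ladd[OF bil] bilinear_radd[OF bil] bilinear_lsub[OF bil] bilinear_rsub[OF bil]
    bilinear_lmul[OF bil] bilinear_rmul[OF bil] bilinear_lzero[OF bil] bilinear_rzero[OF bil]
  have B_sum: "B (sum h I) y = (\<Sum>i\<in>I. B (h i) y)" "B y (sum h I) = (\<Sum>i\<in>I. B y (h i))"
    for h :: "'e \<Rightarrow> 'e" and I y
    by (induction I rule: infinite_finite_induct) (simp_all add: B_simps)
  have "\<exists>v. \<forall>b\<in>F. \<forall>c\<in>F. B (v b) (v c) = (if b = c then 1 else 0)" if "finite F" "F \<subseteq> Basis" for F :: "'e set"
    using that
  proof (induction F rule: finite_induct)
    case (insert a F)
    then obtain v where v: "\<And>b c. b \<in> F \<Longrightarrow> c \<in> F \<Longrightarrow> B (v b) (v c) = (if b = c then 1 else 0)" by auto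
    \<comment> \<open>fewer than DIM vectors cannot span, which leaves a vector to orthogonalise\<close>
    have "card F < card (insert a F)" using insert by simp
    also have "\<dots> \<le> DIM('e)" using insert by (intro card_mono) auto
    finally have "dim (v ` F) < DIM('e)"
      using dim_le_card[of "v ` F" "v ` F"] card_image_le[OF insert(1), of v] insert(1) span_superset by fastforce
    then have "span (v ` F) \<noteq> UNIV" using dim_eq_full[of "v ` F"] by simp
    then obtain x where x: "x \<notin> span (v ` F)" by blast
    define y where "y = x - (\<Sum>b\<in>F. B x (v b) *\<^sub>R v b)"
    have "(\<Sum>b\<in>F. B x (v b) *\<^sub>R v b) \<in> span (v ` F)" by (intro span_sum span_scale span_base) auto
    then have "y \<noteq> 0" using x by (auto simp: y_def)
    have yv: "B y (v c) = 0" if "c \<in> F" for c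
    proof -
      have "B y (v c) = B x (v c) - (\<Sum>b\<in>F. B x (v b) * B (v b) (v c))"
        by (simp add: y_def B_simps B_sum)
      also have "(\<Sum>b\<in>F. B x (v b) * B (v b) (v c)) = (\<Sum>b\<in>F. if b = c then B x (v c) else 0)"
        by (rule sum.cong) (auto simp: v that)
      finally show ?thesis using that insert(1) by simp
    qed
    define u where "u = (1 / sqrt (B y y)) *\<^sub>R y"
    have "B y y > 0" using pos \<open>y \<noteq> 0\<close> by blast
    then have u: "B u u = 1" by (simp add: u_def B_simps)
    have uv: "B u (v c) = 0" "B (v c) u = 0" if "c \<in> F" for c
      using yv[OF that] sym[of "v c"] by (simp_all add: u_def B_simps)
    have "\<forall>b\<in>insert a F. \<forall>c\<in>insert a F. B ((v(a := u)) b) ((v(a := u)) c) = (if b = c then 1 else 0)"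
      using v uv u insert(2) by auto
    then show ?case by blast
  qed simp
  from this[of Basis] obtain v :: "'e \<Rightarrow> 'e" where v: "\<And>b c. b \<in> Basis \<Longrightarrow> c \<in> Basis \<Longrightarrow> B (v b) (v c) = (if b = c then 1 else 0)"
    by auto
  define T where "T x = (\<Sum>b\<in>Basis. (x \<bullet> b) *\<^sub>R v b)" for x
  have lin: "linear T"
    by (rule linearI) (simp_all add: T_def inner_add_left scaleR_add_left sum.distrib scaleR_sum_right)
  have BT: "B (T x) (T y) = x \<bullet> y" for x y
  proof -
    have "B (T x) (T y) = (\<Sum>b\<in>Basis. (x \<bullet> b) * (\<Sum>c\<in>Basis. (y \<bullet> c) * B (v b) (v c)))"
    proof -
      have 1: "B (T x) (T y) = (\<Sum>b\<in>Basis. (x \<bullet> b) * B (v b) (T y))"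
        unfolding T_def[of x] B_sum(1) by (simp add: B_simps)
      have 2: "B (v b) (T y) = (\<Sum>c\<in>Basis. (y \<bullet> c) * B (v b) (v c))" for b
        unfolding T_def[of y] B_sum(2) by (simp add: B_simps)
      show ?thesis unfolding 1 2 ..
    qed
    also have "\<dots> = (\<Sum>b\<in>Basis. (x \<bullet> b) * (\<Sum>c\<in>Basis. if b = c then y \<bullet> b else 0))"
      by (intro sum.cong refl arg_cong2[where f = "(*)"]) (auto simp: v)
    also have "\<dots> = x \<bullet> y" by (simp add: euclidean_inner[of x y])
    finally show ?thesis .
  qed
  have "inj T"
    unfolding linear_injective_0[OF lin]
  proof (intro allI impI)
    fix x assume "T x = 0"
    then have "x \<bullet> x = 0" using BT[of x x] by (simp add: B_simps)
    then show "x = 0" by simp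
  qed
  then have "bij T" using linear_injective_imp_surjective[OF lin] by (simp add: bij_def)
  then show thesis using that[OF lin _ BT] by simp
qed

section \<open>Hermitian Lie algebras and their Strominger connection\<close>

primrec descending_series :: "('e::real_vector \<Rightarrow> 'e \<Rightarrow> 'e) \<Rightarrow> nat \<Rightarrow> 'e set" where
  "descending_series br 0 = UNIV"
| "descending_series br (Suc k) = span {br x y |x y. y \<in> descending_series br k}"

text \<open>
The data that a Lie-Hermitian manifold induces on its Lie algebra, with the metric already normalised to the
Euclidean one. The last assumption is the vanishing of the Nijenhuis tensor.
\<close>
locale hermitian_lie_algebra =
  fixes br :: "'e::euclidean_space \<Rightarrow> 'e \<Rightarrow> 'e" and J :: "'e \<Rightarrow> 'e"
  assumes br_bilinear: "bilinear br"
    and br_skew: "br x y = - br y x"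
    and jacobi: "br x (br y z) + br y (br z x) + br z (br x y) = 0"
    and J_linear: "linear J"
    and JJ: "J (J x) = - x"
    and J_isometry: "J x \<bullet> J y = x \<bullet> y"
    and integrable: "br (J x) (J y) = br x y + J (br (J x) y) + J (br x (J y))"

text \<open>
\<open>nb x y\<close> stands for \<open>\<nabla>\<^sub>x y\<close> on left invariant fields, where \<open>\<nabla>\<close> is the Strominger connection. The
assumption \<open>torsion_skew\<close> says that its torsion is totally skew, and \<open>bianchi\<close> is the one Kaehler-like symmetry
that does not already follow from \<open>nb_skew\<close> and \<open>nb_J\<close>.
\<close>
locale nilpotent_skl_algebra = hermitian_lie_algebra +
  fixes nb :: "'a::euclidean_space \<Rightarrow> 'a \<Rightarrow> 'a"
  assumes nb_bilinear: "bilinear nb"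
    and nb_skew: "nb x y \<bullet> w = - (y \<bullet> nb x w)"
    and nb_J: "nb x (J y) = J (nb x y)"
    and torsion_skew: "(nb x y - nb y x - br x y) \<bullet> w = - ((nb x w - nb w x - br x w) \<bullet> y)"
    and bianchi: "nb x (nb y z) - nb y (nb x z) - nb (br x y) z
      + (nb y (nb z x) - nb z (nb y x) - nb (br y z) x)
      + (nb z (nb x y) - nb x (nb z y) - nb (br z x) y) = 0"
    and nilpotent: "\<exists>K. descending_series br K = {0}"

context hermitian_lie_algebra
begin

declare descending_series.simps(2) [simp del]

lemmas br_simps = bilinear_ladd[OF br_bilinear] bilinear_radd[OF br_bilinear]
  bilinear_lsub[OF br_bilinear] bilinear_rsub[OF br_bilinear]
  bilinear_lneg[OF br_bilinear] bilinear_rneg[OF br_bilinear]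
  bilinear_lmul[OF br_bilinear] bilinear_rmul[OF br_bilinear]
  bilinear_lzero[OF br_bilinear] bilinear_rzero[OF br_bilinear]

lemmas J_simps = linear_add[OF J_linear] linear_diff[OF J_linear] linear_neg[OF J_linear]
  linear_scale[OF J_linear] linear_0[OF J_linear] JJ

lemma br_self [simp]: "br x x = 0"
proof -
  have "2 *\<^sub>R br x x = 0" using br_skew[of x x] by (simp add: scaleR_2 eq_neg_iff_add_eq_0)
  then show ?thesis by simp
qed

lemma J_skew: "J x \<bullet> y = - (x \<bullet> J y)"
  using J_isometry[of x "J y"] by (simp add: JJ)

lemma J_inner_self [simp]: "J x \<bullet> x = 0" "x \<bullet> J x = 0"
  using J_skew[of x x] by (simp_all add: inner_commute)

lemma J_eq_0_iff [simp]: "J x = 0 \<longleftrightarrow> x = 0"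
  using JJ[of x] J_simps(5) by (metis neg_equal_0_iff_equal)

lemma linear_br: "linear (br x)" "linear (\<lambda>x. br x y)"
  using br_bilinear by (auto simp: bilinear_def)

definition center :: "'e set"
  where "center = {z. \<forall>x. br z x = 0}"

lemma subspace_center: "subspace center"
  by (simp add: subspace_def center_def br_simps)

lemma centerI: "(\<And>x. br z x = 0) \<Longrightarrow> z \<in> center"
  by (simp add: center_def)

lemma center_br [simp]: "z \<in> center \<Longrightarrow> br z x = 0" "z \<in> center \<Longrightarrow> br x z = 0"
  using br_skew[of x z] by (auto simp: center_def)

lemma subspace_descending_series: "subspace (descending_series br k)"
  by (cases k) (simp_all only: descending_series.simps subspace_UNIV subspace_span)

lemma descending_series_step: "y \<in> descending_series br k \<Longrightarrow> br x y \<in> descending_series br (Suc k)"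
  unfolding descending_series.simps by (rule span_base) blast

lemma descending_series_antimono: "descending_series br (Suc k) \<subseteq> descending_series br k"
proof (induction k)
  case (Suc k)
  have "{br x y |x y. y \<in> descending_series br (Suc k)} \<subseteq> {br x y |x y. y \<in> descending_series br k}"
    using Suc by blast
  then have "span {br x y |x y. y \<in> descending_series br (Suc k)} \<subseteq> span {br x y |x y. y \<in> descending_series br k}"
    by (rule span_mono)
  then show ?case by (simp only: descending_series.simps)
qed simp

lemma funpow_br_in_descending_series: "((br x) ^^ k) y \<in> descending_series br k"
  by (induction k) (simp_all only: funpow.simps descending_series.simps(1) id_apply UNIV_I o_apply
      descending_series_step)

end

context nilpotent_skl_algebra
begin

lemmas nb_simps = bilinear_ladd[OF nb_bilinear] bilinear_radd[OF nb_bilinear]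
  bilinear_lsub[OF nb_bilinear] bilinear_rsub[OF nb_bilinear]
  bilinear_lneg[OF nb_bilinear] bilinear_rneg[OF nb_bilinear]
  bilinear_lmul[OF nb_bilinear] bilinear_rmul[OF nb_bilinear]
  bilinear_lzero[OF nb_bilinear] bilinear_rzero[OF nb_bilinear]

lemma linear_nb: "linear (nb x)" "linear (\<lambda>x. nb x y)"
  using nb_bilinear by (auto simp: bilinear_def)

lemma nb_inner_self [simp]: "nb x y \<bullet> y = 0"
  using nb_skew[of x y y] by (simp add: inner_commute)

definition T :: "'a \<Rightarrow> 'a \<Rightarrow> 'a"
  where "T x y = nb x y - nb y x - br x y"

lemma br_eq: "br x y = nb x y - nb y x - T x y"
  by (simp add: T_def)

lemma T_alt: "T x y = - T y x"
  using br_skew[of x y] by (simp add: T_def)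

lemma T_skew: "T x y \<bullet> w = - (T x w \<bullet> y)"
  unfolding T_def by (rule torsion_skew)

lemma T_cyclic: "T x y \<bullet> w = T y w \<bullet> x"
  using T_skew[of y x w] T_alt[of x y] by simp

lemma T_simps: "T (x + x') y = T x y + T x' y" "T x (y + y') = T x y + T x y'"
  "T (- x) y = - T x y" "T x (- y) = - T x y" "T (c *\<^sub>R x) y = c *\<^sub>R T x y"
  "T x (c *\<^sub>R y) = c *\<^sub>R T x y" "T 0 y = 0" "T x 0 = 0"
  by (simp_all add: T_def nb_simps br_simps algebra_simps)

lemma T_self [simp]: "T x y \<bullet> x = 0" "T x y \<bullet> y = 0" "T x x = 0"
proof -
  show x: "T x x = 0" for x by (simp add: T_def)
  show "T x y \<bullet> x = 0" "T x y \<bullet> y = 0"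
    using T_skew[of x y x] T_cyclic[of x y y] x by simp_all
qed

text \<open>
Since \<open>nb\<close> commutes with \<open>J\<close>, its part in the integrability condition cancels and the condition becomes one on
the torsion: as a 3-form, \<open>T\<close> has no component of type (3,0) or (0,3).
\<close>
lemma T_J: "T (J x) (J y) = T x y + J (T (J x) y) + J (T x (J y))"
  using integrable[of x y] unfolding T_def by (simp add: nb_J J_simps algebra_simps)

definition R :: "'a \<Rightarrow> 'a \<Rightarrow> 'a \<Rightarrow> 'a"
  where "R x y z = nb x (nb y z) - nb y (nb x z) - nb (br x y) z"

section \<open>Curvature and the parallelism of the center\<close>

lemma R_alt: "R x y z = - R y x z"
  using br_skew[of x y] by (simp add: R_def nb_simps)

lemma R_skew: "R x y z \<bullet> w = - (R x y w \<bullet> z)"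
proof -
  have "nb x (nb y z) \<bullet> w = nb y (nb x w) \<bullet> z" "nb y (nb x z) \<bullet> w = nb x (nb y w) \<bullet> z"
    "nb (br x y) z \<bullet> w = - (nb (br x y) w \<bullet> z)"
    using nb_skew[of x "nb y z" w] nb_skew[of y z "nb x w"] nb_skew[of y "nb x z" w]
      nb_skew[of x z "nb y w"] nb_skew[of "br x y" z w] by (simp_all add: inner_commute)
  then show ?thesis by (simp add: R_def inner_diff_left)
qed

lemma R_bianchi: "R x y z + R y z x + R z x y = 0"
  using bianchi by (simp add: R_def)

lemma R_J: "R x y (J z) = J (R x y z)"
  by (simp add: R_def nb_J J_simps)

text \<open>
The classical octahedron argument: the pair symmetry of a curvature tensor follows from the Bianchi identity and
the two skew symmetries.
\<close>
lemma R_pair: "R x y z \<bullet> w = R z w x \<bullet> y"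
proof -
  have b: "R a b c \<bullet> d + R b c a \<bullet> d + R c a b \<bullet> d = 0" for a b c d
    using R_bianchi[of a b c] by (metis inner_add_left inner_zero_left)
  have s: "R a b c \<bullet> d = - (R b a c \<bullet> d)" for a b c d
    using R_alt[of a b c] by simp
  show ?thesis
    using b[of x y z w] b[of y z w x] b[of z w x y] b[of w x y z]
      R_skew[of x y w z] R_skew[of y z w x] R_skew[of z x y w] R_skew[of z w y x]
      R_skew[of w y x z] R_skew[of w x z y] R_skew[of x z y w] R_skew[of x y z w]
      R_skew[of z w x y] R_skew[of y w z x] R_skew[of x w y z]
      s[of x z y w] s[of w z x y] s[of y x z w] s[of y w x z] s[of y w z x] s[of x w y z] s[of x w z y]
      s[of y z x w] s[of z y x w] s[of x z w y] s[of z x w y]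
    by argo
qed

lemma R_JJ: "R (J x) (J y) z = R x y z"
proof -
  have "R (J x) (J y) z \<bullet> w = R x y z \<bullet> w" for w
    unfolding R_pair[of "J x" "J y"] R_pair[of x y] by (simp add: R_J J_isometry)
  then show ?thesis by (metis vector_eq_rdot)
qed

text \<open>
This expresses the Ricci form through Ricci traces: summed over an orthonormal basis \<open>w\<close>, the left-hand side is
computable from a commutator, and the right-hand side consists of the curvatures entering the Ricci tensor.
\<close>
lemma R_holomorphic: "R x (J x) w \<bullet> J w = - (R (J x) w w \<bullet> J x) - R x w w \<bullet> x"
proof -
  have "R x (J x) w = - R (J x) w x - R w x (J x)"
    using R_bianchi[of x "J x" w] by (simp add: algebra_simps eq_neg_iff_add_eq_0)
  moreover have "R (J x) w x \<bullet> J w = R (J x) w w \<bullet> J x"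
    using R_skew[of "J x" w x "J w"] J_skew[of "R (J x) w w" x]
    by (simp add: R_J)
  moreover have "R w x (J x) \<bullet> J w = R x w w \<bullet> x"
    using R_skew[of w x x w] R_alt[of w x w] by (simp add: R_J J_isometry)
  ultimately show ?thesis by (simp add: inner_diff_left)
qed

lemma sum_J_invariant:
  assumes "linear f"
  shows "(\<Sum>b\<in>Basis. f (J b) \<bullet> J b) = (\<Sum>b\<in>Basis. f b \<bullet> b)"
proof -
  have "(\<Sum>b\<in>Basis. f (J b) \<bullet> J b) = - tr (\<lambda>b. J (f (J b)))"
    by (simp add: tr_def J_skew sum_negf)
  also have "\<dots> = - tr (\<lambda>b. f (J (J b)))"
    using tr_commute[of J "\<lambda>b. f (J b)"] J_linear assms
    by (simp add: linear_compose[unfolded o_def])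
  also have "\<dots> = tr f" using assms by (simp add: JJ linear_neg tr_minus)
  finally show ?thesis by (simp add: tr_def)
qed

lemma tr_ad: "tr (br x) = 0"
proof -
  obtain K where K: "descending_series br K = {0}" using nilpotent by blast
  show ?thesis
    using tr_nilpotent[OF linear_br(1) subspace_descending_series _ descending_series_antimono descending_series_step K]
    by simp
qed

lemma ad_funpow_eq_0: "\<exists>k>0. \<forall>x y. ((br x) ^^ k) y = 0"
proof -
  obtain K where K: "descending_series br K = {0}" using nilpotent by blast
  then have "descending_series br (Suc K) \<subseteq> {0}" using descending_series_antimono[of K] by simp
  then show ?thesis using funpow_br_in_descending_series[of "Suc K"] by (metis singletonD subsetD zero_less_Suc)
qed

text \<open>
\<open>ad x\<close> is then both skew symmetric and nilpotent, hence zero. This is how nilpotency of the group is used to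
recognise central elements.
\<close>
lemma skew_ad_eq_0:
  assumes "\<And>y. br x y \<bullet> y = 0"
  shows "x \<in> center"
proof -
  have skew: "br x y \<bullet> w = - (y \<bullet> br x w)" for y w
    using assms[of "y + w"] assms[of y] assms[of w]
    by (simp add: br_simps inner_add_left inner_add_right inner_commute)
  obtain k where "k > 0" "\<And>y. ((br x) ^^ k) y = 0" using ad_funpow_eq_0 by blast
  then have "br x y = 0" for y using skew_nilpotent_eq_0[OF skew] by blast
  then show ?thesis by (rule centerI)
qed

text \<open>
Nilpotent Lie algebras are unimodular, and \<open>nb b b \<bullet> y = br y b \<bullet> b\<close> because the torsion is skew.
\<close>
lemma sum_nb_self: "(\<Sum>b\<in>Basis. nb b b \<bullet> y) = 0"
proof -
  have "nb b b \<bullet> y = br y b \<bullet> b" for b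
  proof -
    have "br y b \<bullet> b = - (nb b y \<bullet> b)" by (simp add: br_eq inner_diff_left)
    then show ?thesis using nb_skew[of b b y] inner_commute[of b "nb b y"] by linarith
  qed
  then show ?thesis using tr_ad[of y] by (simp add: tr_def)
qed

context
  fixes z assumes z: "z \<in> center"
begin

lemma B_eq: "nb w z = nb z w - T z w"
  using br_eq[of z w] z by (simp add: algebra_simps)

text \<open>
The endomorphism \<open>w \<mapsto> \<nabla>\<^sub>w z\<close> of a central \<open>z\<close> differs from the skew endomorphism \<open>\<nabla>\<^sub>z\<close> only by torsion, so
it is skew too.
\<close>
lemma B_skew: "nb w z \<bullet> y = - (w \<bullet> nb y z)"
  unfolding B_eq inner_diff_left inner_diff_right
  using nb_skew[of z w y] T_skew[of z w y] inner_commute[of w "T z y"] by linarith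

lemma B_self: "nb z z = 0"
proof -
  have "nb z z \<bullet> nb z z = - (z \<bullet> nb (nb z z) z)" by (rule B_skew)
  also have "\<dots> = 0" using nb_inner_self[of "nb z z" z] by (simp add: inner_commute)
  finally show ?thesis by simp
qed

lemma ad_Jz_J: "br (J z) (J y) = J (br (J z) y)"
  using integrable[of z y] z by (simp add: J_simps)

text \<open>
As \<open>z\<close> and \<open>J z\<close> commute, \<open>R(z, J z)\<close> is the commutator of \<open>\<nabla>\<^sub>z\<close> and \<open>\<nabla>\<^bsub>J z\<^esub>\<close>; both commute with \<open>J\<close>, so the trace
of \<open>J\<close> times this commutator vanishes.
\<close>
lemma sum_ricci: "(\<Sum>b\<in>Basis. R z (J z) b \<bullet> J b) = 0"
proof -
  have eq: "R z (J z) b = nb z (nb (J z) b) - nb (J z) (nb z b)" for b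
    using z by (simp add: R_def nb_simps)
  have "(\<Sum>b\<in>Basis. R z (J z) b \<bullet> J b)
      = - tr (\<lambda>b. J (nb z (nb (J z) b))) + tr (\<lambda>b. J (nb (J z) (nb z b)))"
    by (simp add: tr_def eq inner_diff_left J_skew sum_subtractf sum_negf)
  also have "tr (\<lambda>b. J (nb (J z) (nb z b))) = tr (\<lambda>b. nb (J z) (nb z (J b)))"
    using nb_J by simp
  also have "\<dots> = tr (\<lambda>b. nb z (J (nb (J z) b)))"
    using tr_commute[of "nb (J z)" "\<lambda>b. nb z (J b)"] linear_nb J_linear
    by (simp add: linear_compose[unfolded o_def])
  finally show ?thesis using nb_J by simp
qed

text \<open>
The Ricci curvature in direction \<open>J z\<close>: by \<open>R_holomorphic\<close> the Ricci form of \<open>(z, J z)\<close> is minus the sum of the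
Ricci curvatures of \<open>z\<close> and \<open>J z\<close>, and these two agree because \<open>R\<close> is \<open>J\<close>-invariant.
\<close>
lemma sum_K_Jz: "(\<Sum>b\<in>Basis. R (J z) b b \<bullet> J z) = 0"
proof -
  define f where "f w = - R (J z) w (J z)" for w
  have lin: "linear f"
    by (rule linearI) (simp_all add: f_def R_def nb_simps br_simps algebra_simps)
  have K: "R (J z) w w \<bullet> J z = f w \<bullet> w" for w
    using R_skew[of "J z" w w "J z"] by (simp add: f_def)
  have K': "R z w w \<bullet> z = f (J w) \<bullet> J w" for w
    unfolding K[symmetric] R_JJ by (simp add: R_J J_isometry)
  have "(\<Sum>b\<in>Basis. R z (J z) b \<bullet> J b) = - 2 * (\<Sum>b\<in>Basis. f b \<bullet> b)"
    unfolding R_holomorphic K K' sum_subtractf sum_negf sum_J_invariant[OF lin] by simp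
  then show ?thesis using sum_ricci K by simp
qed

text \<open>
Write \<open>B w = \<nabla>\<^sub>w z\<close>, \<open>a = ad (J z)\<close> and \<open>E = J B + B J\<close>. The symmetric part of \<open>a\<close> is \<open>- E / 2\<close>, so
\<open>\<Sum> \<parallel>E b\<parallel>\<^sup>2 = - 2 tr (E a)\<close>. On the other hand, expanding the vanishing Ricci curvature of \<open>J z\<close> in terms of \<open>nb\<close>
leaves exactly \<open>tr (J B a)\<close>, which is half of \<open>tr (E a)\<close> since \<open>a\<close> commutes with \<open>J\<close>. Hence \<open>E = 0\<close>.
\<close>
lemma JB_plus_BJ: "J (nb w z) + nb (J w) z = 0"
proof -
  define a where "a = br (J z)"
  define B where "B w = nb w z" for w
  define E where "E w = J (B w) + B (J w)" for w
  have linB: "linear B" unfolding B_def by (rule linear_nb)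
  have lina: "linear a" unfolding a_def by (rule linear_br)
  have linE: "linear E" unfolding E_def
    by (intro linear_compose_add linear_compose[unfolded o_def, OF linB J_linear]
        linear_compose[unfolded o_def, OF J_linear linB])
  have Esym: "E w \<bullet> y = w \<bullet> E y" for w y
    by (simp add: E_def B_def inner_add_left inner_add_right J_skew B_skew nb_simps)
  have a_sym: "a w \<bullet> y + w \<bullet> a y = - (E w \<bullet> y)" for w y
  proof -
    have "a w = nb (J z) w - J (B w) - T (J z) w" for w
      by (simp add: a_def B_def br_eq nb_J)
    moreover have "J (B y) \<bullet> w = y \<bullet> B (J w)"
      using J_skew[of "B y" w] B_skew[of y "J w"] by (simp add: B_def)
    ultimately show ?thesis using nb_skew[of "J z" w y] T_skew[of "J z" w y]
      by (simp add: inner_diff_left inner_diff_right E_def inner_add_left inner_add_right inner_commute)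
  qed
  have expand: "R (J z) b b \<bullet> J z = nb (J z) b \<bullet> J (B b) + J (B (a b)) \<bullet> b - nb b b \<bullet> J (nb (J z) z)" for b
  proof -
    have "nb (J z) (nb b b) \<bullet> J z = - (nb b b \<bullet> J (nb (J z) z))"
      by (simp add: nb_skew nb_J)
    moreover have "nb b (nb (J z) b) \<bullet> J z = - (nb (J z) b \<bullet> J (B b))"
      by (simp add: nb_skew[of b] nb_J B_def)
    moreover have "nb (br (J z) b) b \<bullet> J z = - (J (B (a b)) \<bullet> b)"
      by (simp add: nb_skew[of "br (J z) b"] nb_J B_def a_def inner_commute[of b])
    ultimately show ?thesis by (simp add: R_def inner_diff_left)
  qed
  \<comment> \<open>J composed with \<open>\<nabla>\<^bsub>J z\<^esub>\<close> is symmetric and B is skew, so their product has trace zero\<close>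
  have zero1: "(\<Sum>b\<in>Basis. nb (J z) b \<bullet> J (B b)) = 0"
  proof -
    define S where "S w = J (nb (J z) w)" for w
    have linS: "linear S" unfolding S_def by (intro linear_compose[unfolded o_def, OF linear_nb(1) J_linear])
    have Ssym: "S w \<bullet> y = w \<bullet> S y" for w y
      by (simp add: S_def J_skew nb_skew nb_J)
    have t: "(\<Sum>b\<in>Basis. nb (J z) b \<bullet> J (B b)) = - tr (\<lambda>b. S (B b))"
      unfolding tr_def sum_negf[symmetric]
    proof (rule sum.cong[OF refl])
      fix b
      have "S (B b) \<bullet> b = B b \<bullet> S b" by (rule Ssym)
      also have "\<dots> = - (J (B b) \<bullet> nb (J z) b)" using J_skew[of "B b" "nb (J z) b"] by (simp add: S_def)
      finally show "nb (J z) b \<bullet> J (B b) = - (S (B b) \<bullet> b)" by (simp add: inner_commute)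
    qed
    have "S (B b) \<bullet> b = - (B (S b) \<bullet> b)" for b
    proof -
      have "S (B b) \<bullet> b = B b \<bullet> S b" by (rule Ssym)
      also have "\<dots> = - (b \<bullet> B (S b))" unfolding B_def by (rule B_skew)
      finally show ?thesis by (simp add: inner_commute)
    qed
    then have "tr (\<lambda>b. S (B b)) = - tr (\<lambda>b. B (S b))" by (simp add: tr_def sum_negf)
    with tr_commute[OF linS linB] have "tr (\<lambda>b. S (B b)) = 0" by simp
    with t show ?thesis by simp
  qed
  \<comment> \<open>the last term of expand sums to zero by unimodularity\<close>
  have sumJBa: "tr (\<lambda>b. J (B (a b))) = 0"
    using sum_K_Jz unfolding expand sum_subtractf sum.distrib sum_nb_self zero1 by (simp add: tr_def)
  have "tr (\<lambda>b. J (B (a b))) = tr (\<lambda>b. B (J (a b)))"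
  proof -
    have "tr (\<lambda>b. J (B (a b))) = tr (\<lambda>b. B (a (J b)))"
      using tr_commute[of J "\<lambda>b. B (a b)"] J_linear linB lina
      by (simp add: linear_compose[unfolded o_def])
    then show ?thesis by (simp add: a_def ad_Jz_J)
  qed
  then have tE: "tr (\<lambda>b. E (a b)) = 0"
    unfolding E_def tr_add using sumJBa by simp
  have "(\<Sum>b\<in>Basis. E b \<bullet> E b) = - 2 * tr (\<lambda>b. E (a b))"
  proof -
    have "E b \<bullet> E b = - (E (a b) \<bullet> b) - a (E b) \<bullet> b" for b
      using a_sym[of b "E b"] Esym[of "a b" b] by (simp add: inner_commute)
    then have "(\<Sum>b\<in>Basis. E b \<bullet> E b) = - tr (\<lambda>b. E (a b)) - tr (\<lambda>b. a (E b))"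
      by (simp add: tr_def sum_subtractf sum_negf)
    then show ?thesis using tr_commute[OF linE lina] by simp
  qed
  then have "(\<Sum>b\<in>Basis. E b \<bullet> E b) = 0" using tE by simp
  then have "\<forall>b\<in>Basis. E b \<bullet> E b = 0" by (subst (asm) sum_nonneg_eq_0_iff) auto
  then have "E b = 0" if "b \<in> Basis" for b using that by simp
  then have "E w = 0" using linear_eq_stdbasis[OF linE linear_zero] by metis
  then show ?thesis by (simp add: E_def B_def)
qed

text \<open>
With \<open>JB_plus_BJ\<close> the operator \<open>J B\<close> is skew, and then so is \<open>ad (J z)\<close>.
\<close>
lemma J_center: "J z \<in> center"
proof (rule skew_ad_eq_0)
  fix y
  have "br (J z) y = nb (J z) y - J (nb y z) - T (J z) y" by (simp add: br_eq nb_J)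
  moreover have "J (nb y z) \<bullet> y = 0"
    using JB_plus_BJ[of y] J_skew[of "nb y z" y] B_skew[of y "J y"] nb_inner_self
    by (metis B_skew J_skew add_eq_0_iff inner_commute inner_minus_left neg_equal_zero)
  ultimately show "br (J z) y \<bullet> y = 0" by (simp add: inner_diff_left)
qed

text \<open>
Once \<open>B\<close> anticommutes with \<open>J\<close>, the summands of the vanishing trace \<open>sum_ricci\<close> are the nonnegative numbers
\<open>2 \<parallel>B b\<parallel>\<^sup>2\<close>.
\<close>
lemma center_parallel: "nb w z = 0"
proof -
  define B where "B w = nb w z" for w
  have JB: "B (J w) = - J (B w)" for w
    using JB_plus_BJ[of w] by (simp add: B_def eq_neg_iff_add_eq_0 add.commute)
  have Bz: "B (J z) = 0" using JB[of z] B_self by (simp add: B_def J_simps)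
  have "R b (J b) z \<bullet> J z = 2 * (B b \<bullet> B b)" for b
  proof -
    have "nb b (nb (J b) z) \<bullet> J z = - (B (J b) \<bullet> J (B b))"
      by (simp add: nb_skew[of b] nb_J B_def)
    moreover have "nb (J b) (nb b z) \<bullet> J z = - (B b \<bullet> J (B (J b)))"
      by (simp add: nb_skew[of "J b"] nb_J B_def)
    moreover have "nb (br b (J b)) z \<bullet> J z = 0"
      using B_skew[of "br b (J b)" "J z"] Bz by (simp add: B_def)
    ultimately show ?thesis by (simp add: R_def inner_diff_left JB J_isometry J_simps)
  qed
  then have "(\<Sum>b\<in>Basis. 2 * (B b \<bullet> B b)) = 0"
    using sum_ricci unfolding R_pair[of z] by simp
  then have "\<forall>b\<in>Basis. 2 * (B b \<bullet> B b) = 0" by (subst (asm) sum_nonneg_eq_0_iff) auto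
  then have "B b = 0" if "b \<in> Basis" for b using that by simp
  moreover have "linear B" unfolding B_def by (rule linear_nb)
  ultimately have "B w = 0" using linear_eq_stdbasis[OF _ linear_zero] by metis
  then show ?thesis by (simp add: B_def)
qed

end

end

section \<open>The center acts by commuting rotations\<close>

context nilpotent_skl_algebra
begin

lemma J_in_center [simp]: "z \<in> center \<Longrightarrow> J z \<in> center"
  by (rule J_center)

lemma nb_center_right [simp]: "z \<in> center \<Longrightarrow> nb w z = 0"
  by (rule center_parallel)

lemma nb_center: "z \<in> center \<Longrightarrow> nb z w = T z w"
  using B_eq[of z w] by simp

lemma T_inner_center: "z \<in> center \<Longrightarrow> T x y \<bullet> z = nb z x \<bullet> y"
  using T_cyclic[of z x y] by (simp add: nb_center)

lemma br_inner_center: 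
  assumes "z \<in> center"
  shows "br y w \<bullet> z = - (nb z y \<bullet> w)"
proof -
  have "nb y w \<bullet> z = 0" "nb w y \<bullet> z = 0"
    using nb_skew[of y w z] nb_skew[of w y z] assms by simp_all
  then show ?thesis using T_inner_center[OF assms, of y w] by (simp add: br_eq inner_diff_left)
qed

text \<open>
By pair symmetry \<open>R(z, x)\<close> sees \<open>z\<close> only as the argument of the derivative, where it is parallel; and \<open>[z, x] = 0\<close>.
\<close>
lemma nb_center_commute: 
  assumes "z \<in> center"
  shows "nb z (nb x u) = nb x (nb z u)"
proof -
  have "R z x u \<bullet> w = 0" for w
    unfolding R_pair[of z x] using assms by (simp add: R_def nb_simps)
  then have "R z x u = 0" by (metis inner_eq_zero_iff)
  then show ?thesis using assms by (simp add: R_def nb_simps)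
qed

text \<open>
The Jacobi identity for \<open>w, x, y\<close> paired with \<open>z\<close>. Of the three summands of each bracket, the two derivatives
cancel in pairs since every \<open>\<nabla>\<^sub>a\<close> commutes with \<open>\<nabla>\<^sub>z\<close>, and only the torsion survives.
\<close>
lemma T_center_cyclic:
  assumes z: "z \<in> center"
  shows "T w x \<bullet> nb z y + T x y \<bullet> nb z w + T y w \<bullet> nb z x = 0"
proof -
  have J: "br (br w x) y + br (br x y) w + br (br y w) x = 0"
  proof -
    have "br (br w x) y + br (br x y) w + br (br y w) x = - (br y (br w x) + br w (br x y) + br x (br y w))"
      using br_skew[of "br w x" y] br_skew[of "br x y" w] br_skew[of "br y w" x] by simp
    also have "\<dots> = 0" using jacobi[of w x y] by (simp add: add.commute add.left_commute)
    finally show ?thesis .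
  qed
  have b: "br (br a b) c \<bullet> z = br a b \<bullet> nb z c" for a b c
    using br_inner_center[OF z, of "br a b" c] nb_skew[of z "br a b" c] by simp
  have sum: "br w x \<bullet> nb z y + br x y \<bullet> nb z w + br y w \<bullet> nb z x = 0"
    using arg_cong[OF J, of "\<lambda>v. v \<bullet> z"] by (simp add: inner_add_left b)
  have t: "nb a b \<bullet> nb z c = nb a c \<bullet> nb z b" for a b c
  proof -
    have "nb a b \<bullet> nb z c = - (b \<bullet> nb z (nb a c))"
      unfolding nb_center_commute[OF z] by (rule nb_skew)
    then show ?thesis using nb_skew[of z b "nb a c"] inner_commute[of "nb a c" "nb z b"] by linarith
  qed
  have e: "br a b \<bullet> nb z c = nb a b \<bullet> nb z c - nb b a \<bullet> nb z c - T a b \<bullet> nb z c" for a b c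
    by (simp only: br_eq inner_diff_left)
  show ?thesis
    using sum t[of w x y] t[of x y w] t[of y w x] e[of w x y] e[of x y w] e[of y w x] by argo
qed

text \<open>
A reformulation of \<open>T_center_cyclic\<close>: the rotations generated by central elements preserve the torsion.
\<close>
lemma nb_center_derivation:
  assumes z: "z \<in> center"
  shows "nb z (T x y) = T (nb z x) y + T x (nb z y)"
proof -
  have "nb z (T x y) \<bullet> w = (T (nb z x) y + T x (nb z y)) \<bullet> w" for w
    using T_center_cyclic[OF z, of x y w] nb_skew[of z "T x y" w]
      T_cyclic[of "nb z x" y w] T_cyclic[of x "nb z y" w] T_cyclic[of "nb z y" w x]
    unfolding inner_add_left by linarith
  then show ?thesis by (metis vector_eq_rdot)
qed

text \<open>
The orthogonal complement of the center; all derivatives take values in it because the center is parallel.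
\<close>
definition W :: "'a set"
  where "W = {w. \<forall>z\<in>center. w \<bullet> z = 0}"

lemma subspace_W: "subspace W"
  by (simp add: subspace_def W_def inner_add_left)

lemma W_inner_center: "w \<in> W \<Longrightarrow> z \<in> center \<Longrightarrow> w \<bullet> z = 0" "w \<in> W \<Longrightarrow> z \<in> center \<Longrightarrow> z \<bullet> w = 0"
  by (simp_all add: W_def inner_commute[of z w])

lemma nb_in_W [simp]: "nb x y \<in> W"
  by (simp add: W_def nb_skew)

lemma J_in_W [simp]: "w \<in> W \<Longrightarrow> J w \<in> W"
  by (simp add: W_def J_skew)

lemma W_center_eq_0: "x \<in> W \<Longrightarrow> x \<in> center \<Longrightarrow> x = 0"
  using W_inner_center inner_eq_zero_iff by blast

lemma center_W_decomp:
  obtains z w where "z \<in> center" "w \<in> W" "x = z + w"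
proof -
  obtain P where P: "linear P" "\<And>x. P x \<in> center" "\<And>x. x \<in> center \<Longrightarrow> P x = x"
    "\<And>x y. y \<in> center \<Longrightarrow> (x - P x) \<bullet> y = 0"
    using orthogonal_projection_exists[OF subspace_center] by metis
  show thesis by (rule that[of "P x" "x - P x"]) (auto simp: P W_def)
qed

lemma in_centerI:
  assumes "\<And>b. b \<in> W \<Longrightarrow> x \<bullet> b = 0"
  shows "x \<in> center"
proof -
  obtain z w where x: "z \<in> center" "w \<in> W" "x = z + w" using center_W_decomp .
  then have "w \<bullet> w = 0" using assms[of w] W_inner_center[of w z] by (simp add: inner_add_left)
  then show ?thesis using x by simp
qed

text \<open>
Follow the descending central series inside the ideal: if the ideal missed the center, every step could be
continued by a nonzero bracket, contradicting nilpotency.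
\<close>
lemma ideal_meets_center:
  assumes ideal: "\<And>x y. x \<in> I \<Longrightarrow> br y x \<in> I" and "x \<in> I" "x \<noteq> 0"
  obtains y where "y \<in> I" "y \<in> center" "y \<noteq> 0"
proof (rule ccontr)
  assume "\<not> thesis"
  with that have no: "y \<notin> center" if "y \<in> I" "y \<noteq> 0" for y using that by blast
  have "\<exists>y\<in>I. y \<noteq> 0 \<and> y \<in> descending_series br k" for k
  proof (induction k)
    case 0 then show ?case using assms by auto
  next
    case (Suc k)
    then obtain y where y: "y \<in> I" "y \<noteq> 0" "y \<in> descending_series br k" by blast
    then obtain u where "br y u \<noteq> 0" using no[of y] centerI by blast
    then have "br u y \<noteq> 0" using br_skew[of y u] by simp
    then show ?case using ideal[OF y(1)] descending_series_step[OF y(3)] by blast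
  qed
  moreover obtain K where "descending_series br K = {0}" using nilpotent by blast
  ultimately show False by blast
qed

text \<open>
The vectors of \<open>W\<close> killed by all \<open>\<nabla>\<^sub>z\<close> form an ideal, which therefore would meet the center, but \<open>W\<close> does not.
For the ideal property let \<open>U\<close> be the complement of \<open>W0\<close> in \<open>W\<close> and \<open>x \<in> W0\<close>. Relative to \<open>W0\<close> and \<open>U\<close> the operator
\<open>ad x\<close> is block triangular, and its diagonal block on \<open>U\<close> is the skew map \<open>L\<close>; as \<open>ad x\<close> is nilpotent, \<open>L\<close>
vanishes.
\<close>
lemma flat_part_trivial:
  assumes "w \<in> W" "\<And>z. z \<in> center \<Longrightarrow> nb z w = 0"
  shows "w = 0"
proof -
  define W0 where "W0 = {w\<in>W. \<forall>z\<in>center. nb z w = 0}"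
  define U where "U = {u\<in>W. \<forall>x\<in>W0. u \<bullet> x = 0}"
  have sub: "subspace W0" "subspace U"
    using subspace_W by (auto simp: W0_def U_def subspace_def nb_simps inner_add_left)
  have W0_W: "x \<in> W0 \<Longrightarrow> x \<in> W" and W0_nb: "x \<in> W0 \<Longrightarrow> z \<in> center \<Longrightarrow> nb z x = 0" for x z
    by (auto simp: W0_def)
  have nbW0: "nb y x \<in> W0" if "x \<in> W0" for x y
    using that nb_center_commute[of _ y x] by (auto simp: W0_def nb_simps)
  have TW0: "T x y \<in> W0" if "x \<in> W0" "y \<in> W0" for x y
    using that by (simp add: W0_def W_def T_inner_center nb_center_derivation T_simps)
  have brW0: "br x y \<in> W0" if "x \<in> W0" "y \<in> W0" for x y
    using that nbW0 TW0 sub(1) by (simp add: br_eq subspace_diff)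
  have nbU: "nb y u \<in> U" if "u \<in> U" for u y
    using that nbW0 by (simp add: U_def nb_skew)
  have TU: "T x u \<in> U" if "x \<in> W0" "u \<in> U" for x u
  proof -
    have "T x u \<bullet> y = 0" if "y \<in> W0" for y
      using T_skew[of x u y] TW0[OF \<open>x \<in> W0\<close> that] \<open>u \<in> U\<close> inner_commute[of u "T x y"] by (simp add: U_def)
    moreover have "T x u \<in> W" using \<open>x \<in> W0\<close> by (simp add: W_def T_inner_center W0_nb)
    ultimately show ?thesis by (simp add: U_def)
  qed
  have key: "br x u \<in> W0" if x: "x \<in> W0" and u: "u \<in> U" for x u
  proof -
    define L where "L u = nb x u - T x u" for u
    have L_skew: "L v \<bullet> w = - (v \<bullet> L w)" for v w
      using nb_skew[of x v w] T_skew[of x v w]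
      by (simp add: L_def inner_diff_left inner_diff_right inner_commute[of "T x w"])
    have LU: "(L ^^ k) u \<in> U" for k
      by (induction k) (use u nbU TU[OF x] sub(2) in \<open>auto simp: L_def subspace_diff\<close>)
    have brL: "br x v = L v - nb v x" for v by (simp add: L_def br_eq)
    \<comment> \<open>modulo W0, powers of ad x agree with powers of its diagonal block L\<close>
    have diff: "((br x) ^^ k) u - (L ^^ k) u \<in> W0" for k
    proof (induction k)
      case 0 then show ?case using sub(1) by (simp add: subspace_0)
    next
      case (Suc k)
      define d where "d = ((br x) ^^ k) u - (L ^^ k) u"
      have "(br x ^^ Suc k) u - (L ^^ Suc k) u = br x d - nb ((L ^^ k) u) x"
        by (simp add: d_def br_simps brL[of "(L ^^ k) u"])
      also have "\<dots> \<in> W0" using Suc brW0[OF x] nbW0[OF x] sub(1) by (simp add: d_def subspace_diff)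
      finally show ?case .
    qed
    obtain k where k: "k > 0" "\<forall>v w. ((br v) ^^ k) w = 0" using ad_funpow_eq_0 by blast
    \<comment> \<open>W0 and U are orthogonal, so this power of L kills u, and L is skew\<close>
    have "(L ^^ k) u \<in> W0" using diff[of k] k sub(1) by (simp add: subspace_neg[of W0 "- _", simplified])
    then have "(L ^^ k) u \<bullet> (L ^^ k) u = 0" using LU[of k] unfolding U_def by blast
    then have "(L ^^ k) u = 0" by simp
    then have "L u = 0" using skew_nilpotent_eq_0[OF L_skew] k(1) by blast
    then show ?thesis using nbW0[OF x] sub(1) by (simp add: brL subspace_neg)
  qed
  obtain P where P: "linear P" "\<And>x. P x \<in> W0" "\<And>x. x \<in> W0 \<Longrightarrow> P x = x"
    "\<And>x y. y \<in> W0 \<Longrightarrow> (x - P x) \<bullet> y = 0"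
    using orthogonal_projection_exists[OF sub(1)] by metis
  have ideal: "br y x \<in> W0" if x: "x \<in> W0" for x y
  proof -
    obtain z v where y: "z \<in> center" "v \<in> W" "y = z + v" using center_W_decomp .
    have "v - P v \<in> U" using P(4) y(2) W0_W[OF P(2)] subspace_W by (simp add: U_def subspace_diff)
    then have "br x (P v) + br x (v - P v) \<in> W0"
      using brW0[OF x P(2)] key[OF x] sub(1) by (simp add: subspace_add)
    then have "br x y \<in> W0" using y(1) by (simp add: y(3) br_simps)
    then show ?thesis using br_skew[of y x] sub(1) by (simp add: subspace_neg)
  qed
  show ?thesis
  proof (rule ccontr)
    assume "w \<noteq> 0"
    moreover have "w \<in> W0" using assms by (simp add: W0_def)
    ultimately obtain y where "y \<in> W0" "y \<in> center" "y \<noteq> 0" using ideal_meets_center[OF ideal] by metis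
    then show False using W0_W W_center_eq_0 by blast
  qed
qed

text \<open>
The joint eigenspaces of the commuting family \<open>\<nabla>\<^sub>z\<close>, \<open>z\<close> central. Their real form is a rotation, and the weight, a
linear functional on the center, is represented by a vector \<open>\<kappa>\<close>.
\<close>
definition E :: "'a \<Rightarrow> 'a set"
  where "E \<kappa> = {w\<in>W. \<forall>z\<in>center. nb z w = - (\<kappa> \<bullet> z) *\<^sub>R J w}"

lemma E_nb: "w \<in> E \<kappa> \<Longrightarrow> z \<in> center \<Longrightarrow> nb z w = - (\<kappa> \<bullet> z) *\<^sub>R J w"
  and E_W: "w \<in> E \<kappa> \<Longrightarrow> w \<in> W"
  by (auto simp: E_def)

lemma subspace_E: "subspace (E \<kappa>)"
  using subspace_W by (auto simp: E_def subspace_def nb_simps J_simps algebra_simps)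

lemma J_in_E [simp]: "w \<in> E \<kappa> \<Longrightarrow> J w \<in> E \<kappa>"
  by (simp add: E_def nb_J J_simps)

lemma nb_in_E [simp]: "w \<in> E \<kappa> \<Longrightarrow> nb x w \<in> E \<kappa>"
  using nb_center_commute[of _ x w] by (auto simp: E_def nb_J nb_simps)

lemma E_orthogonal:
  assumes "\<kappa> \<in> center" "\<psi> \<in> center" "\<kappa> \<noteq> \<psi>" "a \<in> E \<kappa>" "b \<in> E \<psi>"
  shows "a \<bullet> b = 0"
proof -
  have z: "\<kappa> - \<psi> \<in> center" using assms subspace_center by (simp add: subspace_diff)
  have "nb (\<kappa> - \<psi>) (J a) \<bullet> b = - (J a \<bullet> nb (\<kappa> - \<psi>) b)" by (rule nb_skew)
  then have "((\<kappa> - \<psi>) \<bullet> (\<kappa> - \<psi>)) * (a \<bullet> b) = 0"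
    using E_nb[OF J_in_E[OF assms(4)] z] E_nb[OF assms(5) z]
    by (simp add: J_isometry JJ inner_diff_left algebra_simps)
  then show ?thesis using assms(3) by simp
qed

text \<open>
The operators \<open>J \<nabla>\<^sub>z\<close> are symmetric and commute, so they have a common unit eigenvector \<open>w\<close>. Its weight is
represented by the central component of \<open>[w, J w]\<close>, by \<open>br_inner_center\<close>.
\<close>
lemma character_exists:
  assumes S: "subspace S" "S \<subseteq> W" "S \<noteq> {0}"
    and J: "\<And>w. w \<in> S \<Longrightarrow> J w \<in> S" and nb: "\<And>z w. z \<in> center \<Longrightarrow> w \<in> S \<Longrightarrow> nb z w \<in> S"
  obtains w \<kappa> where "w \<in> S" "norm w = 1" "\<kappa> \<in> center" "w \<in> E \<kappa>"
proof -
  have "\<exists>w\<in>S. norm w = 1 \<and> (\<forall>z\<in>center. \<exists>\<mu>. J (nb z w) = \<mu> *\<^sub>R w)"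
  proof (rule common_eigenvector)
    show "linear (\<lambda>w. J (nb z w))" for z
      by (intro linear_compose[unfolded o_def, OF linear_nb(1) J_linear])
    show "J (nb z x) \<bullet> y = x \<bullet> J (nb z y)" for z x y
      by (simp add: J_skew nb_skew nb_J)
    show "J (nb z (J (nb z' x))) = J (nb z' (J (nb z x)))" if "z \<in> center" "z' \<in> center" for z z' x
      using nb_center_commute[OF that(1)] by (simp add: nb_J)
  qed (use S J nb in auto)
  then obtain w where w: "w \<in> S" "norm w = 1" "\<And>z. z \<in> center \<Longrightarrow> \<exists>\<mu>. J (nb z w) = \<mu> *\<^sub>R w" by blast
  \<comment> \<open>the weight is represented by the central part of [w, J w], as w has length 1\<close>
  obtain \<kappa> v where \<kappa>: "\<kappa> \<in> center" "v \<in> W" "br w (J w) = \<kappa> + v" using center_W_decomp .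
  have "nb z w = - (\<kappa> \<bullet> z) *\<^sub>R J w" if z: "z \<in> center" for z
  proof -
    obtain \<mu> where "J (nb z w) = \<mu> *\<^sub>R w" using w(3)[OF z] by blast
    then have "J (J (nb z w)) = \<mu> *\<^sub>R J w" by (simp add: J_simps)
    then have m: "nb z w = - \<mu> *\<^sub>R J w" by (simp add: JJ minus_equation_iff[of "nb z w"])
    have "\<kappa> \<bullet> z = br w (J w) \<bullet> z" using \<kappa> W_inner_center[OF \<kappa>(2) z] by (simp add: inner_add_left)
    also have "\<dots> = \<mu> * (w \<bullet> w)" by (simp add: br_inner_center[OF z] m J_isometry)
    also have "\<dots> = \<mu>" using w(2) by (simp add: dot_square_norm)
    finally show ?thesis using m by simp
  qed
  then have "w \<in> E \<kappa>" using w(1) S(2) by (auto simp: E_def)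
  then show thesis using that w \<kappa>(1) by blast
qed

text \<open>
The eigenspaces \<open>E \<kappa>\<close> span \<open>W\<close>: otherwise \<open>character_exists\<close> would find one inside the orthogonal complement of
them all.
\<close>
lemma character_component:
  assumes "y \<in> W" "y \<noteq> 0"
  obtains \<kappa> u v where "\<kappa> \<in> center" "u \<in> E \<kappa>" "u \<noteq> 0" "y = u + v" "v \<in> W" "\<And>e. e \<in> E \<kappa> \<Longrightarrow> v \<bullet> e = 0"
proof -
  define S where "S = {w\<in>W. \<forall>\<kappa>\<in>center. \<forall>e\<in>E \<kappa>. w \<bullet> e = 0}"
  have "y \<notin> S"
  proof
    assume "y \<in> S"
    then have "S \<noteq> {0}" using assms by blast
    moreover have "subspace S" using subspace_W by (auto simp: S_def subspace_def inner_add_left)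
    ultimately obtain w \<kappa> where "w \<in> S" "norm w = 1" "\<kappa> \<in> center" "w \<in> E \<kappa>"
      by (rule_tac character_exists[of S]) (auto simp: S_def J_skew nb_skew)
    then have "w \<bullet> w = 0" by (simp add: S_def)
    then show False using \<open>norm w = 1\<close> by simp
  qed
  then obtain \<kappa> e where \<kappa>: "\<kappa> \<in> center" "e \<in> E \<kappa>" "y \<bullet> e \<noteq> 0" using assms by (auto simp: S_def)
  obtain P where P: "linear P" "\<And>x. P x \<in> E \<kappa>" "\<And>x. x \<in> E \<kappa> \<Longrightarrow> P x = x"
    "\<And>x y. y \<in> E \<kappa> \<Longrightarrow> (x - P x) \<bullet> y = 0"
    using orthogonal_projection_exists[OF subspace_E] by metis
  show thesis
  proof (rule that[OF \<kappa>(1) P(2)])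
    show "P y \<noteq> 0" using P(4)[OF \<kappa>(2), of y] \<kappa>(3) by auto
    show "y = P y + (y - P y)" by simp
    show "y - P y \<in> W" using assms E_W[OF P(2)] subspace_W by (simp add: subspace_diff)
    show "(y - P y) \<bullet> e = 0" if "e \<in> E \<kappa>" for e using P(4)[OF that] .
  qed
qed

text \<open>
All \<open>\<nabla>\<^sub>x\<close> preserve \<open>E \<kappa>\<close>, hence so does \<open>R(c, d)\<close>; pair symmetry turns this into the vanishing of \<open>R(a, b)\<close>.
\<close>
lemma R_E_perp:
  assumes "a \<in> E \<kappa>" "\<And>e. e \<in> E \<kappa> \<Longrightarrow> b \<bullet> e = 0"
  shows "R a b c = 0"
proof -
  have "R a b c \<bullet> d = 0" for d
  proof -
    have "R c d a \<in> E \<kappa>" using assms(1) subspace_E by (simp add: R_def subspace_diff)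
    then have "R c d a \<bullet> b = 0" using assms(2) inner_commute[of b] by simp
    then show ?thesis by (simp only: R_pair[of a b])
  qed
  then show ?thesis by (metis inner_eq_zero_iff)
qed

lemma R_E_E_perp:
  assumes "a \<in> E \<kappa>" "b \<in> E \<kappa>" "\<And>e. e \<in> E \<kappa> \<Longrightarrow> c \<bullet> e = 0"
  shows "R a b c = 0"
  using R_bianchi[of a b c] R_E_perp[OF assms(1,3)] R_E_perp[OF assms(2,3)] R_alt[of c a b] by simp

end

section \<open>The second center and two-step nilpotency\<close>

text \<open>
The vector \<open>y\<close> is orthogonal to the center and central modulo the center, and \<open>u\<close> is a nonzero component of \<open>y\<close>
in one eigenspace. The results of this locale culminate in \<open>derived_perp_u\<close>, which forbids \<open>y\<close> to be an element of
the derived algebra modulo the center.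
\<close>
locale second_center_component = nilpotent_skl_algebra +
  fixes y u v \<kappa>
  assumes y: "y \<in> W" "\<And>x. br y x \<in> center"
    and \<kappa>: "\<kappa> \<in> center"
    and u: "u \<in> E \<kappa>" "u \<noteq> 0" and yuv: "y = u + v"
    and v: "v \<in> W" "\<And>e. e \<in> E \<kappa> \<Longrightarrow> v \<bullet> e = 0"
begin

text \<open>
A zero weight would put \<open>u\<close> into the flat part.
\<close>
lemma \<kappa>_nonzero: "\<kappa> \<bullet> \<kappa> \<noteq> 0"
proof
  assume "\<kappa> \<bullet> \<kappa> = 0"
  then have "nb z u = 0" if "z \<in> center" for z using E_nb[OF u(1) that] by simp
  then show False using flat_part_trivial[OF E_W[OF u(1)]] u(2) by blast
qed

lemma br_y_Ju: "br y (J u) = (u \<bullet> u) *\<^sub>R \<kappa>"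
proof -
  let ?d = "br y (J u) - (u \<bullet> u) *\<^sub>R \<kappa>"
  have d: "?d \<in> center" using y(2) \<kappa> subspace_center by (simp add: subspace_diff subspace_scale)
  have "?d \<bullet> z = 0" if z: "z \<in> center" for z
  proof -
    have "nb z v \<bullet> J u = - (v \<bullet> nb z (J u))" by (rule nb_skew)
    also have "\<dots> = 0" using v(2)[of "nb z (J u)"] u(1) by simp
    finally show ?thesis
      using E_nb[OF u(1) z]
      by (simp add: inner_diff_left br_inner_center[OF z] yuv nb_simps inner_add_left J_isometry)
  qed
  from this[OF d] show ?thesis by simp
qed

text \<open>
For \<open>w \<in> E \<psi>\<close> the curvature \<open>R(y, J u) w\<close> vanishes by orthogonality of the eigenspaces, while
\<open>[y, J u] = \<parallel>u\<parallel>\<^sup>2 \<kappa>\<close>. Hence the commutator of \<open>\<nabla>\<^sub>y\<close> and \<open>\<nabla>\<^bsub>J u\<^esub>\<close> acts on \<open>E \<psi>\<close> as the rotation by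
\<open>- \<parallel>u\<parallel>\<^sup>2 (\<psi> \<bullet> \<kappa>)\<close>. A unit eigenvector \<open>w\<close> of \<open>J \<nabla>\<^sub>y\<close> gives the commutator the expectation \<open>0\<close>.
\<close>
lemma other_characters_orthogonal:
  assumes "\<psi> \<in> center" "\<psi> \<noteq> \<kappa>" "E \<psi> \<noteq> {0}"
  shows "\<psi> \<bullet> \<kappa> = 0"
proof -
  obtain w \<mu> where w: "w \<in> E \<psi>" "norm w = 1" "J (nb y w) = \<mu> *\<^sub>R w"
  proof (rule symmetric_eigenvector[of "\<lambda>w. J (nb y w)" "E \<psi>"])
    show "linear (\<lambda>w. J (nb y w))"
      by (intro linear_compose[unfolded o_def, OF linear_nb(1) J_linear])
    show "J (nb y a) \<bullet> b = a \<bullet> J (nb y b)" for a b by (simp add: J_skew nb_skew nb_J)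
  qed (use assms subspace_E in auto)
  have "J (J (nb y w)) = \<mu> *\<^sub>R J w" by (simp add: w(3) J_simps)
  then have m: "nb y w = - \<mu> *\<^sub>R J w" by (simp add: JJ minus_equation_iff[of "nb y w"])
  have perp: "w \<bullet> e = 0" if "e \<in> E \<kappa>" for e
    using E_orthogonal[OF assms(1) \<kappa> assms(2) w(1) that] .
  have "R y (J u) w = R u (J u) w + R v (J u) w"
    by (simp add: yuv R_def nb_simps br_simps)
  also have "R u (J u) w = 0" using R_E_E_perp[OF u(1) J_in_E[OF u(1)] perp] .
  also have "R v (J u) w = 0" using R_alt[of v "J u" w] R_E_perp[OF J_in_E[OF u(1)] v(2)] by simp
  finally have "nb y (nb (J u) w) - nb (J u) (nb y w) = (u \<bullet> u) *\<^sub>R nb \<kappa> w"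
    by (simp add: R_def br_y_Ju nb_simps)
  then have "(nb y (nb (J u) w) - nb (J u) (nb y w)) \<bullet> J w = - (u \<bullet> u) * (\<psi> \<bullet> \<kappa>)"
    using w(2) E_nb[OF w(1) \<kappa>] by (simp add: J_isometry dot_square_norm[of w])
  moreover have "nb y (nb (J u) w) \<bullet> J w = 0"
    by (simp add: nb_skew[of y] nb_J m J_simps)
  moreover have "nb (J u) (nb y w) \<bullet> J w = 0"
    by (simp add: m nb_simps)
  ultimately show ?thesis using u(2) by (simp add: inner_diff_left)
qed

text \<open>
Were the image of \<open>\<nabla>\<^sub>\<kappa>\<close> on the complement of \<open>E \<kappa>\<close> nonzero, it would contain an eigenvector whose weight is
orthogonal to \<open>\<kappa>\<close>, i.e. one in the kernel of \<open>\<nabla>\<^sub>\<kappa>\<close>. Image and kernel of a skew map are orthogonal.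
\<close>
lemma nb_\<kappa>_perp:
  assumes "w \<in> W" "\<And>e. e \<in> E \<kappa> \<Longrightarrow> w \<bullet> e = 0"
  shows "nb \<kappa> w = 0"
proof (rule ccontr)
  assume ne: "nb \<kappa> w \<noteq> 0"
  define S0 where "S0 = {w\<in>W. \<forall>e\<in>E \<kappa>. w \<bullet> e = 0}"
  define S where "S = nb \<kappa> ` S0"
  have "subspace S0" using subspace_W by (auto simp: S0_def subspace_def inner_add_left)
  then have sub: "subspace S" unfolding S_def by (rule linear_subspace_image[OF linear_nb(1)])
  have S0J: "J w \<in> S0" if "w \<in> S0" for w using that by (simp add: S0_def J_skew)
  have S0nb: "nb z w \<in> S0" if "w \<in> S0" for w z using that by (simp add: S0_def nb_skew)
  have S_W: "S \<subseteq> W" by (auto simp: S_def)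
  have "w \<in> S0" using assms by (simp add: S0_def)
  then have S_ne: "S \<noteq> {0}" using ne by (auto simp: S_def)
  have SJ: "J w \<in> S" if w: "w \<in> S" for w
  proof -
    obtain w' where "w' \<in> S0" "w = nb \<kappa> w'" using w by (auto simp: S_def)
    then show ?thesis using S0J[of w'] nb_J[of \<kappa> w'] unfolding S_def by (metis imageI)
  qed
  have Snb: "nb z w \<in> S" if w: "w \<in> S" for z w
  proof -
    obtain w' where "w' \<in> S0" "w = nb \<kappa> w'" using w by (auto simp: S_def)
    then show ?thesis using S0nb[of w' z] nb_center_commute[OF \<kappa>, of z w'] unfolding S_def by (metis imageI)
  qed
  obtain e \<psi> where e: "e \<in> S" "norm e = 1" "\<psi> \<in> center" "e \<in> E \<psi>"
    using character_exists[OF sub S_W S_ne SJ Snb] by metis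
  obtain w' where w': "w' \<in> S0" "e = nb \<kappa> w'" using e(1) by (auto simp: S_def)
  then have "e \<in> S0" using S0nb by simp
  have "e \<bullet> e = 1" using e(2) by (simp add: dot_square_norm)
  then have "\<psi> \<noteq> \<kappa>" "e \<noteq> 0" using \<open>e \<in> S0\<close> e(4) by (auto simp: S0_def)
  then have "\<psi> \<bullet> \<kappa> = 0" using other_characters_orthogonal[OF e(3)] e(4) by blast
  then have "nb \<kappa> e = 0" using E_nb[OF e(4) \<kappa>] by simp
  then have "e \<bullet> e = 0" using nb_skew[of \<kappa> w' e] w'(2) by simp
  then show False using \<open>e \<bullet> e = 1\<close> by simp
qed

lemma E_decomp:
  assumes "w \<in> W"
  obtains a b where "w = a + b" "a \<in> E \<kappa>" "b \<in> W" "\<And>e. e \<in> E \<kappa> \<Longrightarrow> b \<bullet> e = 0"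
proof -
  obtain P where P: "linear P" "\<And>x. P x \<in> E \<kappa>" "\<And>x. x \<in> E \<kappa> \<Longrightarrow> P x = x"
    "\<And>x y. y \<in> E \<kappa> \<Longrightarrow> (x - P x) \<bullet> y = 0"
    using orthogonal_projection_exists[OF subspace_E] by metis
  show thesis
  proof (rule that[of "P w" "w - P w"])
    show "w - P w \<in> W" using assms E_W[OF P(2)] subspace_W by (simp add: subspace_diff)
  qed (auto simp: P)
qed

lemma nb_\<kappa>_E: "a \<in> E \<kappa> \<Longrightarrow> nb \<kappa> a = - (\<kappa> \<bullet> \<kappa>) *\<^sub>R J a"
  using E_nb \<kappa> by blast

text \<open>
\<open>\<nabla>\<^sub>\<kappa>\<close> is a derivation of \<open>T\<close> which kills \<open>b\<close> and \<open>c\<close> but is invertible on \<open>E \<kappa>\<close>.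
\<close>
lemma T_E_perp_perp:
  assumes a: "a \<in> E \<kappa>" and b: "b \<in> W" "\<And>e. e \<in> E \<kappa> \<Longrightarrow> b \<bullet> e = 0"
    and c: "c \<in> W" "\<And>e. e \<in> E \<kappa> \<Longrightarrow> c \<bullet> e = 0"
  shows "T b c \<bullet> a = 0"
proof -
  have "T b c \<bullet> nb \<kappa> (J a) = 0"
    using T_center_cyclic[OF \<kappa>, of b c "J a"] nb_\<kappa>_perp[OF b] nb_\<kappa>_perp[OF c] by simp
  then show ?thesis using \<kappa>_nonzero nb_\<kappa>_E[OF J_in_E[OF a]] by (simp add: JJ)
qed

text \<open>
Let \<open>q\<close> be the component of \<open>T a a'\<close> in \<open>W\<close> orthogonal to \<open>E \<kappa>\<close>. The cyclic identity for \<open>z = \<kappa>\<close> shows that the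
expression by which \<open>\<kappa> \<bullet> z\<close> is multiplied in the identity for general \<open>z\<close> is zero; hence all \<open>\<nabla>\<^sub>z\<close> kill \<open>q\<close>, and the
flat part is trivial.
\<close>
lemma T_E_E_perp:
  assumes a: "a \<in> E \<kappa>" "a' \<in> E \<kappa>" and b: "b \<in> W" "\<And>e. e \<in> E \<kappa> \<Longrightarrow> b \<bullet> e = 0"
  shows "T a a' \<bullet> b = 0"
proof -
  obtain t t' where T: "t \<in> center" "t' \<in> W" "T a a' = t + t'" using center_W_decomp .
  obtain p q where pq: "t' = p + q" "p \<in> E \<kappa>" "q \<in> W" "\<And>e. e \<in> E \<kappa> \<Longrightarrow> q \<bullet> e = 0"
    by (rule E_decomp[OF T(2)]) blast
  have Tq: "T a a' \<bullet> c = q \<bullet> c" if "c \<in> W" "\<And>e. e \<in> E \<kappa> \<Longrightarrow> c \<bullet> e = 0" for c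
    using that(2)[OF pq(2)] W_inner_center[OF that(1) T(1)]
    by (simp add: T(3) pq(1) inner_add_left inner_commute[of p c])
  have nbq: "q \<bullet> nb z c = 0" if z: "z \<in> center" and c: "c \<in> W" "\<And>e. e \<in> E \<kappa> \<Longrightarrow> c \<bullet> e = 0" for z c
  proof -
    have c': "nb z c \<bullet> e = 0" if "e \<in> E \<kappa>" for e using nb_skew[of z c e] c(2) that by simp
    have cyc: "T a a' \<bullet> nb s c = (\<kappa> \<bullet> s) * (T a' c \<bullet> J a + T c a \<bullet> J a')" if "s \<in> center" for s
      using T_center_cyclic[OF that, of a a' c] E_nb[OF a(1) that] E_nb[OF a(2) that]
      by (simp add: algebra_simps)
    have "T a' c \<bullet> J a + T c a \<bullet> J a' = 0"
      using cyc[OF \<kappa>] nb_\<kappa>_perp[OF c] \<kappa>_nonzero by simp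
    then have "T a a' \<bullet> nb z c = 0" using cyc[OF z] by simp
    then show ?thesis using Tq[OF nb_in_W c'] by simp
  qed
  have "nb z q = 0" if z: "z \<in> center" for z
  proof -
    \<comment> \<open>\<open>nbq\<close> with \<open>c = \<nabla>\<^sub>z q\<close> gives the square of the norm\<close>
    have "q \<bullet> nb z (nb z q) = 0"
    proof (rule nbq[OF z])
      show "nb z q \<bullet> e = 0" if "e \<in> E \<kappa>" for e using nb_skew[of z q e] pq(4) that by simp
    qed simp
    then have "nb z q \<bullet> nb z q = 0" using nb_skew[of z q "nb z q"] by simp
    then show ?thesis by simp
  qed
  then have "q = 0" using flat_part_trivial[OF pq(3)] by blast
  then show ?thesis using Tq[OF b] by simp
qed

text \<open>
On \<open>E \<kappa>\<close> the rotation \<open>\<nabla>\<^sub>\<kappa>\<close> is a nonzero multiple of \<open>J\<close>, so \<open>J\<close> itself acts on \<open>T\<close> as a derivation. Inserting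
\<open>J\<close> into each slot of that identity gives three linear equations, and the type condition \<open>T_J\<close> a fourth, for the
values of \<open>T\<close> on \<open>a, b, c\<close> with \<open>J\<close> in two of the slots or in none; they only have the zero solution.
\<close>
lemma T_E_E_E:
  assumes "a \<in> E \<kappa>" "b \<in> E \<kappa>" "c \<in> E \<kappa>"
  shows "T a b \<bullet> c = 0"
proof -
  have D: "T (J a) b \<bullet> c + T a (J b) \<bullet> c + T a b \<bullet> J c = 0"
    if "a \<in> E \<kappa>" "b \<in> E \<kappa>" "c \<in> E \<kappa>" for a b c
  proof -
    have "(\<kappa> \<bullet> \<kappa>) * (T a b \<bullet> J c + T b c \<bullet> J a + T c a \<bullet> J b) = 0"
      using T_center_cyclic[OF \<kappa>, of a b c] nb_\<kappa>_E[OF that(1)] nb_\<kappa>_E[OF that(2)] nb_\<kappa>_E[OF that(3)]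
      by (simp add: algebra_simps)
    then have "T a b \<bullet> J c + T b c \<bullet> J a + T c a \<bullet> J b = 0" using \<kappa>_nonzero by simp
    then show ?thesis using T_cyclic[of "J a" b c] T_cyclic[of a "J b" c] T_cyclic[of "J b" c a] by linarith
  qed
  have type: "T (J a) (J b) \<bullet> c = T a b \<bullet> c - T (J a) b \<bullet> J c - T a (J b) \<bullet> J c"
    unfolding T_J by (simp add: inner_add_left J_skew)
  have "T (J a) b \<bullet> J c + T (J a) (J b) \<bullet> c - T a b \<bullet> c = 0"
    using D[OF J_in_E[OF assms(1)] assms(2,3)] by (simp add: JJ T_simps)
  moreover have "T a (J b) \<bullet> J c + T (J a) (J b) \<bullet> c - T a b \<bullet> c = 0"
    using D[OF assms(1) J_in_E[OF assms(2)] assms(3)] by (simp add: JJ T_simps)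
  moreover have "T (J a) b \<bullet> J c + T a (J b) \<bullet> J c - T a b \<bullet> c = 0"
    using D[OF assms(1,2) J_in_E[OF assms(3)]] by (simp add: JJ T_simps)
  ultimately show ?thesis using type by linarith
qed

lemma T_E_W:
  assumes a: "a \<in> E \<kappa>" and w: "w \<in> W"
  shows "T a w \<in> center"
proof (rule in_centerI)
  fix b assume "b \<in> W"
  then obtain b1 b2 where b: "b = b1 + b2" "b1 \<in> E \<kappa>" "b2 \<in> W" "\<And>e. e \<in> E \<kappa> \<Longrightarrow> b2 \<bullet> e = 0"
    by (rule E_decomp) blast
  obtain w1 w2 where w': "w = w1 + w2" "w1 \<in> E \<kappa>" "w2 \<in> W" "\<And>e. e \<in> E \<kappa> \<Longrightarrow> w2 \<bullet> e = 0"
    by (rule E_decomp[OF w]) blast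
  have "T a w1 \<bullet> b1 = 0" by (rule T_E_E_E[OF a w'(2) b(2)])
  moreover have "T a w1 \<bullet> b2 = 0" by (rule T_E_E_perp[OF a w'(2) b(3,4)])
  moreover have "T a w2 \<bullet> b1 = 0"
    using T_E_E_perp[OF b(2) a w'(3,4)] T_cyclic[of b1 a w2] by simp
  moreover have "T a w2 \<bullet> b2 = 0"
    using T_E_perp_perp[OF a w'(3,4) b(3,4)] T_cyclic[of a w2 b2] by simp
  ultimately show "T a w \<bullet> b = 0"
    by (simp add: w'(1) b(1) T_simps inner_add_left inner_add_right)
qed

lemma br_E_E:
  assumes "a \<in> E \<kappa>" "b \<in> E \<kappa>"
  shows "br a b = nb a b - nb b a + (J a \<bullet> b) *\<^sub>R \<kappa>"
proof -
  let ?d = "T a b + (J a \<bullet> b) *\<^sub>R \<kappa>"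
  have d: "?d \<in> center"
    using T_E_W[OF assms(1) E_W[OF assms(2)]] \<kappa> subspace_center by (simp add: subspace_add subspace_scale)
  have "?d \<bullet> z = 0" if z: "z \<in> center" for z
    using E_nb[OF assms(1) z] by (simp add: inner_add_left T_inner_center[OF z])
  from this[OF d] have "T a b = - (J a \<bullet> b) *\<^sub>R \<kappa>" by (simp add: add_eq_0_iff2)
  then show ?thesis by (simp add: br_eq)
qed

text \<open>
Subtract the Bianchi identity for \<open>p, J p, w\<close> from the Jacobi identity. By \<open>br_E_E\<close> all derivatives cancel except
those in direction \<open>\<kappa>\<close>, and \<open>\<nabla>\<^sub>\<kappa>\<close> is a multiple of \<open>J\<close>. Pairing what is left with \<open>J w\<close> yields \<open>\<parallel>p\<parallel>\<^sup>2 \<parallel>w\<parallel>\<^sup>2 = 0\<close>.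
\<close>
lemma E_complex_line:
  assumes p: "p \<in> E \<kappa>" "p \<noteq> 0" and w: "w \<in> E \<kappa>" "w \<bullet> p = 0" "w \<bullet> J p = 0"
  shows "w = 0"
proof -
  define d where "d a b = nb a b - nb b a" for a b
  define s where "s a b = J a \<bullet> b" for a b
  have br: "br a b = d a b + s a b *\<^sub>R \<kappa>" if "a \<in> E \<kappa>" "b \<in> E \<kappa>" for a b
    using br_E_E[OF that] by (simp add: d_def s_def)
  have dE: "d a b \<in> E \<kappa>" if "a \<in> E \<kappa>" "b \<in> E \<kappa>" for a b
    using that subspace_E by (simp add: d_def subspace_diff)
  have brbr: "br a (br b c) = nb a (d b c) - nb (d b c) a + s a (d b c) *\<^sub>R \<kappa>"
    if "a \<in> E \<kappa>" "b \<in> E \<kappa>" "c \<in> E \<kappa>" for a b c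
    using br[OF that(1) dE[OF that(2,3)]] br[OF that(2,3)] \<kappa> by (simp add: br_simps d_def[of a])
  have Rabc: "nb (br a b) c = nb (d a b) c - (s a b * (\<kappa> \<bullet> \<kappa>)) *\<^sub>R J c"
    if "a \<in> E \<kappa>" "b \<in> E \<kappa>" "c \<in> E \<kappa>" for a b c
    using br[OF that(1,2)] nb_\<kappa>_E[OF that(3)] by (simp add: nb_simps)
  have Jp: "J p \<in> E \<kappa>" using p(1) by simp
  define k where "k = s p (d (J p) w) + s (J p) (d w p) + s w (d p (J p))"
  have jac: "nb p (d (J p) w) - nb (d (J p) w) p + (nb (J p) (d w p) - nb (d w p) (J p))
     + (nb w (d p (J p)) - nb (d p (J p)) w) + k *\<^sub>R \<kappa> = 0"
    using jacobi[of p "J p" w] brbr[OF p(1) Jp w(1)] brbr[OF Jp w(1) p(1)] brbr[OF w(1) p(1) Jp]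
    by (simp add: k_def algebra_simps)
  let ?X = "(\<kappa> \<bullet> \<kappa>) *\<^sub>R (s p (J p) *\<^sub>R J w + s (J p) w *\<^sub>R J p + s w p *\<^sub>R J (J p))"
  \<comment> \<open>the right-hand side is the Jacobi identity minus the Bianchi identity\<close>
  have "k *\<^sub>R \<kappa> - ?X =
      ((nb p (d (J p) w) - nb (d (J p) w) p + (nb (J p) (d w p) - nb (d w p) (J p))
        + (nb w (d p (J p)) - nb (d p (J p)) w) + k *\<^sub>R \<kappa>)
      - (nb p (nb (J p) w) - nb (J p) (nb p w) - nb (br p (J p)) w
      + (nb (J p) (nb w p) - nb w (nb (J p) p) - nb (br (J p) w) p)
      + (nb w (nb p (J p)) - nb p (nb w (J p)) - nb (br w p) (J p))))"
    unfolding Rabc[OF p(1) Jp w(1)] Rabc[OF Jp w(1) p(1)] Rabc[OF w(1) p(1) Jp]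
    by (simp add: d_def nb_simps algebra_simps)
  then have "k *\<^sub>R \<kappa> = ?X" unfolding jac bianchi by simp
  from arg_cong[OF this, of "\<lambda>x. x \<bullet> J w"]
  have "(\<kappa> \<bullet> \<kappa>) * (s p (J p) * (w \<bullet> w) + s (J p) w * (p \<bullet> w) + s w p * (J p \<bullet> w)) = 0"
    using W_inner_center(2)[OF E_W[OF J_in_E[OF w(1)]] \<kappa>]
    by (simp only: inner_scaleR_left inner_add_left J_isometry mult_zero_right)
  then have "(p \<bullet> p) * (w \<bullet> w) = 0"
    using \<kappa>_nonzero w(2,3) by (simp add: s_def J_isometry inner_commute[of p w] inner_commute[of "J p" w])
  then show ?thesis using p(2) by simp
qed

text \<open>
\<open>[y, [a, b]] = 0\<close> by Jacobi, because brackets with \<open>y\<close> are central; the \<open>\<kappa>\<close>-component of this equation is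
\<open>\<nabla>\<^sub>\<kappa> y \<bullet> [a, b] = 0\<close>, where \<open>\<nabla>\<^sub>\<kappa> y\<close> is a nonzero multiple of \<open>J u\<close>.
\<close>
lemma derived_perp_Ju: "br a b \<bullet> J u = 0"
proof -
  have "br y (br a b) + br a (br b y) + br b (br y a) = 0" by (rule jacobi)
  moreover have "br b y \<in> center" using y(2)[of b] br_skew[of b y] subspace_center by (simp add: subspace_neg)
  ultimately have "br y (br a b) = 0" using y(2) by simp
  then have "nb \<kappa> y \<bullet> br a b = 0" using br_inner_center[OF \<kappa>, of y "br a b"] by simp
  then show ?thesis using \<kappa>_nonzero nb_\<kappa>_perp[OF v] nb_\<kappa>_E[OF u(1)]
    by (simp add: yuv nb_simps inner_commute)
qed

lemma nb_u_eq: "nb x u \<bullet> J u = 0 \<Longrightarrow> nb x u = 0"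
  by (rule E_complex_line[OF u]) (use u in auto)

text \<open>
Since \<open>E \<kappa>\<close> is a complex line, only \<open>\<nabla>\<^sub>x u \<bullet> J u\<close> matters. It equals \<open>[x, u] \<bullet> J u = 0\<close> up to the term
\<open>\<nabla>\<^sub>u x \<bullet> J u\<close>, which vanishes for \<open>x\<close> orthogonal to \<open>J (\<nabla>\<^sub>u u)\<close>. So it remains to prove \<open>\<nabla>\<^sub>u u = 0\<close>, and this
follows from nilpotency of \<open>ad (J u)\<close>.
\<close>
lemma nb_W_u:
  assumes "x \<in> W"
  shows "nb x u = 0"
proof -
  have perp: "nb w u \<bullet> J u = 0" if w: "w \<in> W" "w \<bullet> J (nb u u) = 0" for w
  proof -
    have "nb u w \<bullet> J u = 0" using w(2) nb_skew[of u w "J u"] by (simp add: nb_J)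
    moreover have "T u w \<bullet> J u = 0"
      using W_inner_center[OF E_W[OF J_in_E[OF u(1)]] T_E_W[OF u(1) w(1)]] by simp
    ultimately show ?thesis using derived_perp_Ju[of u w] by (simp add: br_eq inner_diff_left)
  qed
  have nbJu: "nb (J u) u = 0"
    by (rule nb_u_eq, rule perp) (use u(1) E_W in \<open>auto simp: J_isometry inner_commute[of u]\<close>)
  have nbu: "nb u u = 0"
  proof -
    define t where "t = (nb u u \<bullet> J u) / (u \<bullet> u)"
    have "nb u u - t *\<^sub>R J u = 0"
    proof (rule E_complex_line[OF u])
      show "nb u u - t *\<^sub>R J u \<in> E \<kappa>" using u(1) subspace_E by (simp add: subspace_diff subspace_scale)
    qed (use u(2) in \<open>auto simp: t_def inner_diff_left J_isometry\<close>)
    then have nbu: "nb u u = t *\<^sub>R J u" by simp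
    have "br (J u) u = t *\<^sub>R u - (u \<bullet> u) *\<^sub>R \<kappa>"
      using br_E_E[OF J_in_E[OF u(1)] u(1)] nbJu nbu by (simp add: nb_J J_simps)
    \<comment> \<open>modulo \<kappa>, ad (J u) multiplies u by t; being nilpotent it has t = 0\<close>
    moreover have "\<exists>c. ((br (J u)) ^^ k) u = t ^ k *\<^sub>R u + c *\<^sub>R \<kappa>" for k
    proof (induction k)
      case 0 show ?case by (rule exI[of _ 0]) simp
    next
      case (Suc k)
      then obtain c where "((br (J u)) ^^ k) u = t ^ k *\<^sub>R u + c *\<^sub>R \<kappa>" by blast
      then have "((br (J u)) ^^ Suc k) u = t ^ Suc k *\<^sub>R u + (- (t ^ k * (u \<bullet> u))) *\<^sub>R \<kappa>"
        using calculation \<kappa> by (simp add: br_simps scaleR_diff_right)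
      then show ?case by blast
    qed
    moreover obtain k where "k > 0" "\<forall>x y. ((br x) ^^ k) y = 0" using ad_funpow_eq_0 by blast
    ultimately obtain c where "t ^ k *\<^sub>R u + c *\<^sub>R \<kappa> = 0" by metis
    from arg_cong[OF this, of "\<lambda>x. x \<bullet> u"] have "t ^ k = 0"
      using u W_inner_center(2)[OF E_W[OF u(1)] \<kappa>] by (simp add: inner_add_left)
    then show ?thesis using nbu by simp
  qed
  show ?thesis by (rule nb_u_eq, rule perp[OF assms]) (simp add: nbu J_simps)
qed

lemma derived_perp_u: "br a b \<bullet> u = 0"
proof -
  obtain z a' where a: "z \<in> center" "a' \<in> W" "a = z + a'" using center_W_decomp .
  obtain z' b' where b: "z' \<in> center" "b' \<in> W" "b = z' + b'" using center_W_decomp .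
  have "br a' b' \<bullet> u = nb a' b' \<bullet> u - nb b' a' \<bullet> u - T a' b' \<bullet> u"
    by (simp add: br_eq inner_diff_left)
  moreover have "nb a' b' \<bullet> u = 0" "nb b' a' \<bullet> u = 0"
    using nb_skew[of a' b' u] nb_skew[of b' a' u] nb_W_u a(2) b(2) by simp_all
  moreover have "T a' b' \<bullet> u = 0"
    using T_cyclic[of u a' b'] W_inner_center(2)[OF b(2) T_E_W[OF u(1) a(2)]] by simp
  ultimately show ?thesis using a(1) b(1) by (simp add: a(3) b(3) br_simps)
qed

end

context nilpotent_skl_algebra
begin

text \<open>
The second center meets the derived algebra only inside the center: a component \<open>u\<close> of \<open>y\<close> is orthogonal to the
derived algebra by \<open>derived_perp_u\<close> and to \<open>z\<close>, hence to itself.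
\<close>
lemma second_center_meets_derived:
  assumes "y \<in> W" "\<And>x. br y x \<in> center" "z \<in> center" "y + z \<in> span {br a b |a b. True}"
  shows "y = 0"
proof (rule ccontr)
  assume "y \<noteq> 0"
  then obtain \<kappa> u v where d: "\<kappa> \<in> center" "u \<in> E \<kappa>" "u \<noteq> 0" "y = u + v" "v \<in> W"
    "\<And>e. e \<in> E \<kappa> \<Longrightarrow> v \<bullet> e = 0"
    using character_component[OF assms(1)] by metis
  interpret second_center_component br J nb y u v \<kappa>
    by unfold_locales (use assms d in auto)
  have "x \<bullet> u = 0" if "x \<in> span {br a b |a b. True}" for x
    using that by (induction rule: span_induct_alt) (auto simp: inner_add_left derived_perp_u)
  then have "(y + z) \<bullet> u = 0" using assms(4) by blast
  then have "u \<bullet> u = 0"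
    using d W_inner_center(2)[OF E_W[OF d(2)] assms(3)] by (simp add: inner_add_left)
  then show False using d(3) by simp
qed

text \<open>
If the descending central series entered the center later than after the first step, then the member before would
consist of elements of the second center in the derived algebra, which are central already.
\<close>
theorem two_step: "br x y \<in> center"
proof -
  obtain K where K: "descending_series br K = {0}" using nilpotent by blast
  \<comment> \<open>the first member of the series inside the center\<close>
  define k where "k = (LEAST k. descending_series br k \<subseteq> center)"
  have ex: "descending_series br K \<subseteq> center" using K subspace_center by (simp add: subspace_0)
  have k: "descending_series br k \<subseteq> center" unfolding k_def by (rule LeastI[of _ K]) (rule ex)
  have anti: "descending_series br m \<subseteq> descending_series br l" if "l \<le> m" for l m
    using that by (induction rule: dec_induct) (use descending_series_antimono in auto)
  have "k \<le> 1"
  proof (rule ccontr)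
    assume "\<not> k \<le> 1"
    then obtain j where j: "k = Suc (Suc j)" by (metis One_nat_def le_Suc_eq nat_le_linear not0_implies_Suc not_less_eq_eq le_0_eq)
    have "\<not> descending_series br (Suc j) \<subseteq> center"
      using not_less_Least[of "Suc j" "\<lambda>k. descending_series br k \<subseteq> center"] j by (simp add: k_def)
    then obtain x where x: "x \<in> descending_series br (Suc j)" "x \<notin> center" by blast
    obtain z w where zw: "z \<in> center" "w \<in> W" "x = z + w" using center_W_decomp .
    have "w = 0"
    proof (rule second_center_meets_derived[OF zw(2)])
      show "br w v \<in> center" for v
      proof -
        have "br v x \<in> center" using descending_series_step[OF x(1)] k j by blast
        then show ?thesis using br_skew[of v x] zw(1) subspace_center
          by (simp add: zw(3) br_simps subspace_neg[of center "- _", simplified])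
      qed
      have "x \<in> descending_series br 1" using anti[of 1 "Suc j"] x(1) by auto
      then show "w + z \<in> span {br a b |a b. True}"
        by (simp add: zw(3) add.commute descending_series.simps(2))
    qed (rule zw(1))
    then show False using x(2) zw by simp
  qed
  then have "descending_series br 1 \<subseteq> center" using anti[of k 1] k by blast
  moreover have "br x y \<in> descending_series br 1" using descending_series_step[of y 0] by simp
  ultimately show ?thesis by blast
qed

end

section \<open>The normal form\<close>

context hermitian_lie_algebra
begin

definition unitary_basis :: "nat \<Rightarrow> (nat \<Rightarrow> 'e) \<Rightarrow> 'e set \<Rightarrow> bool" where
  "unitary_basis m e S \<longleftrightarrow>
     (\<forall>i<m. \<forall>j<m. e i \<bullet> e j = (if i = j then 1 else 0) \<and> e i \<bullet> J (e j) = 0) \<and>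
     span (e ` {..<m} \<union> (\<lambda>i. J (e i)) ` {..<m}) = S"

lemma unitary_basis_in: "unitary_basis m e S \<Longrightarrow> i < m \<Longrightarrow> e i \<in> S"
  by (auto simp: unitary_basis_def intro!: span_base)

text \<open>
Greedy choice of vectors with property \<open>Q\<close>. The predicate \<open>adm\<close> describes the subspaces in which such vectors can
be found, and has to be inherited by the complement of a chosen complex line.
\<close>
lemma unitary_basis_exists:
  assumes pick: "\<And>S. subspace S \<Longrightarrow> S \<noteq> {0} \<Longrightarrow> adm S \<Longrightarrow> \<exists>w\<in>S. norm w = 1 \<and> Q w"
    and perp: "\<And>S w. adm S \<Longrightarrow> w \<in> S \<Longrightarrow> Q w \<Longrightarrow> adm {x\<in>S. x \<bullet> w = 0 \<and> x \<bullet> J w = 0}"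
    and J: "\<And>S w. adm S \<Longrightarrow> w \<in> S \<Longrightarrow> J w \<in> S"
    and S: "subspace S" "adm S"
  shows "\<exists>m e. unitary_basis m e S \<and> (\<forall>i<m. Q (e i))"
  using S
proof (induction "dim S" arbitrary: S rule: less_induct)
  case less
  show ?case
  proof (cases "S = {0}")
    case True
    then have "unitary_basis 0 (\<lambda>_. 0) S" by (simp add: unitary_basis_def)
    then show ?thesis by blast
  next
    case False
    obtain w where w: "w \<in> S" "norm w = 1" "Q w" using pick[OF less.prems(1) False less.prems(2)] by blast
    have ww: "w \<bullet> w = 1" using w(2) by (simp add: dot_square_norm)
    have Jw: "J w \<in> S" using J[OF less.prems(2) w(1)] .
    define S' where "S' = {x\<in>S. x \<bullet> w = 0 \<and> x \<bullet> J w = 0}"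
    have sub: "subspace S'" using less.prems(1) by (auto simp: S'_def subspace_def inner_add_left)
    have adm: "adm S'" unfolding S'_def by (rule perp[OF less.prems(2) w(1,3)])
    have "S' \<subseteq> S" "w \<notin> S'" using ww by (auto simp: S'_def)
    then have "\<not> dim S \<le> dim S'" using subspace_dim_equal[OF sub less.prems(1)] w(1) by metis
    then have "dim S' < dim S" by simp
    then obtain m e where e: "unitary_basis m e S'" "\<forall>i<m. Q (e i)" using less.hyps[OF _ sub adm] by blast
    define f where "f = case_nat w e"
    have eS': "e i \<bullet> w = 0" "e i \<bullet> J w = 0" "w \<bullet> e i = 0" "w \<bullet> J (e i) = 0" if "i < m" for i
    proof -
      show 1: "e i \<bullet> w = 0" "e i \<bullet> J w = 0" using unitary_basis_in[OF e(1) that] by (auto simp: S'_def)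
      show "w \<bullet> e i = 0" using 1(1) by (simp only: inner_commute[of w "e i"])
      have "J w \<bullet> e i = 0" using 1(2) by (simp only: inner_commute[of "J w" "e i"])
      then show "w \<bullet> J (e i) = 0" using J_skew[of w "e i"] by linarith
    qed
    have "f i \<bullet> f j = (if i = j then 1 else 0) \<and> f i \<bullet> J (f j) = 0" if "i < Suc m" "j < Suc m" for i j
      using that e(1) eS' ww by (auto simp: f_def unitary_basis_def less_Suc_eq_0_disj)
    moreover have "span (f ` {..<Suc m} \<union> (\<lambda>i. J (f i)) ` {..<Suc m}) = S"
    proof -
      let ?F = "f ` {..<Suc m} \<union> (\<lambda>i. J (f i)) ` {..<Suc m}"
      have "f i \<in> S" if "i < Suc m" for i
        using that w(1) unitary_basis_in[OF e(1)] \<open>S' \<subseteq> S\<close> by (auto simp: f_def less_Suc_eq_0_disj)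
      then have "?F \<subseteq> S" using J[OF less.prems(2)] by auto
      then have "span ?F \<subseteq> S" using less.prems(1) by (simp add: span_minimal)
      moreover have "x \<in> span ?F" if x: "x \<in> S" for x
      proof -
        let ?x = "x - (x \<bullet> w) *\<^sub>R w - (x \<bullet> J w) *\<^sub>R J w"
        have "?x \<in> S'" using x w(1) Jw less.prems(1) ww
          by (simp add: S'_def subspace_diff subspace_scale inner_diff_left J_isometry)
        then have "?x \<in> span (e ` {..<m} \<union> (\<lambda>i. J (e i)) ` {..<m})" using e(1) by (simp add: unitary_basis_def)
        moreover have "e ` {..<m} \<union> (\<lambda>i. J (e i)) ` {..<m} \<subseteq> ?F"
        proof -
          have "e i = f (Suc i)" for i by (simp add: f_def)
          then show ?thesis by auto
        qed
        ultimately have "?x \<in> span ?F" using span_mono by blast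
        moreover have "w \<in> span ?F" "J w \<in> span ?F"
          by (rule span_base, force simp: f_def)+
        ultimately have "?x + (x \<bullet> w) *\<^sub>R w + (x \<bullet> J w) *\<^sub>R J w \<in> span ?F"
          by (intro span_add span_scale)
        then show ?thesis by simp
      qed
      ultimately show ?thesis by blast
    qed
    ultimately have "unitary_basis (Suc m) f S" by (simp add: unitary_basis_def)
    moreover have "\<forall>i<Suc m. Q (f i)" using e(2) w(3) by (auto simp: f_def less_Suc_eq_0_disj)
    ultimately show ?thesis by blast
  qed
qed

lemma unitary_basis_exists_J:
  assumes "subspace S" "\<And>x. x \<in> S \<Longrightarrow> J x \<in> S"
  shows "\<exists>m e. unitary_basis m e S"
proof -
  have "\<exists>m e. unitary_basis m e S \<and> (\<forall>i<m. True)"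
  proof (rule unitary_basis_exists[where adm = "\<lambda>S. \<forall>x\<in>S. J x \<in> S" and Q = "\<lambda>_. True"])
    fix S :: "'e set" assume S: "subspace S" "S \<noteq> {0}"
    obtain v where v: "v \<in> S" "v \<noteq> 0" using S subspace_0 by blast
    have "(1 / norm v) *\<^sub>R v \<in> S" "norm ((1 / norm v) *\<^sub>R v) = 1"
      using v S(1) by (simp_all add: subspace_scale)
    then show "\<exists>w\<in>S. norm w = 1 \<and> True" by blast
  qed (use assms in \<open>auto simp: J_skew JJ\<close>)
  then show ?thesis by blast
qed

lemma unitary_basis_append:
  assumes e: "unitary_basis m e S" and f: "unitary_basis k f S'"
    and orth: "\<And>x y. x \<in> S \<Longrightarrow> y \<in> S' \<Longrightarrow> x \<bullet> y = 0" and J: "\<And>x. x \<in> S' \<Longrightarrow> J x \<in> S'"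
  shows "unitary_basis (m + k) (\<lambda>i. if i < m then e i else f (i - m)) {x + y |x y. x \<in> S \<and> y \<in> S'}"
proof -
  let ?g = "\<lambda>i. if i < m then e i else f (i - m)"
  have ef: "e i \<bullet> f j = 0" "e i \<bullet> J (f j) = 0" "f j \<bullet> e i = 0" "f j \<bullet> J (e i) = 0" if "i < m" "j < k" for i j
  proof -
    show "e i \<bullet> f j = 0" "e i \<bullet> J (f j) = 0"
      using orth[OF unitary_basis_in[OF e that(1)]] unitary_basis_in[OF f that(2)] J by auto
    then show "f j \<bullet> e i = 0" "f j \<bullet> J (e i) = 0"
      using J_skew[of "f j" "e i"] by (simp_all add: inner_commute)
  qed
  have onb: "?g i \<bullet> ?g j = (if i = j then 1 else 0) \<and> ?g i \<bullet> J (?g j) = 0"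
    if "i < m + k" "j < m + k" for i j
  proof -
    consider "i < m" "j < m" | "i < m" "m \<le> j" | "m \<le> i" "j < m" | "m \<le> i" "m \<le> j" by linarith
    then show ?thesis
      by cases (use that e f ef[of i "j - m"] ef[of j "i - m"] in \<open>auto simp: unitary_basis_def\<close>)
  qed
  have img: "?g ` {..<m + k} = e ` {..<m} \<union> f ` {..<k}"
    "(\<lambda>i. J (?g i)) ` {..<m + k} = (\<lambda>i. J (e i)) ` {..<m} \<union> (\<lambda>i. J (f i)) ` {..<k}"
  proof -
    have *: "(\<lambda>i. if i < m then p i else q (i - m)) ` {..<m + k} = p ` {..<m} \<union> q ` {..<k}" for p q :: "nat \<Rightarrow> 'e"
    proof (intro equalityI subsetI)
      fix x assume "x \<in> p ` {..<m} \<union> q ` {..<k}"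
      then consider i where "i < m" "x = p i" | i where "i < k" "x = q i" by auto
      then show "x \<in> (\<lambda>i. if i < m then p i else q (i - m)) ` {..<m + k}"
      proof cases
        case 1 then show ?thesis by (intro image_eqI[of _ _ i]) auto
      next
        case 2 then show ?thesis by (intro image_eqI[of _ _ "m + i"]) auto
      qed
    qed auto
    show "?g ` {..<m + k} = e ` {..<m} \<union> f ` {..<k}" by (rule *)
    have "(\<lambda>i. J (?g i)) = (\<lambda>i. if i < m then J (e i) else J (f (i - m)))" by auto
    then show "(\<lambda>i. J (?g i)) ` {..<m + k} = (\<lambda>i. J (e i)) ` {..<m} \<union> (\<lambda>i. J (f i)) ` {..<k}"
      using *[of "\<lambda>i. J (e i)" "\<lambda>i. J (f i)"] by (simp only:)
  qed
  have "?g ` {..<m + k} \<union> (\<lambda>i. J (?g i)) ` {..<m + k}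
      = (e ` {..<m} \<union> (\<lambda>i. J (e i)) ` {..<m}) \<union> (f ` {..<k} \<union> (\<lambda>i. J (f i)) ` {..<k})"
    unfolding img by blast
  then have "span (?g ` {..<m + k} \<union> (\<lambda>i. J (?g i)) ` {..<m + k}) = {x + y |x y. x \<in> S \<and> y \<in> S'}"
    using e f by (simp add: span_Un unitary_basis_def)
  then show ?thesis unfolding unitary_basis_def using onb by blast
qed

lemma unitary_basis_UNIV_dim:
  assumes "unitary_basis n f UNIV"
  shows "2 * n = DIM('e)"
proof -
  let ?F = "f ` {..<n}" and ?G = "(\<lambda>i. J (f i)) ` {..<n}"
  have o: "f i \<bullet> f j = (if i = j then 1 else 0)" "f i \<bullet> J (f j) = 0" "J (f j) \<bullet> f i = 0"
    if "i < n" "j < n" for i j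
  proof -
    show 1: "f i \<bullet> f j = (if i = j then 1 else 0)" "f i \<bullet> J (f j) = 0"
      using assms that by (simp_all add: unitary_basis_def)
    then show "J (f j) \<bullet> f i = 0" by (simp only: inner_commute[of "J (f j)" "f i"])
  qed
  have inj: "inj_on f {..<n}"
  proof (rule inj_onI)
    fix i j assume "i \<in> {..<n}" "j \<in> {..<n}" "f i = f j"
    then show "i = j" using o(1)[of i j] o(1)[of i i] by (cases "i = j") auto
  qed
  have injJ: "inj_on (\<lambda>i. J (f i)) {..<n}"
    by (rule inj_onI) (use inj JJ in \<open>metis inj_onD minus_minus\<close>)
  have "x \<bullet> y = 0" if "x \<in> ?F" "y \<in> ?G" for x y using that o by auto
  then have disj: "?F \<inter> ?G = {}"
  proof -
    have "x \<bullet> x \<noteq> 0" if x: "x \<in> ?F" for x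
    proof -
      obtain i where "i < n" "x = f i" using x by auto
      then show ?thesis using o(1)[of i i] by simp
    qed
    then show ?thesis using \<open>\<And>y x. x \<in> ?F \<Longrightarrow> y \<in> ?G \<Longrightarrow> x \<bullet> y = 0\<close> by blast
  qed
  have "pairwise orthogonal (?F \<union> ?G)"
    unfolding pairwise_def orthogonal_def using o by (auto simp: J_isometry)
  moreover have "0 \<notin> ?F \<union> ?G"
  proof
    assume "0 \<in> ?F \<union> ?G"
    then obtain i where "i < n" "f i = 0" by auto
    then show False using o(1)[of i i] by simp
  qed
  ultimately have "independent (?F \<union> ?G)" by (rule pairwise_orthogonal_independent)
  then have "card (?F \<union> ?G) = dim (span (?F \<union> ?G))" by (simp add: dim_eq_card_independent)
  also have "\<dots> = DIM('e)" using assms by (simp add: unitary_basis_def)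
  finally show ?thesis using disj inj injJ by (simp add: card_Un_disjoint card_image)
qed

definition derived :: "'e set"
  where "derived = span {br a b |a b. True}"

lemma br_in_span:
  assumes S: "subspace S" and gen: "\<And>a b. a \<in> F \<Longrightarrow> b \<in> F \<Longrightarrow> br a b \<in> S"
    and "x \<in> span F" "y \<in> span F"
  shows "br x y \<in> S"
proof -
  have *: "br a y \<in> S" if "a \<in> F" for a
    using assms(4) by (induction rule: span_induct_alt)
      (use S gen[OF that] in \<open>auto simp: br_simps subspace_add subspace_scale subspace_0\<close>)
  show ?thesis
    using assms(3) by (induction rule: span_induct_alt)
      (use S * in \<open>auto simp: br_simps subspace_add subspace_scale subspace_0\<close>)
qed

end

context nilpotent_skl_algebra
begin

text \<open>
In a 2-step nilpotent algebra all brackets are central, so they are determined by their products with central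
elements, which \<open>br_inner_center\<close> computes.
\<close>
lemma br_inner_E:
  assumes "a \<in> E \<kappa>" "\<kappa> \<in> center"
  shows "br a b = (J a \<bullet> b) *\<^sub>R \<kappa>"
proof -
  let ?d = "br a b - (J a \<bullet> b) *\<^sub>R \<kappa>"
  have d: "?d \<in> center" using two_step assms(2) subspace_center by (simp add: subspace_diff subspace_scale)
  have "?d \<bullet> z = 0" if "z \<in> center" for z
    using E_nb[OF assms(1) that] by (simp add: inner_diff_left br_inner_center[OF that])
  from this[OF d] show ?thesis by simp
qed

text \<open>
Take a unitary basis of \<open>W\<close> consisting of joint eigenvectors and complete it by unitary bases of the part of the
center orthogonal to \<open>N = \<nn> + J \<nn>\<close> and of \<open>N\<close> itself. Because the algebra is 2-step nilpotent, every element of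
\<open>W\<close> lies in the second center, so the results on \<open>second_center_component\<close> apply to each basis vector: the weights
are nonzero, distinct ones are orthogonal, and none occurs twice.
\<close>
theorem structure_theorem:
  obtains n r s f \<kappa> where
    "unitary_basis n f UNIV" "s \<le> r" "r \<le> n"
    "{x + J y |x y. x \<in> derived \<and> y \<in> derived} = span (f ` {r..<n} \<union> (\<lambda>i. J (f i)) ` {r..<n})"
    "derived = span (\<kappa> ` {..<s})" "\<And>i. i < s \<Longrightarrow> \<kappa> i \<noteq> 0"
    "\<And>i j. i < s \<Longrightarrow> j < s \<Longrightarrow> i \<noteq> j \<Longrightarrow> \<kappa> i \<bullet> \<kappa> j = 0"
    "\<And>i j. i < n \<Longrightarrow> j < n \<Longrightarrow> br (f i) (f j) = 0"
    "\<And>i j. i < n \<Longrightarrow> j < n \<Longrightarrow> br (J (f i)) (J (f j)) = 0"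
    "\<And>i j. i < n \<Longrightarrow> j < n \<Longrightarrow> br (f i) (J (f j)) = (if i = j \<and> i < s then \<kappa> i else 0)"
proof -
  have "\<exists>m e. unitary_basis m e W \<and> (\<forall>i<m. \<exists>\<kappa>\<in>center. e i \<in> E \<kappa>)"
  proof (rule unitary_basis_exists[where
        adm = "\<lambda>S. S \<subseteq> W \<and> (\<forall>x\<in>S. J x \<in> S) \<and> (\<forall>x\<in>S. \<forall>z\<in>center. nb z x \<in> S)"])
    fix S assume "subspace S" "S \<noteq> {0}" "S \<subseteq> W \<and> (\<forall>x\<in>S. J x \<in> S) \<and> (\<forall>x\<in>S. \<forall>z\<in>center. nb z x \<in> S)"
    then show "\<exists>w\<in>S. norm w = 1 \<and> (\<exists>\<kappa>\<in>center. w \<in> E \<kappa>)"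
      using character_exists[of S] by metis
  next
    fix S w assume adm: "S \<subseteq> W \<and> (\<forall>x\<in>S. J x \<in> S) \<and> (\<forall>x\<in>S. \<forall>z\<in>center. nb z x \<in> S)"
      and w: "w \<in> S" "\<exists>\<kappa>\<in>center. w \<in> E \<kappa>"
    obtain \<kappa> where \<kappa>: "w \<in> E \<kappa>" using w by blast
    show "{x \<in> S. x \<bullet> w = 0 \<and> x \<bullet> J w = 0} \<subseteq> W \<and>
        (\<forall>x\<in>{x \<in> S. x \<bullet> w = 0 \<and> x \<bullet> J w = 0}. J x \<in> {x \<in> S. x \<bullet> w = 0 \<and> x \<bullet> J w = 0}) \<and>
        (\<forall>x\<in>{x \<in> S. x \<bullet> w = 0 \<and> x \<bullet> J w = 0}. \<forall>z\<in>center. nb z x \<in> {x \<in> S. x \<bullet> w = 0 \<and> x \<bullet> J w = 0})"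
      using adm E_nb[OF \<kappa>] by (auto simp: J_skew JJ nb_skew nb_J J_simps)
  qed (use subspace_W in auto)
  then obtain s e where e: "unitary_basis s e W" "\<forall>i<s. \<exists>\<kappa>\<in>center. e i \<in> E \<kappa>" by blast
  then obtain \<kappa> where \<kappa>: "\<And>i. i < s \<Longrightarrow> \<kappa> i \<in> center" "\<And>i. i < s \<Longrightarrow> e i \<in> E (\<kappa> i)" by metis
  define N where "N = {x + J y |x y. x \<in> derived \<and> y \<in> derived}"
  have der: "derived \<subseteq> center"
    unfolding derived_def by (rule span_minimal) (use two_step subspace_center in auto)
  have sub_der: "subspace derived" by (simp add: derived_def)
  have N_span: "N = span (derived \<union> J ` derived)"
  proof -
    have "N = {x + y |x y. x \<in> derived \<and> y \<in> J ` derived}" by (auto simp: N_def)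
    then show ?thesis
      using sub_der linear_subspace_image[OF J_linear sub_der] by (simp add: span_Un span_eq_iff[THEN iffD2])
  qed
  have subN: "subspace N" by (simp add: N_span)
  have N_center: "N \<subseteq> center"
    using der subspace_center by (auto simp: N_def subspace_add subset_iff)
  have JN: "J x \<in> N" if x: "x \<in> N" for x
  proof -
    obtain a b where "a \<in> derived" "b \<in> derived" "x = a + J b" using x by (auto simp: N_def)
    then have "J x = - b + J a" "- b \<in> derived" "a \<in> derived" using sub_der by (simp_all add: J_simps subspace_neg)
    then show ?thesis unfolding N_def by blast
  qed
  define N' where "N' = {x\<in>center. \<forall>y\<in>N. x \<bullet> y = 0}"
  have subN': "subspace N'" using subspace_center by (auto simp: N'_def subspace_def inner_add_left)
  have JN': "J x \<in> N'" if "x \<in> N'" for x using that JN by (simp add: N'_def J_skew)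
  obtain k2 e2 where e2: "unitary_basis k2 e2 N'" using unitary_basis_exists_J[OF subN' JN'] by blast
  obtain k3 e3 where e3: "unitary_basis k3 e3 N" using unitary_basis_exists_J[OF subN JN] by blast
  define e12 where "e12 = (\<lambda>i. if i < s then e i else e2 (i - s))"
  define f where "f = (\<lambda>i. if i < s + k2 then e12 i else e3 (i - (s + k2)))"
  have e12: "unitary_basis (s + k2) e12 {x + y |x y. x \<in> W \<and> y \<in> N'}"
    unfolding e12_def by (rule unitary_basis_append[OF e(1) e2]) (use JN' in \<open>auto simp: W_def N'_def\<close>)
  have f0: "unitary_basis (s + k2 + k3) f {x + y |x y. x \<in> {x + y |x y. x \<in> W \<and> y \<in> N'} \<and> y \<in> N}"
    unfolding f_def
    by (rule unitary_basis_append[OF e12 e3])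
      (use JN N_center in \<open>auto simp: W_def N'_def inner_add_left subset_iff\<close>)
  have "{x + y |x y. x \<in> {x + y |x y. x \<in> W \<and> y \<in> N'} \<and> y \<in> N} = UNIV"
  proof -
    have "\<exists>a b c. x = a + b + c \<and> a \<in> W \<and> b \<in> N' \<and> c \<in> N" for x
    proof -
      obtain z w where x: "z \<in> center" "w \<in> W" "x = z + w" using center_W_decomp .
      obtain P where P: "\<And>x. P x \<in> N" "\<And>x y. y \<in> N \<Longrightarrow> (x - P x) \<bullet> y = 0"
        using orthogonal_projection_exists[OF subN] by metis
      have "z - P z \<in> center" using P(1) x(1) N_center subspace_center by (intro subspace_diff) auto
      then have "z - P z \<in> N'" using P(2) by (simp add: N'_def)
      then have "x = w + (z - P z) + P z \<and> w \<in> W \<and> (z - P z) \<in> N' \<and> P z \<in> N" using x P by simp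
      then show ?thesis by blast
    qed
    then show ?thesis by blast
  qed
  with f0 have f: "unitary_basis (s + k2 + k3) f UNIV" by simp
  have f_lt: "f i = e i" if "i < s" for i using that by (simp add: f_def e12_def)
  have f_center: "f i \<in> center" if i: "s \<le> i" "i < s + k2 + k3" for i
  proof (cases "i < s + k2")
    case True
    then have "e2 (i - s) \<in> N'" using unitary_basis_in[OF e2] i by auto
    then show ?thesis using True i by (simp add: f_def e12_def N'_def)
  next
    case False
    then have "e3 (i - (s + k2)) \<in> N" using unitary_basis_in[OF e3] i by auto
    then show ?thesis using False N_center by (auto simp: f_def)
  qed
  have onb: "f i \<bullet> f j = (if i = j then 1 else 0)" "f i \<bullet> J (f j) = 0" if "i < s + k2 + k3" "j < s + k2 + k3" for i j
    using f that by (auto simp: unitary_basis_def)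
  have br1: "br (f i) b = (J (f i) \<bullet> b) *\<^sub>R \<kappa> i" if "i < s" for i b
    using br_inner_E[OF \<kappa>(2)[OF that] \<kappa>(1)[OF that]] f_lt[OF that] by simp
  have br2: "br (J (f i)) b = - (f i \<bullet> b) *\<^sub>R \<kappa> i" if "i < s" for i b
    using br_inner_E[OF J_in_E[OF \<kappa>(2)[OF that]] \<kappa>(1)[OF that]] f_lt[OF that] by (simp add: JJ)
  have \<kappa>0: "\<kappa> i \<noteq> 0" if "i < s" for i
  proof
    assume "\<kappa> i = 0"
    then have "nb z (e i) = 0" if "z \<in> center" for z using E_nb[OF \<kappa>(2)[OF \<open>i < s\<close>] that] by simp
    then have "e i = 0" using flat_part_trivial[OF E_W[OF \<kappa>(2)[OF that]]] by blast
    then show False using onb(1)[of i i] f_lt[OF that] that by simp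
  qed
  have orth: "\<kappa> i \<bullet> \<kappa> j = 0" if ij: "i < s" "j < s" "i \<noteq> j" for i j
  proof -
    have ne: "e i \<noteq> 0" "e j \<noteq> 0" using onb(1)[of i i] onb(1)[of j j] f_lt ij by auto
    \<comment> \<open>e j takes the roles of both y and u, with v = 0\<close>
    interpret comp: second_center_component br J nb "e j" "e j" 0 "\<kappa> j"
      by unfold_locales (use \<kappa> ij ne E_W two_step subspace_W in \<open>auto simp: subspace_0\<close>)
    show ?thesis
    proof (cases "\<kappa> i = \<kappa> j")
      case True
      have "e i = 0"
        by (rule comp.E_complex_line[OF \<kappa>(2)[OF ij(2)] ne(2)])
          (use \<kappa>(2)[OF ij(1)] True onb[of i j] f_lt ij in auto)
      then show ?thesis using ne by simp
    next
      case False
      then show ?thesis using comp.other_characters_orthogonal[OF \<kappa>(1)[OF ij(1)]] \<kappa>(2)[OF ij(1)] ne by blast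
    qed
  qed
  have brff: "br (f i) (f j) = 0" "br (J (f i)) (J (f j)) = 0"
    "br (f i) (J (f j)) = (if i = j \<and> i < s then \<kappa> i else 0)"
    if ij: "i < s + k2 + k3" "j < s + k2 + k3" for i j
  proof -
    have *: "br (f i) (f j) = 0 \<and> br (J (f i)) (J (f j)) = 0 \<and>
      br (f i) (J (f j)) = (if i = j \<and> i < s then \<kappa> i else 0)"
    proof (cases "i < s")
      case True
      show ?thesis unfolding br1[OF True] br2[OF True]
        using True onb[OF ij] onb(2)[OF ij(2,1)] by (simp add: J_isometry inner_commute[of "J (f i)" "f j"])
    next
      case False
      then have "f i \<in> center" using f_center ij by simp
      then show ?thesis using False by simp
    qed
    show "br (f i) (f j) = 0" "br (J (f i)) (J (f j)) = 0"
      "br (f i) (J (f j)) = (if i = j \<and> i < s then \<kappa> i else 0)" using * by blast+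
  qed
  have derived: "derived = span (\<kappa> ` {..<s})"
  proof
    have "br a b \<in> span (\<kappa> ` {..<s})" for a b
    proof (rule br_in_span[where F = "f ` {..<s + k2 + k3} \<union> (\<lambda>i. J (f i)) ` {..<s + k2 + k3}"])
      fix x y assume "x \<in> f ` {..<s + k2 + k3} \<union> (\<lambda>i. J (f i)) ` {..<s + k2 + k3}"
        "y \<in> f ` {..<s + k2 + k3} \<union> (\<lambda>i. J (f i)) ` {..<s + k2 + k3}"
      then obtain i j where ij: "i < s + k2 + k3" "j < s + k2 + k3" "x = f i \<or> x = J (f i)" "y = f j \<or> y = J (f j)"
        by auto
      have "br x y = 0 \<or> (i < s \<and> (br x y = \<kappa> i \<or> br x y = - \<kappa> i))"
        using ij(3,4) brff[OF ij(1,2)] brff[OF ij(2,1)] br_skew[of "J (f i)" "f j"]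
        by (auto split: if_splits)
      then show "br x y \<in> span (\<kappa> ` {..<s})"
        using span_base[of "\<kappa> i" "\<kappa> ` {..<s}"] span_neg[of "\<kappa> i" "\<kappa> ` {..<s}"] span_0
        by fastforce
    qed (use f in \<open>auto simp: unitary_basis_def\<close>)
    then show "derived \<subseteq> span (\<kappa> ` {..<s})" unfolding derived_def by (intro span_minimal) auto
    have "\<kappa> i \<in> derived" if "i < s" for i
    proof -
      have "br (f i) (J (f i)) = \<kappa> i" using brff(3)[of i i] that by simp
      moreover have "br (f i) (J (f i)) \<in> derived" unfolding derived_def by (rule span_base) blast
      ultimately show ?thesis by simp
    qed
    then show "span (\<kappa> ` {..<s}) \<subseteq> derived" using sub_der by (intro span_minimal) auto
  qed
  have N: "N = span (f ` {s + k2..<s + k2 + k3} \<union> (\<lambda>i. J (f i)) ` {s + k2..<s + k2 + k3})"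
  proof -
    have "{s + k2..<s + k2 + k3} = (\<lambda>i. i + (s + k2)) ` {..<k3}"
      using image_add_atLeastLessThan'[of "s + k2" 0 k3] by (simp add: atLeast0LessThan add.commute)
    moreover have "f (i + (s + k2)) = e3 i" for i by (simp add: f_def)
    ultimately have "f ` {s + k2..<s + k2 + k3} = e3 ` {..<k3}"
      "(\<lambda>i. J (f i)) ` {s + k2..<s + k2 + k3} = (\<lambda>i. J (e3 i)) ` {..<k3}"
      by (simp_all only: image_image)
    then show ?thesis using e3 by (simp add: unitary_basis_def)
  qed
  show thesis
    by (rule that[OF f _ _ N[unfolded N_def] derived \<kappa>0 orth brff]) auto
qed

end

section \<open>Lie algebras in normal form\<close>

lemma dim_orthonormal:
  fixes v :: "'i \<Rightarrow> 'e::euclidean_space"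
  assumes fin: "finite I" and o: "\<And>i k. i \<in> I \<Longrightarrow> k \<in> I \<Longrightarrow> v i \<bullet> v k = (if i = k then 1 else 0)"
  shows "dim (span (v ` I)) = card I"
proof -
  have inj: "inj_on v I"
  proof (rule inj_onI)
    fix i k assume "i \<in> I" "k \<in> I" "v i = v k"
    then show "i = k" using o[of i k] o[of i i] by (cases "i = k") auto
  qed
  have "pairwise orthogonal (v ` I)"
    unfolding pairwise_def orthogonal_def
  proof (clarsimp)
    fix i k assume "i \<in> I" "k \<in> I" "v i \<noteq> v k"
    then show "v i \<bullet> v k = 0" using o[of i k] by (cases "i = k") auto
  qed
  moreover have "0 \<notin> v ` I"
  proof
    assume "0 \<in> v ` I"
    then obtain i where "i \<in> I" "v i = 0" by auto
    then show False using o[of i i] by simp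
  qed
  ultimately have "independent (v ` I)" by (rule pairwise_orthogonal_independent)
  then have "dim (span (v ` I)) = card (v ` I)" by (simp add: dim_eq_card_independent)
  then show ?thesis using inj by (simp add: card_image)
qed

context hermitian_lie_algebra
begin

text \<open>
The normal form of the theorem, stated inside the Euclidean model of the Lie algebra.
\<close>
definition skl_type :: "nat \<Rightarrow> nat \<Rightarrow> nat \<Rightarrow> (nat \<Rightarrow> 'e) \<Rightarrow> (nat \<Rightarrow> 'e) \<Rightarrow> (nat \<Rightarrow> real) \<Rightarrow> bool" where
  "skl_type n r s X \<epsilon> l \<longleftrightarrow>
     (\<forall>x y z. br x (br y z) = 0) \<and> r \<le> n \<and>
     (\<forall>i\<in>{1..s}. \<forall>k\<in>{1..s}. X i \<bullet> X k = (if i = k then 1 else 0)) \<and> span (X ` {1..s}) = derived \<and>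
     (\<forall>i\<in>{1..2 * n}. \<forall>k\<in>{1..2 * n}. \<epsilon> i \<bullet> \<epsilon> k = (if i = k then 1 else 0)) \<and> span (\<epsilon> ` {1..2 * n}) = UNIV \<and>
     (\<forall>i\<in>{1..n}. J (\<epsilon> i) = \<epsilon> (n + i)) \<and>
     {x + J y |x y. x \<in> derived \<and> y \<in> derived} = span (\<epsilon> ` ({r + 1..n} \<union> {n + r + 1..2 * n})) \<and>
     (\<forall>i\<in>{1..s}. l i > 0) \<and>
     (\<forall>i\<in>{1..2 * n}. \<forall>k\<in>{1..2 * n}. i < k \<longrightarrow>
        br (\<epsilon> i) (\<epsilon> k) = (if i \<le> s \<and> k = n + i then l i *\<^sub>R X i else 0))"

lemma br_in_derived: "br x y \<in> derived"
  unfolding derived_def by (rule span_base) blast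

end

locale skl_type_algebra = hermitian_lie_algebra br J for br :: "'e::euclidean_space \<Rightarrow> 'e \<Rightarrow> 'e" and J +
  fixes n r s X \<epsilon> l
  assumes skl_type: "skl_type n r s X \<epsilon> l"
begin

lemmas skl_type_unfolded = skl_type[unfolded skl_type_def]
lemmas two_step = skl_type_unfolded[THEN conjunct1, rule_format]
lemmas r_le = skl_type_unfolded[THEN conjunct2, THEN conjunct1, rule_format]
lemmas X_orthonormal = skl_type_unfolded[THEN conjunct2, THEN conjunct2, THEN conjunct1, rule_format]
lemmas span_X = skl_type_unfolded[THEN conjunct2, THEN conjunct2, THEN conjunct2, THEN conjunct1, rule_format]
lemmas \<epsilon>_orthonormal = skl_type_unfolded[THEN conjunct2, THEN conjunct2, THEN conjunct2, THEN conjunct2, THEN conjunct1, rule_format]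
lemmas span_\<epsilon> = skl_type_unfolded[THEN conjunct2, THEN conjunct2, THEN conjunct2, THEN conjunct2, THEN conjunct2, THEN conjunct1, rule_format]
lemmas J_\<epsilon> = skl_type_unfolded[THEN conjunct2, THEN conjunct2, THEN conjunct2, THEN conjunct2, THEN conjunct2, THEN conjunct2, THEN conjunct1, rule_format]
lemmas derived_J = skl_type_unfolded[THEN conjunct2, THEN conjunct2, THEN conjunct2, THEN conjunct2, THEN conjunct2, THEN conjunct2, THEN conjunct2, THEN conjunct1, rule_format]
lemmas l_pos = skl_type_unfolded[THEN conjunct2, THEN conjunct2, THEN conjunct2, THEN conjunct2, THEN conjunct2, THEN conjunct2, THEN conjunct2, THEN conjunct2, THEN conjunct1, rule_format]
lemmas br_\<epsilon> = skl_type_unfolded[THEN conjunct2, THEN conjunct2, THEN conjunct2, THEN conjunct2, THEN conjunct2, THEN conjunct2, THEN conjunct2, THEN conjunct2, THEN conjunct2, rule_format]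

lemma br_\<epsilon>_\<epsilon>: "i \<in> {1..n} \<Longrightarrow> k \<in> {1..n} \<Longrightarrow> br (\<epsilon> i) (\<epsilon> k) = 0"
  and br_J_J: "i \<in> {1..n} \<Longrightarrow> k \<in> {1..n} \<Longrightarrow> br (J (\<epsilon> i)) (J (\<epsilon> k)) = 0"
  and br_\<epsilon>_J: "i \<in> {1..n} \<Longrightarrow> k \<in> {1..n} \<Longrightarrow> br (\<epsilon> i) (J (\<epsilon> k)) = (if i = k \<and> i \<le> s then l i *\<^sub>R X i else 0)"
proof -
  assume ik: "i \<in> {1..n}" "k \<in> {1..n}"
  show "br (\<epsilon> i) (\<epsilon> k) = 0"
  proof (cases i k rule: linorder_cases)
    case less then show ?thesis using br_\<epsilon>[of i k] ik by simp
  next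
    case greater then show ?thesis using br_\<epsilon>[of k i] ik br_skew[of "\<epsilon> i" "\<epsilon> k"] by simp
  qed simp
  show "br (J (\<epsilon> i)) (J (\<epsilon> k)) = 0"
  proof (cases i k rule: linorder_cases)
    case less then show ?thesis using br_\<epsilon>[of "n + i" "n + k"] ik J_\<epsilon> by simp
  next
    case greater
    then show ?thesis using br_\<epsilon>[of "n + k" "n + i"] ik J_\<epsilon> br_skew[of "\<epsilon> (n + i)" "\<epsilon> (n + k)"] by simp
  qed simp
  show "br (\<epsilon> i) (J (\<epsilon> k)) = (if i = k \<and> i \<le> s then l i *\<^sub>R X i else 0)"
    using br_\<epsilon>[of i "n + k"] ik J_\<epsilon> by auto
qed

lemma br_J_\<epsilon>: "i \<in> {1..n} \<Longrightarrow> k \<in> {1..n} \<Longrightarrow> br (J (\<epsilon> i)) (\<epsilon> k) = - (if k = i \<and> k \<le> s then l k *\<^sub>R X k else 0)"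
  using br_\<epsilon>_J[of k i] br_skew[of "J (\<epsilon> i)" "\<epsilon> k"] by simp

lemma \<epsilon>_cases:
  assumes "a \<in> \<epsilon> ` {1..2 * n}"
  obtains i where "i \<in> {1..n}" "a = \<epsilon> i" | i where "i \<in> {1..n}" "a = J (\<epsilon> i)"
proof -
  obtain i where i: "i \<in> {1..2 * n}" "a = \<epsilon> i" using assms by blast
  show thesis
  proof (cases "i \<le> n")
    case True then show ?thesis using that(1)[of i] i by simp
  next
    case False
    then have "i - n \<in> {1..n}" "n + (i - n) = i" using i(1) by auto
    then show ?thesis using that(2)[of "i - n"] i(2) J_\<epsilon>[of "i - n"] by simp
  qed
qed

lemma J_\<epsilon>_inner: "i \<in> {1..n} \<Longrightarrow> k \<in> {1..n} \<Longrightarrow> \<epsilon> i \<bullet> J (\<epsilon> k) = 0"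
  "i \<in> {1..n} \<Longrightarrow> k \<in> {1..n} \<Longrightarrow> \<epsilon> i \<bullet> \<epsilon> k = (if i = k then 1 else 0)"
  using \<epsilon>_orthonormal[of i "n + k"] \<epsilon>_orthonormal[of i k] J_\<epsilon>[of k] by simp_all

lemma bilinear_eq_on_\<epsilon>:
  assumes "\<And>y. linear (\<lambda>x. F x y)" "\<And>x. linear (F x)" "\<And>y. linear (\<lambda>x. G x y)" "\<And>x. linear (G x)"
    and "\<And>a b. a \<in> \<epsilon> ` {1..2 * n} \<Longrightarrow> b \<in> \<epsilon> ` {1..2 * n} \<Longrightarrow> F a b = G a b"
  shows "F x y = (G x y :: 'b::real_vector)"
proof -
  have *: "F a y = G a y" if "a \<in> \<epsilon> ` {1..2 * n}" for a
    using linear_eq_on_span[OF assms(2,4), of "\<epsilon> ` {1..2 * n}" a a y] assms(5)[OF that] span_\<epsilon> by blast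
  show ?thesis
    using linear_eq_on_span[OF assms(1,3), of "\<epsilon> ` {1..2 * n}" y y x] * span_\<epsilon> by blast
qed

lemma abelian: "br (J x) (J y) = br x y"
proof (rule bilinear_eq_on_\<epsilon>[where F = "\<lambda>x y. br (J x) (J y)" and G = br])
  show "linear (\<lambda>x. br (J x) (J y))" for y by (rule linearI) (simp_all add: J_simps br_simps)
  show "linear (\<lambda>y. br (J x) (J y))" for x by (rule linearI) (simp_all add: J_simps br_simps)
  show "br (J a) (J b) = br a b" if "a \<in> \<epsilon> ` {1..2 * n}" "b \<in> \<epsilon> ` {1..2 * n}" for a b
    using that(1)
  proof (cases rule: \<epsilon>_cases)
    case (1 i) note a = this
    show ?thesis using that(2)
      by (cases rule: \<epsilon>_cases)
        (use a br_\<epsilon>_\<epsilon> br_J_J br_\<epsilon>_J br_J_\<epsilon> in \<open>auto simp: JJ br_simps\<close>)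
  next
    case (2 i) note a = this
    show ?thesis using that(2)
      by (cases rule: \<epsilon>_cases)
        (use a br_\<epsilon>_\<epsilon> br_J_J br_\<epsilon>_J br_J_\<epsilon> in \<open>auto simp: JJ br_simps\<close>)
  qed
qed (rule linear_br)+

lemma br_J_left: "br (J x) y = - br x (J y)"
  using abelian[of "J x" y] by (simp add: JJ br_simps)

lemma derived_central: "d \<in> derived \<Longrightarrow> br x d = 0"
  unfolding derived_def by (induction rule: span_induct_alt) (auto simp: br_simps two_step)

lemma J_derived_central:
  assumes "d \<in> derived"
  shows "br x (J d) = 0"
  using br_J_left[of x d] derived_central[OF assms, of "J x"] by simp

lemma dim_derived: "dim derived = s"
  using dim_orthonormal[of "{1..s}" X] X_orthonormal by (simp add: span_X[symmetric])

lemma s_le_n: "s \<le> n"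
proof -
  let ?S = "span (X ` {1..min s n})"
  have "br x y \<in> ?S" for x y
  proof (rule br_in_span[where F = "\<epsilon> ` {1..2 * n}"])
    fix a b assume a: "a \<in> \<epsilon> ` {1..2 * n}" and b: "b \<in> \<epsilon> ` {1..2 * n}"
    have X: "l i *\<^sub>R X i \<in> ?S" if "i \<in> {1..n}" "i \<le> s" for i
      using that by (intro span_scale span_base) auto
    have \<epsilon>J: "br (\<epsilon> i) (J (\<epsilon> k)) \<in> ?S" if "i \<in> {1..n}" "k \<in> {1..n}" for i k
      using br_\<epsilon>_J[OF that] X[OF that(1)] by (cases "i = k \<and> i \<le> s") (auto simp: span_0)
    show "br a b \<in> ?S" using a
    proof (cases rule: \<epsilon>_cases)
      case (1 i)
      show ?thesis using b by (cases rule: \<epsilon>_cases) (use 1 br_\<epsilon>_\<epsilon> \<epsilon>J in \<open>auto simp: span_0\<close>)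
    next
      case (2 i)
      show ?thesis using b
        by (cases rule: \<epsilon>_cases)
          (use 2 br_J_J br_J_\<epsilon> X in \<open>auto simp: span_0 intro: span_neg\<close>)
    qed
  qed (simp_all only: span_\<epsilon> UNIV_I subspace_span)
  then have "derived \<subseteq> ?S" unfolding derived_def by (intro span_minimal) auto
  then have "s \<le> dim ?S" using dim_subset dim_derived by metis
  also have "\<dots> \<le> card (X ` {1..min s n})" by (simp add: dim_le_card')
  also have "\<dots> \<le> min s n" using card_image_le[of "{1..min s n}" X] by simp
  finally show ?thesis by simp
qed

lemma dim_derived_J: "dim {x + J y |x y. x \<in> derived \<and> y \<in> derived} = 2 * (n - r)"
proof -
  have "dim (span (\<epsilon> ` ({r + 1..n} \<union> {n + r + 1..2 * n}))) = card ({r + 1..n} \<union> {n + r + 1..2 * n})"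
    by (rule dim_orthonormal) (use \<epsilon>_orthonormal in auto)
  also have "\<dots> = card {r + 1..n} + card {n + r + 1..2 * n}" by (rule card_Un_disjoint) auto
  finally show ?thesis unfolding derived_J by simp
qed

text \<open>
The first two bounds compare \<open>\<nn>\<close> with \<open>\<nn> + J \<nn>\<close>. The third holds because \<open>\<nn> + J \<nn>\<close> is central, whereas
\<open>\<epsilon>\<^sub>1, \<dots>, \<epsilon>\<^sub>s\<close> are not.
\<close>
lemma dimension_bounds: "n - r \<le> s" "s \<le> 2 * (n - r)" "s \<le> r"
proof -
  let ?N = "{x + J y |x y. x \<in> derived \<and> y \<in> derived}"
  have sub: "subspace derived" by (simp add: derived_def)
  have subJ: "subspace (J ` derived)" by (rule linear_subspace_image[OF J_linear sub])
  have "?N = {x + y |x y. x \<in> derived \<and> y \<in> J ` derived}" by auto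
  then have "dim ?N \<le> dim derived + dim (J ` derived)"
    using dim_sums_Int[OF sub subJ] by simp
  also have "dim (J ` derived) \<le> dim derived" by (rule dim_image_le[OF J_linear])
  finally show "n - r \<le> s" unfolding dim_derived_J dim_derived by simp
  have "x \<in> ?N" if "x \<in> derived" for x
  proof -
    have "x = x + J 0" "0 \<in> derived" using sub by (simp_all add: J_simps subspace_0)
    then show ?thesis using that by blast
  qed
  then have "derived \<subseteq> ?N" by blast
  then show "s \<le> 2 * (n - r)" using dim_subset[of derived ?N] dim_derived_J dim_derived by simp
  show "s \<le> r"
  proof (rule ccontr)
    assume "\<not> s \<le> r"
    then have i: "s \<in> {1..n}" "s \<in> {r + 1..n}" "s \<in> {1..s}" using s_le_n by auto
    \<comment> \<open>for \<open>s > r\<close> the vector \<open>\<epsilon>\<^sub>s\<close> lies in \<open>\<nn> + J \<nn>\<close>, which is central\<close>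
    have "\<epsilon> s \<in> ?N" unfolding derived_J using i(2) by (intro span_base) blast
    then obtain x y where "x \<in> derived" "y \<in> derived" "\<epsilon> s = x + J y" by blast
    then have "br (J (\<epsilon> s)) (\<epsilon> s) = 0"
      using derived_central[of x "J (\<epsilon> s)"] J_derived_central[of y "J (\<epsilon> s)"]
        bilinear_radd[OF br_bilinear, of "J (\<epsilon> s)" x "J y"] by simp
    then have "l s *\<^sub>R X s = 0"
      using br_\<epsilon>_J[OF i(1,1)] br_skew[of "\<epsilon> s" "J (\<epsilon> s)"] by simp
    then show False using l_pos[OF i(3)] X_orthonormal[OF i(3,3)] by auto
  qed
qed

text \<open>
The left-hand side is the closedness of the fundamental form. Evaluated on \<open>\<epsilon>\<^sub>1, J \<epsilon>\<^sub>1, J X\<^sub>1\<close>, where \<open>J X\<^sub>1\<close> is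
central, it would force \<open>\<lambda>\<^sub>1 = 0\<close>.
\<close>
lemma kahler_iff: "(\<forall>x y z. J (br x y) \<bullet> z + J (br y z) \<bullet> x + J (br z x) \<bullet> y = 0) \<longleftrightarrow> s = 0 \<and> r = n"
proof
  assume K: "\<forall>x y z. J (br x y) \<bullet> z + J (br y z) \<bullet> x + J (br z x) \<bullet> y = 0"
  have "s = 0"
  proof (rule ccontr)
    assume "s \<noteq> 0"
    then have 1: "1 \<in> {1..s}" "1 \<in> {1..n}" using s_le_n by auto
    have "X 1 \<in> derived" unfolding span_X[symmetric] using 1(1) by (intro span_base) blast
    then have z: "br x (J (X 1)) = 0" "br (J (X 1)) x = 0" for x
      using J_derived_central br_skew[of "J (X 1)" x] by simp_all
    have "J (br (\<epsilon> 1) (J (\<epsilon> 1))) \<bullet> J (X 1) = 0"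
      using K[rule_format, of "\<epsilon> 1" "J (\<epsilon> 1)" "J (X 1)"] z by (simp add: J_simps)
    then show False
      using br_\<epsilon>_J[OF 1(2,2)] l_pos[OF 1(1)] X_orthonormal[OF 1(1,1)] \<open>s \<noteq> 0\<close> by (simp add: J_isometry)
  qed
  then show "s = 0 \<and> r = n" using dimension_bounds(1) r_le by simp
next
  assume "s = 0 \<and> r = n"
  then have "derived = {0}" using span_X by simp
  then have "br x y = 0" for x y using br_in_derived[of x y] by simp
  then show "\<forall>x y z. J (br x y) \<bullet> z + J (br y z) \<bullet> x + J (br z x) \<bullet> y = 0" by (simp add: J_simps)
qed

text \<open>
The Strominger connection of a Lie algebra with abelian complex structure: \<open>\<nabla>\<^sub>x y\<close> is minus the metric adjoint of
\<open>ad y\<close> applied to \<open>x\<close>, which makes the torsion skew and, as \<open>[J y, w] = - [y, J w]\<close>, commutes with \<open>J\<close>.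
\<close>
definition nb :: "'e \<Rightarrow> 'e \<Rightarrow> 'e"
  where "nb x y = - (\<Sum>b\<in>Basis. (x \<bullet> br y b) *\<^sub>R b)"

lemma nb_inner: "nb x y \<bullet> w = - (x \<bullet> br y w)"
proof -
  have "x \<bullet> br y w = x \<bullet> br y (\<Sum>b\<in>Basis. (w \<bullet> b) *\<^sub>R b)" by (simp only: euclidean_representation)
  also have "\<dots> = (\<Sum>b\<in>Basis. (w \<bullet> b) * (x \<bullet> br y b))"
    by (simp add: linear_sum[OF linear_br(1)] linear_scale[OF linear_br(1)] inner_sum_right)
  finally have 1: "x \<bullet> br y w = (\<Sum>b\<in>Basis. (w \<bullet> b) * (x \<bullet> br y b))" .
  have "nb x y \<bullet> w = - (\<Sum>b\<in>Basis. (x \<bullet> br y b) * (b \<bullet> w))"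
    by (simp add: nb_def inner_sum_left)
  also have "\<dots> = - (\<Sum>b\<in>Basis. (w \<bullet> b) * (x \<bullet> br y b))"
    by (simp add: inner_commute[of w] mult.commute)
  finally show ?thesis unfolding 1 .
qed

lemma nb_eqI: "(\<And>w. w \<in> \<epsilon> ` {1..2 * n} \<Longrightarrow> x \<bullet> w = y \<bullet> w) \<Longrightarrow> x = y"
proof -
  assume eq: "\<And>w. w \<in> \<epsilon> ` {1..2 * n} \<Longrightarrow> x \<bullet> w = y \<bullet> w"
  have "(x - y) \<bullet> w = 0" if "w \<in> span (\<epsilon> ` {1..2 * n})" for w
    using that by (induction rule: span_induct_alt) (auto simp: inner_add_right inner_diff_left eq)
  then have "(x - y) \<bullet> (x - y) = 0" using span_\<epsilon> by blast
  then show ?thesis by simp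
qed

lemma nb_bilinear: "bilinear nb"
  unfolding bilinear_def
proof (intro conjI allI)
  show "linear (nb x)" for x
    by (rule linearI; rule nb_eqI) (simp_all add: nb_inner inner_add_left inner_add_right br_simps)
  show "linear (\<lambda>x. nb x y)" for y
    by (rule linearI; rule nb_eqI) (simp_all add: nb_inner inner_add_left)
qed

lemma nb_skew: "nb x y \<bullet> w = - (y \<bullet> nb x w)"
  using nb_inner[of x w y] br_skew[of y w] by (simp add: nb_inner inner_commute[of y])

lemma nb_J: "nb x (J y) = J (nb x y)"
  by (rule nb_eqI) (simp add: nb_inner J_skew br_J_left)

lemma nb_torsion_skew: "(nb x y - nb y x - br x y) \<bullet> w = - ((nb x w - nb w x - br x w) \<bullet> y)"
  using br_skew[of w y] by (simp add: inner_diff_left nb_inner inner_commute[of "br x _"])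

text \<open>
The angular velocity with which \<open>\<nabla>\<^sub>x\<close> rotates the plane of \<open>\<epsilon>\<^sub>i\<close> and \<open>J \<epsilon>\<^sub>i\<close>.
\<close>
definition rate :: "nat \<Rightarrow> 'e \<Rightarrow> real"
  where "rate i x = (if i \<le> s then l i * (x \<bullet> X i) else 0)"

lemma nb_\<epsilon>:
  assumes i: "i \<in> {1..n}"
  shows "nb x (\<epsilon> i) = - rate i x *\<^sub>R J (\<epsilon> i)"
proof (rule nb_eqI)
  fix w assume "w \<in> \<epsilon> ` {1..2 * n}"
  then show "nb x (\<epsilon> i) \<bullet> w = (- rate i x *\<^sub>R J (\<epsilon> i)) \<bullet> w"
  proof (cases rule: \<epsilon>_cases)
    case (1 k)
    have "J (\<epsilon> i) \<bullet> \<epsilon> k = 0" using J_\<epsilon>_inner(1)[OF 1(1) i] by (simp only: inner_commute)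
    then show ?thesis using br_\<epsilon>_\<epsilon>[OF i 1(1)] 1(2) by (simp add: nb_inner)
  next
    case (2 k)
    then show ?thesis using br_\<epsilon>_J[OF i 2(1)] J_\<epsilon>_inner(2)[OF i 2(1)]
      by (simp add: nb_inner J_isometry rate_def)
  qed
qed

lemma nb_commute: "nb x (nb y z) = nb y (nb x z)"
proof -
  have lin: "linear (\<lambda>z. nb x (nb y z))" for x y
    using nb_bilinear linear_compose[of "nb y" "nb x"] by (simp add: bilinear_def o_def)
  have \<epsilon>: "nb x (nb y (\<epsilon> i)) = - (rate i x * rate i y) *\<^sub>R \<epsilon> i" if "i \<in> {1..n}" for i x y
    by (simp add: nb_\<epsilon>[OF that] bilinear_rmul[OF nb_bilinear] bilinear_rneg[OF nb_bilinear] nb_J J_simps)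
  have "nb x (nb y a) = nb y (nb x a)" if "a \<in> \<epsilon> ` {1..2 * n}" for a
    using that by (cases rule: \<epsilon>_cases) (simp_all add: nb_J \<epsilon> mult.commute)
  then show ?thesis using linear_eq_on_span[OF lin lin, of "\<epsilon> ` {1..2 * n}" x y y x z] span_\<epsilon> by blast
qed

text \<open>
The 2-form dual to the plane of \<open>\<epsilon>\<^sub>i\<close> and \<open>J \<epsilon>\<^sub>i\<close>.
\<close>
definition area :: "nat \<Rightarrow> 'e \<Rightarrow> 'e \<Rightarrow> real"
  where "area i x y = (x \<bullet> \<epsilon> i) * (y \<bullet> J (\<epsilon> i)) - (x \<bullet> J (\<epsilon> i)) * (y \<bullet> \<epsilon> i)"

lemma br_area: "br x y = (\<Sum>i=1..s. (l i * area i x y) *\<^sub>R X i)"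
proof (rule bilinear_eq_on_\<epsilon>[where F = br and G = "\<lambda>x y. \<Sum>i=1..s. (l i * area i x y) *\<^sub>R X i"])
  show "linear (\<lambda>x. \<Sum>i=1..s. (l i * area i x y) *\<^sub>R X i)" for y
    by (rule linearI)
      (simp_all add: area_def inner_add_left scaleR_sum_right sum.distrib[symmetric] algebra_simps)
  show "linear (\<lambda>y. \<Sum>i=1..s. (l i * area i x y) *\<^sub>R X i)" for x
    by (rule linearI)
      (simp_all add: area_def inner_add_left scaleR_sum_right sum.distrib[symmetric] algebra_simps)
  have le: "i \<in> {1..n}" if "i \<in> {1..s}" for i using that s_le_n by auto
  have ar: "area i (\<epsilon> p) (\<epsilon> q) = 0" "area i (J (\<epsilon> p)) (J (\<epsilon> q)) = 0"
    "area i (\<epsilon> p) (J (\<epsilon> q)) = (if i = p \<and> i = q then 1 else 0)"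
    "area i (J (\<epsilon> p)) (\<epsilon> q) = - (if i = p \<and> i = q then 1 else 0)"
    if "i \<in> {1..s}" "p \<in> {1..n}" "q \<in> {1..n}" for i p q
    using J_\<epsilon>_inner(1)[OF that(2) le[OF that(1)]] J_\<epsilon>_inner(1)[OF that(3) le[OF that(1)]]
      J_\<epsilon>_inner(1)[OF le[OF that(1)] that(2)] J_\<epsilon>_inner(1)[OF le[OF that(1)] that(3)]
      J_\<epsilon>_inner(2)[OF that(2) le[OF that(1)]] J_\<epsilon>_inner(2)[OF that(3) le[OF that(1)]]
    by (auto simp: area_def J_isometry J_skew JJ)
  have pick: "(\<Sum>i=1..s. (l i * (if i = p \<and> i = q then 1 else 0)) *\<^sub>R X i) = (if p = q \<and> p \<le> s then l p *\<^sub>R X p else 0)"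
    if "p \<in> {1..n}" for p q
  proof -
    have "(\<Sum>i=1..s. (l i * (if i = p \<and> i = q then 1 else 0)) *\<^sub>R X i)
        = (\<Sum>i=1..s. if i = p then (if p = q then l p *\<^sub>R X p else 0) else 0)"
      by (rule sum.cong) auto
    also have "\<dots> = (if p = q \<and> p \<le> s then l p *\<^sub>R X p else 0)" using that by auto
    finally show ?thesis .
  qed
  show "br a b = (\<Sum>i=1..s. (l i * area i a b) *\<^sub>R X i)"
    if ab: "a \<in> \<epsilon> ` {1..2 * n}" "b \<in> \<epsilon> ` {1..2 * n}" for a b
    using ab(1)
  proof (cases rule: \<epsilon>_cases)
    case (1 p)
    show ?thesis using ab(2)
    proof (cases rule: \<epsilon>_cases)
      case q: (1 q)
      then show ?thesis using 1 br_\<epsilon>_\<epsilon> ar(1) by simp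
    next
      case q: (2 q)
      have "(\<Sum>i=1..s. (l i * area i a b) *\<^sub>R X i) = (\<Sum>i=1..s. (l i * (if i = p \<and> i = q then 1 else 0)) *\<^sub>R X i)"
        by (rule sum.cong) (use 1 q ar(3) in auto)
      then show ?thesis using 1 q br_\<epsilon>_J pick by simp
    qed
  next
    case (2 p)
    show ?thesis using ab(2)
    proof (cases rule: \<epsilon>_cases)
      case q: (1 q)
      have "(\<Sum>i=1..s. (l i * area i a b) *\<^sub>R X i) = - (\<Sum>i=1..s. (l i * (if i = p \<and> i = q then 1 else 0)) *\<^sub>R X i)"
        unfolding sum_negf[symmetric] by (rule sum.cong) (use 2 q ar(4) in auto)
      then show ?thesis using 2 q br_\<epsilon>_J[OF q(1) 2(1)] br_skew[of "J (\<epsilon> p)" "\<epsilon> q"] pick[OF 2(1)] by auto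
    next
      case q: (2 q)
      then show ?thesis using 2 br_J_J ar(2) by simp
    qed
  qed
qed (rule linear_br)+

text \<open>
All \<open>\<nabla>\<^sub>x\<close> commute, being rotations in the same planes, so only \<open>\<nabla>\<^bsub>[x, y]\<^esub> z\<close> contributes. Its cyclic sum paired
with \<open>w\<close> is \<open>\<Sum> \<lambda>\<^sub>i\<^sup>2 area\<^sub>i \<and> area\<^sub>i\<close>, which is zero since each \<open>area\<^sub>i\<close> is decomposable; this uses the
orthonormality of the \<open>X\<^sub>i\<close>.
\<close>
lemma nb_bianchi: "nb x (nb y z) - nb y (nb x z) - nb (br x y) z
      + (nb y (nb z x) - nb z (nb y x) - nb (br y z) x)
      + (nb z (nb x y) - nb x (nb z y) - nb (br z x) y) = 0"
proof -
  have inner: "br x y \<bullet> br z w = (\<Sum>i=1..s. (l i)\<^sup>2 * (area i x y * area i z w))" for x y z w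
  proof -
    have "br x y \<bullet> X i = l i * area i x y" if i: "i \<in> {1..s}" for i x y
    proof -
      have "br x y \<bullet> X i = (\<Sum>k=1..s. (l k * area k x y) * (X k \<bullet> X i))"
        by (subst br_area) (simp add: inner_sum_left)
      also have "\<dots> = (\<Sum>k=1..s. if k = i then l i * area i x y else 0)"
        by (rule sum.cong) (use X_orthonormal i in auto)
      finally show ?thesis using i by simp
    qed
    then have "br x y \<bullet> (\<Sum>i=1..s. (l i * area i z w) *\<^sub>R X i) = (\<Sum>i=1..s. (l i)\<^sup>2 * (area i x y * area i z w))"
      by (simp add: inner_sum_right power2_eq_square mult_ac)
    then show ?thesis by (simp only: br_area[of z w])
  qed
  have "nb (br x y) z + nb (br y z) x + nb (br z x) y = 0"
  proof (rule nb_eqI)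
    fix w
    have "(\<Sum>i=1..s. (l i)\<^sup>2 * (area i x y * area i z w)) + (\<Sum>i=1..s. (l i)\<^sup>2 * (area i y z * area i x w))
        + (\<Sum>i=1..s. (l i)\<^sup>2 * (area i z x * area i y w)) = 0"
      unfolding sum.distrib[symmetric] by (rule sum.neutral) (simp add: area_def algebra_simps)
    then show "(nb (br x y) z + nb (br y z) x + nb (br z x) y) \<bullet> w = 0 \<bullet> w"
      by (simp add: inner_add_left nb_inner inner)
  qed
  moreover have "nb x (nb y z) - nb y (nb x z) - nb (br x y) z
      + (nb y (nb z x) - nb z (nb y x) - nb (br y z) x)
      + (nb z (nb x y) - nb x (nb z y) - nb (br z x) y) = - (nb (br x y) z + nb (br y z) x + nb (br z x) y)"
    unfolding nb_commute[of y x z] nb_commute[of z y x] nb_commute[of x z y] by simp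
  ultimately show ?thesis by simp
qed

end

section \<open>Calculus of smooth functions\<close>

lemma C_k_on_cong:
  assumes "open S" "\<And>x. x \<in> S \<Longrightarrow> f x = g x" "C_k_on k S f"
  shows "C_k_on k S g"
  using assms(2,3)
proof (induction k arbitrary: f g)
  case 0
  then show ?case using continuous_on_cong[of S S f g] by simp
next
  case (Suc k)
  have d: "f differentiable (at x)" if "x \<in> S" for x using Suc.prems(2) that by simp
  have "g differentiable (at x)" if "x \<in> S" for x
  proof -
    have "(f has_derivative frechet_derivative f (at x)) (at x)"
      using d[OF that] by (simp add: frechet_derivative_works)
    then have "(g has_derivative frechet_derivative f (at x)) (at x)"
      by (rule has_derivative_transform_within_open[OF _ assms(1) that Suc.prems(1)])
    then show ?thesis by (auto simp: differentiable_def)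
  qed
  moreover have "C_k_on k S (\<lambda>x. frechet_derivative g (at x) v)" for v
  proof (rule Suc.IH)
    show "C_k_on k S (\<lambda>x. frechet_derivative f (at x) v)" using Suc.prems(2) by simp
    show "frechet_derivative f (at x) v = frechet_derivative g (at x) v" if "x \<in> S" for x
      using frechet_derivative_transform_within_open[OF d[OF that] assms(1) that Suc.prems(1)] by simp
  qed
  ultimately show ?case by simp
qed

lemma C_k_on_derivative:
  assumes "\<And>x. x \<in> S \<Longrightarrow> (f has_derivative f' x) (at x)"
    and "open S" "\<And>v. C_k_on k S (\<lambda>x. f' x v)"
  shows "C_k_on (Suc k) S f"
proof -
  have "f differentiable (at x)" "frechet_derivative f (at x) = f' x" if "x \<in> S" for x
    using assms(1)[OF that] frechet_derivative_at[OF assms(1)[OF that]] by (auto simp: differentiable_def)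
  moreover have "C_k_on k S (\<lambda>x. frechet_derivative f (at x) v)" for v
    by (rule C_k_on_cong[OF assms(2) _ assms(3)[of v]]) (simp add: calculation)
  ultimately show ?thesis by simp
qed

lemma C_k_on_Suc_has_derivative:
  "C_k_on (Suc k) S f \<Longrightarrow> x \<in> S \<Longrightarrow> (f has_derivative frechet_derivative f (at x)) (at x)"
  by (simp add: frechet_derivative_works[symmetric])

lemma C_k_on_subset: "C_k_on k S f \<Longrightarrow> T \<subseteq> S \<Longrightarrow> C_k_on k T f"
  by (induction k arbitrary: f) (auto intro: continuous_on_subset)

lemma C_k_on_SucD: "C_k_on (Suc k) S f \<Longrightarrow> C_k_on k S f"
proof (induction k arbitrary: f)
  case 0
  then show ?case
    using differentiable_imp_continuous_on differentiable_at_imp_differentiable_on C_k_on.simps by metis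
next
  case (Suc k)
  have "\<forall>x\<in>S. f differentiable (at x)" "\<And>v. C_k_on (Suc k) S (\<lambda>x. frechet_derivative f (at x) v)"
    using Suc.prems C_k_on.simps(2) by blast+
  then show ?case using Suc.IH C_k_on.simps(2) by blast
qed

lemma C_k_on_local:
  assumes "\<And>x. x \<in> S \<Longrightarrow> \<exists>T. open T \<and> x \<in> T \<and> C_k_on k T f"
  shows "C_k_on k S f"
  using assms
proof (induction k arbitrary: f)
  case 0
  have "isCont f x" if "x \<in> S" for x
    using 0[OF that] continuous_on_eq_continuous_at by auto
  then show ?case by (simp add: continuous_at_imp_continuous_on)
next
  case (Suc k)
  have "\<exists>T. open T \<and> x \<in> T \<and> C_k_on k T (\<lambda>x. frechet_derivative f (at x) v)" if "x \<in> S" for x v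
    using Suc.prems[OF that] C_k_on.simps(2) by blast
  moreover have "f differentiable (at x)" if "x \<in> S" for x
    using Suc.prems[OF that] C_k_on.simps(2) by blast
  ultimately show ?case using Suc.IH by simp
qed

lemma C_k_on_const: "C_k_on k S (\<lambda>x. c)"
proof (induction k arbitrary: c)
  case (Suc k)
  then show ?case by simp
qed simp

lemma C_k_on_add:
  assumes "open S" "C_k_on k S f" "C_k_on k S g"
  shows "C_k_on k S (\<lambda>x. f x + g x)"
  using assms(2,3)
proof (induction k arbitrary: f g)
  case 0 then show ?case by (simp add: continuous_on_add)
next
  case (Suc k)
  show ?case
    by (rule C_k_on_derivative[OF has_derivative_add assms(1)])
      (use Suc in \<open>auto intro: C_k_on_Suc_has_derivative\<close>)
qed

lemma C_k_on_bilinear: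
  assumes bl: "bounded_bilinear h" and S: "open S" and "C_k_on k S f" "C_k_on k S g"
  shows "C_k_on k S (\<lambda>x. h (f x) (g x))"
  using assms(3,4)
proof (induction k arbitrary: f g)
  case 0 then show ?case by (simp add: bounded_bilinear.continuous_on[OF bl])
next
  case (Suc k)
  show ?case
  proof (rule C_k_on_derivative[OF bounded_bilinear.FDERIV[OF bl] S])
    show "C_k_on k S (\<lambda>x. h (f x) (frechet_derivative g (at x) v) + h (frechet_derivative f (at x) v) (g x))" for v
      using Suc.prems by (intro C_k_on_add S Suc.IH C_k_on_SucD[OF Suc.prems(1)] C_k_on_SucD[OF Suc.prems(2)]) simp_all
  qed (use Suc.prems in \<open>auto intro: C_k_on_Suc_has_derivative\<close>)
qed

lemma C_k_on_sum:
  assumes "open S" "\<And>i. i \<in> I \<Longrightarrow> C_k_on k S (f i)"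
  shows "C_k_on k S (\<lambda>x. \<Sum>i\<in>I. f i x)"
  using assms(2)
proof (induction I rule: infinite_finite_induct)
  case (insert i I)
  then show ?case by (simp add: C_k_on_add[OF assms(1)])
qed (simp_all add: C_k_on_const)

lemma C_k_on_linear:
  assumes "bounded_linear f"
  shows "C_k_on k S f"
proof (cases k)
  case 0 then show ?thesis using assms by (simp add: linear_continuous_on)
next
  case (Suc j)
  have "C_k_on (Suc j) UNIV f"
    by (rule C_k_on_derivative[of _ _ "\<lambda>_. f"])
      (use assms C_k_on_const in \<open>auto intro: bounded_linear_imp_has_derivative\<close>)
  then show ?thesis using C_k_on_subset Suc by blast
qed

lemma C_k_on_compose:
  fixes f :: "'a::euclidean_space \<Rightarrow> 'b::euclidean_space" and g :: "'b \<Rightarrow> 'c::real_normed_vector"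
  assumes S: "open S" and "C_k_on k S f" "C_k_on k T g" "f ` S \<subseteq> T"
  shows "C_k_on k S (\<lambda>x. g (f x))"
  using assms(2-4)
proof (induction k arbitrary: g)
  case 0
  then show ?case by (auto intro: continuous_on_compose2)
next
  case (Suc k)
  have "((\<lambda>x. g (f x)) has_derivative (\<lambda>v. frechet_derivative g (at (f x)) (frechet_derivative f (at x) v))) (at x)"
    if "x \<in> S" for x
  proof -
    have "f x \<in> T" using that Suc.prems(3) by blast
    then show ?thesis
      using diff_chain_at[OF C_k_on_Suc_has_derivative[OF Suc.prems(1) that]
          C_k_on_Suc_has_derivative[OF Suc.prems(2)]] by (simp add: o_def)
  qed
  moreover have "C_k_on k S (\<lambda>x. frechet_derivative g (at (f x)) (frechet_derivative f (at x) v))" for v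
  proof (rule C_k_on_cong[OF S])
    show "C_k_on k S (\<lambda>x. \<Sum>b\<in>Basis. (frechet_derivative f (at x) v \<bullet> b) *\<^sub>R frechet_derivative g (at (f x)) b)"
    proof (intro C_k_on_sum S C_k_on_bilinear[OF bounded_bilinear_scaleR])
      fix b :: 'b
      show "C_k_on k S (\<lambda>x. frechet_derivative f (at x) v \<bullet> b)"
        using Suc.prems(1) by (intro C_k_on_bilinear[OF bounded_bilinear_inner] S C_k_on_const) auto
      show "C_k_on k S (\<lambda>x. frechet_derivative g (at (f x)) b)"
        using Suc.prems(2) by (intro Suc.IH C_k_on_SucD[OF Suc.prems(1)] Suc.prems(3)) simp
    qed
    fix x assume x: "x \<in> S"
    let ?D = "frechet_derivative g (at (f x))" and ?w = "frechet_derivative f (at x) v"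
    have lin: "linear ?D" using x Suc.prems by (intro linear_frechet_derivative) auto
    have "(\<Sum>b\<in>Basis. (?w \<bullet> b) *\<^sub>R ?D b) = ?D (\<Sum>b\<in>Basis. (?w \<bullet> b) *\<^sub>R b)"
      using lin by (simp add: linear_sum linear_scale)
    then show "(\<Sum>b\<in>Basis. (?w \<bullet> b) *\<^sub>R ?D b) = ?D ?w" by (simp add: euclidean_representation)
  qed
  ultimately show ?case by (rule C_k_on_derivative[OF _ S])
qed

lemma C_k_on_Pair:
  fixes f :: "'a::euclidean_space \<Rightarrow> 'b::euclidean_space" and g :: "'a \<Rightarrow> 'c::euclidean_space"
  assumes "open S" "C_k_on k S f" "C_k_on k S g"
  shows "C_k_on k S (\<lambda>x. (f x, g x))"
proof -
  have "C_k_on k S (\<lambda>x. (\<lambda>u. (u, 0 :: 'c)) (f x) + (\<lambda>u. (0 :: 'b, u)) (g x))"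
  proof (rule C_k_on_add[OF assms(1)])
    have "bounded_linear (\<lambda>u :: 'b. (u, 0 :: 'c))" "bounded_linear (\<lambda>u :: 'c. (0 :: 'b, u))"
      by (intro bounded_linear_Pair bounded_linear_ident bounded_linear_zero)+
    then show "C_k_on k S (\<lambda>x. (\<lambda>u. (u, 0 :: 'c)) (f x))" "C_k_on k S (\<lambda>x. (\<lambda>u. (0 :: 'b, u)) (g x))"
      using C_k_on_compose[OF assms(1,2) C_k_on_linear[of _ k UNIV]]
        C_k_on_compose[OF assms(1,3) C_k_on_linear[of _ k UNIV]] by blast+
  qed
  then show ?thesis by simp
qed

lemma smooth_on_subset: "smooth_on S f \<Longrightarrow> T \<subseteq> S \<Longrightarrow> smooth_on T f"
  by (auto simp: smooth_on_def intro: C_k_on_subset)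

lemma smooth_on_cong: "open S \<Longrightarrow> (\<And>x. x \<in> S \<Longrightarrow> f x = g x) \<Longrightarrow> smooth_on S f \<Longrightarrow> smooth_on S g"
  unfolding smooth_on_def using C_k_on_cong by blast

lemma smooth_on_local:
  assumes "\<And>x. x \<in> S \<Longrightarrow> \<exists>T. open T \<and> x \<in> T \<and> smooth_on T f"
  shows "smooth_on S f"
  unfolding smooth_on_def
proof
  fix k
  show "C_k_on k S f" by (rule C_k_on_local) (use assms in \<open>auto simp: smooth_on_def\<close>)
qed

lemma smooth_on_const: "smooth_on S (\<lambda>x. c)"
  by (simp add: smooth_on_def C_k_on_const)

lemma smooth_on_ident: "smooth_on S (\<lambda>x. x)"
  by (simp add: smooth_on_def C_k_on_linear bounded_linear_ident)

lemma smooth_on_add: "open S \<Longrightarrow> smooth_on S f \<Longrightarrow> smooth_on S g \<Longrightarrow> smooth_on S (\<lambda>x. f x + g x)"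
  by (simp add: smooth_on_def C_k_on_add)

lemma smooth_on_mult:
  fixes f g :: "_ \<Rightarrow> real"
  shows "open S \<Longrightarrow> smooth_on S f \<Longrightarrow> smooth_on S g \<Longrightarrow> smooth_on S (\<lambda>x. f x * g x)"
  by (simp add: smooth_on_def C_k_on_bilinear[OF bounded_bilinear_mult])

lemma smooth_on_inner:
  fixes f g :: "_ \<Rightarrow> _::real_inner"
  shows "open S \<Longrightarrow> smooth_on S f \<Longrightarrow> smooth_on S g \<Longrightarrow> smooth_on S (\<lambda>x. f x \<bullet> g x)"
  by (simp add: smooth_on_def C_k_on_bilinear[OF bounded_bilinear_inner])

lemma smooth_on_compose:
  fixes f :: "'a::euclidean_space \<Rightarrow> 'b::euclidean_space" and g :: "'b \<Rightarrow> 'c::real_normed_vector"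
  shows "open S \<Longrightarrow> smooth_on S f \<Longrightarrow> smooth_on T g \<Longrightarrow> f ` S \<subseteq> T \<Longrightarrow> smooth_on S (\<lambda>x. g (f x))"
  unfolding smooth_on_def using C_k_on_compose by blast

lemma smooth_on_Pair:
  fixes f :: "'a::euclidean_space \<Rightarrow> 'b::euclidean_space" and g :: "'a \<Rightarrow> 'c::euclidean_space"
  shows "open S \<Longrightarrow> smooth_on S f \<Longrightarrow> smooth_on S g \<Longrightarrow> smooth_on S (\<lambda>x. (f x, g x))"
  by (simp add: smooth_on_def C_k_on_Pair)

lemma smooth_on_frechet_derivative:
  "smooth_on S f \<Longrightarrow> smooth_on S (\<lambda>x. frechet_derivative f (at x) v)"
  unfolding smooth_on_def using C_k_on.simps(2) by blast

lemma smooth_on_has_derivative: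
  "smooth_on S f \<Longrightarrow> x \<in> S \<Longrightarrow> (f has_derivative frechet_derivative f (at x)) (at x)"
  unfolding smooth_on_def using C_k_on_Suc_has_derivative by blast

lemma smooth_on_continuous_on: "smooth_on S f \<Longrightarrow> continuous_on S f"
  unfolding smooth_on_def using C_k_on.simps(1) by blast

lemma ball_segment:
  fixes x c :: "'e::real_normed_vector"
  assumes "x \<in> ball c r" "0 \<le> t" "t \<le> 1"
  shows "c + t *\<^sub>R (x - c) \<in> ball c r"
proof -
  have "norm (t *\<^sub>R (x - c)) \<le> norm (x - c)" using assms(2,3) by (simp add: mult_left_le_one_le)
  then show ?thesis using assms(1) by (simp add: dist_norm norm_minus_commute)
qed

lemma continuous_on_segment:
  fixes G :: "'e::euclidean_space \<Rightarrow> 'b::topological_space"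
  assumes "continuous_on (ball c r) G"
  shows "continuous_on (ball c r \<times> cbox 0 (1::real)) (\<lambda>(x, t). G (c + t *\<^sub>R (x - c)))"
proof -
  have "continuous_on (ball c r \<times> cbox 0 (1::real)) (\<lambda>p. G (c + snd p *\<^sub>R (fst p - c)))"
    by (rule continuous_on_compose2[OF assms]) (auto intro!: continuous_intros ball_segment[simplified])
  then show ?thesis by (simp add: split_beta)
qed

text \<open>
Differentiation under the integral sign turns \<open>(m, G)\<close> into \<open>(m + 1, \<partial>\<^sub>v G)\<close>; the weight \<open>t ^ m\<close> is there to
make the statement closed under this step, so that induction on the order of smoothness works.
\<close>
lemma smooth_on_segment_integral:
  fixes G :: "'e::euclidean_space \<Rightarrow> real"
  assumes "smooth_on (ball c r) G"
  shows "smooth_on (ball c r) (\<lambda>x. integral (cbox 0 1) (\<lambda>t. t ^ m * G (c + t *\<^sub>R (x - c))))"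
  unfolding smooth_on_def
proof
  fix k
  show "C_k_on k (ball c r) (\<lambda>x. integral (cbox 0 1) (\<lambda>t. t ^ m * G (c + t *\<^sub>R (x - c))))"
    using assms
  proof (induction k arbitrary: G m)
    case 0
    have "continuous_on (ball c r \<times> cbox 0 (1::real)) (\<lambda>p. snd p ^ m * G (c + snd p *\<^sub>R (fst p - c)))"
      using continuous_on_segment[OF smooth_on_continuous_on[OF 0]]
      by (auto intro!: continuous_intros simp: split_beta)
    then show ?case
      unfolding C_k_on.simps by (intro integral_continuous_on_param) (simp add: split_beta)
  next
    case (Suc k)
    let ?D = "\<lambda>v x. frechet_derivative G (at x) v"
    let ?p = "\<lambda>x t. c + t *\<^sub>R (x - c)"
    define F where "F x t = (t ^ Suc m) *\<^sub>R (\<Sum>b\<in>Basis. ?D b (?p x t) *\<^sub>R blinfun_inner_left b)" for x t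
    have smD: "smooth_on (ball c r) (?D v)" for v
      by (rule smooth_on_frechet_derivative[OF Suc.prems])
    have apply_F: "blinfun_apply (F x t) v = t ^ Suc m * ?D v (?p x t)"
      if "x \<in> ball c r" "t \<in> cbox 0 1" for x t v
    proof -
      have "?p x t \<in> ball c r" using ball_segment that by auto
      then have lin: "linear (frechet_derivative G (at (?p x t)))"
        using smooth_on_has_derivative[OF Suc.prems] has_derivative_linear by blast
      have "?D v (?p x t) = frechet_derivative G (at (?p x t)) (\<Sum>b\<in>Basis. (v \<bullet> b) *\<^sub>R b)"
        by (simp add: euclidean_representation)
      also have "\<dots> = (\<Sum>b\<in>Basis. (v \<bullet> b) * ?D b (?p x t))"
        using lin by (simp add: linear_sum linear_scale)
      finally show ?thesis
        by (simp add: F_def blinfun.scaleR_left blinfun.sum_left mult.commute)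
    qed
    have contF: "continuous_on (ball c r \<times> cbox 0 1) (\<lambda>(x, t). F x t)"
      unfolding F_def split_beta
      using continuous_on_segment[OF smooth_on_continuous_on[OF smD]]
      by (intro continuous_intros) (auto simp: split_beta)
    have der: "((\<lambda>x. integral (cbox 0 1) (\<lambda>t. t ^ m * G (?p x t))) has_derivative
        blinfun_apply (integral (cbox 0 1) (F x0))) (at x0)" if x0: "x0 \<in> ball c r" for x0
    proof -
      have "((\<lambda>x. integral (cbox 0 1) (\<lambda>t. t ^ m * G (?p x t))) has_derivative
        blinfun_apply (integral (cbox 0 1) (F x0))) (at x0 within ball c r)"
      proof (rule leibniz_rule[OF _ _ contF x0 convex_ball])
        fix x and t :: real assume xt: "x \<in> ball c r" "t \<in> cbox 0 1"
        have "(G has_derivative frechet_derivative G (at (?p x t))) (at (?p x t))"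
          by (intro smooth_on_has_derivative[OF Suc.prems] ball_segment) (use xt in auto)
        moreover have "((\<lambda>x. ?p x t) has_derivative (\<lambda>v. t *\<^sub>R v)) (at x)"
          by (auto intro!: derivative_eq_intros)
        ultimately have "((\<lambda>x. G (?p x t)) has_derivative (\<lambda>v. ?D (t *\<^sub>R v) (?p x t))) (at x)"
          using diff_chain_at[of "\<lambda>x. ?p x t"] by (simp add: o_def)
        then have "((\<lambda>x. t ^ m * G (?p x t)) has_derivative (\<lambda>v. t ^ m * ?D (t *\<^sub>R v) (?p x t))) (at x)"
          by (rule has_derivative_mult_right)
        moreover have "t ^ m * ?D (t *\<^sub>R v) (?p x t) = blinfun_apply (F x t) v" for v
        proof -
          have "linear (frechet_derivative G (at (?p x t)))"
            by (intro has_derivative_linear[OF smooth_on_has_derivative[OF Suc.prems]] ball_segment) (use xt in auto)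
          then show ?thesis by (simp add: apply_F[OF xt] linear_scale)
        qed
        ultimately show "((\<lambda>x. t ^ m * G (?p x t)) has_derivative blinfun_apply (F x t)) (at x within ball c r)"
          by (simp add: has_derivative_at_withinI)
      next
        fix x assume "x \<in> ball c r"
        have "continuous_on (cbox 0 1) (\<lambda>t. ?p x t)" by (intro continuous_intros)
        moreover have "(\<lambda>t. ?p x t) ` cbox 0 1 \<subseteq> ball c r"
          using ball_segment[OF \<open>x \<in> ball c r\<close>] by (simp add: image_subset_iff del: mem_ball)
        ultimately have "continuous_on (cbox 0 1) (\<lambda>t. G (?p x t))"
          by (rule continuous_on_compose2[OF smooth_on_continuous_on[OF Suc.prems]])
        then have "continuous_on (cbox 0 1) (\<lambda>t. t ^ m * G (?p x t))"
          by (intro continuous_on_mult continuous_on_power continuous_on_id)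
        then show "(\<lambda>t. t ^ m * G (?p x t)) integrable_on cbox 0 1" by (rule integrable_continuous)
      qed
      then show ?thesis by (simp only: at_within_open[OF x0 open_ball])
    qed
    show ?case
    proof (rule C_k_on_derivative[OF der open_ball])
      fix v
      have "blinfun_apply (integral (cbox 0 1) (F x)) v = integral (cbox 0 1) (\<lambda>t. t ^ Suc m * ?D v (?p x t))"
        if x: "x \<in> ball c r" for x
      proof -
        have "continuous_on (cbox 0 1) (F x)"
        proof -
          have "continuous_on (cbox 0 1) (\<lambda>t. (\<lambda>(x, t). F x t) (x, t))"
            by (rule continuous_on_compose2[OF contF continuous_on_Pair[OF continuous_on_const continuous_on_id]])
              (use x in auto)
          then show ?thesis by simp
        qed
        then have "blinfun_apply (integral (cbox 0 1) (F x)) v = integral (cbox 0 1) (\<lambda>t. blinfun_apply (F x t) v)"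
          by (intro blinfun_apply_integral integrable_continuous)
        also have "\<dots> = integral (cbox 0 1) (\<lambda>t. t ^ Suc m * ?D v (?p x t))"
          by (intro integral_cong apply_F x)
        finally show ?thesis .
      qed
      then show "C_k_on k (ball c r) (\<lambda>x. blinfun_apply (integral (cbox 0 1) (F x)) v)"
        using C_k_on_cong[OF open_ball _ Suc.IH[OF smD, of "Suc m" v]] by simp
    qed
  qed
qed

text \<open>
The fundamental theorem of calculus along the segment from \<open>c\<close> to \<open>x\<close>.
\<close>
lemma hadamard:
  fixes G :: "'e::euclidean_space \<Rightarrow> real"
  assumes G: "smooth_on (ball c r) G"
  obtains h where "\<And>b. smooth_on (ball c r) (h b)"
    "\<And>x. x \<in> ball c r \<Longrightarrow> G x - G c = (\<Sum>b\<in>Basis. ((x - c) \<bullet> b) * h b x)"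
    "\<And>b. h b c = frechet_derivative G (at c) b"
proof
  define h where "h b x = integral (cbox 0 1) (\<lambda>t. t ^ 0 * frechet_derivative G (at (c + t *\<^sub>R (x - c))) b)" for b x
  show "smooth_on (ball c r) (h b)" for b
    unfolding h_def by (rule smooth_on_segment_integral[OF smooth_on_frechet_derivative[OF G]])
  show "h b c = frechet_derivative G (at c) b" for b
    by (simp add: h_def)
  fix x assume x: "x \<in> ball c r"
  let ?p = "\<lambda>t. c + t *\<^sub>R (x - c)"
  have "((\<lambda>t. G (?p t)) has_vector_derivative frechet_derivative G (at (?p t)) (x - c)) (at t within {0..1})"
    if t: "t \<in> {0..1}" for t
  proof -
    have d: "(G has_derivative frechet_derivative G (at (?p t))) (at (?p t))"
      using smooth_on_has_derivative[OF G] ball_segment[OF x] t by auto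
    have p: "((\<lambda>t. ?p t) has_derivative (\<lambda>s. s *\<^sub>R (x - c))) (at t)"
      by (auto intro!: derivative_eq_intros)
    have "((\<lambda>t. G (?p t)) has_derivative (\<lambda>s. frechet_derivative G (at (?p t)) (s *\<^sub>R (x - c)))) (at t)"
      by (rule has_derivative_compose[OF p d])
    then show ?thesis
      using has_derivative_linear[OF d]
      by (simp add: has_vector_derivative_def linear_scale has_derivative_at_withinI)
  qed
  then have "((\<lambda>t. frechet_derivative G (at (?p t)) (x - c)) has_integral (G (?p 1) - G (?p 0))) {0..1}"
    by (intro fundamental_theorem_of_calculus) auto
  then have 1: "integral {0..1} (\<lambda>t. frechet_derivative G (at (?p t)) (x - c)) = G x - G c"
    by (simp add: integral_unique)
  have "integral {0..1} (\<lambda>t. frechet_derivative G (at (?p t)) (x - c))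
      = integral {0..1} (\<lambda>t. \<Sum>b\<in>Basis. ((x - c) \<bullet> b) * frechet_derivative G (at (?p t)) b)"
  proof (rule integral_cong)
    fix t :: real assume t: "t \<in> {0..1}"
    have lin: "linear (frechet_derivative G (at (?p t)))"
      by (intro has_derivative_linear[OF smooth_on_has_derivative[OF G]] ball_segment x) (use t in auto)
    have "frechet_derivative G (at (?p t)) (x - c)
        = frechet_derivative G (at (?p t)) (\<Sum>b\<in>Basis. ((x - c) \<bullet> b) *\<^sub>R b)"
      by (simp only: euclidean_representation)
    then show "frechet_derivative G (at (?p t)) (x - c)
        = (\<Sum>b\<in>Basis. ((x - c) \<bullet> b) * frechet_derivative G (at (?p t)) b)"
      using lin by (simp add: linear_sum linear_scale)
  qed
  also have "\<dots> = (\<Sum>b\<in>Basis. ((x - c) \<bullet> b) * h b x)"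
  proof -
    have int: "(\<lambda>t. frechet_derivative G (at (?p t)) b) integrable_on {0..1}" for b
    proof -
      have "continuous_on {0..1} (\<lambda>t. frechet_derivative G (at (?p t)) b)"
      proof (rule continuous_on_compose2[OF smooth_on_continuous_on[OF smooth_on_frechet_derivative[OF G]]])
        show "continuous_on {0..1} ?p" by (intro continuous_intros)
        show "?p ` {0..1} \<subseteq> ball c r" using ball_segment[OF x] by (simp add: image_subset_iff del: mem_ball)
      qed
      then show ?thesis by (rule integrable_continuous_real)
    qed
    then show ?thesis
      by (subst integral_sum) (auto simp: h_def intro!: integrable_on_cmult_left[where 'b = real, simplified])
  qed
  finally show "G x - G c = (\<Sum>b\<in>Basis. ((x - c) \<bullet> b) * h b x)" using 1 by simp
qed

section \<open>Bump functions and derivations at a point\<close>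

text \<open>
The family \<open>p(1/t) exp(-1/t)\<close>, extended by zero, is closed under differentiation; this is why smoothness is proved for
all polynomials at once.
\<close>
definition flat :: "real poly \<Rightarrow> real \<Rightarrow> real"
  where "flat p t = (if t > 0 then poly p (1 / t) * exp (- (1 / t)) else 0)"

lemma poly_exp_tendsto_0: "((\<lambda>x::real. poly p x * exp (- x)) \<longlongrightarrow> 0) at_top"
proof (induction p rule: pCons_induct)
  case (pCons a p)
  have "((\<lambda>x::real. x ^ k * exp (- x)) \<longlongrightarrow> 0) at_top" for k
    using tendsto_power_div_exp_0[of k] by (simp add: exp_minus field_simps)
  then have m: "((\<lambda>x::real. c * (x ^ k * exp (- x))) \<longlongrightarrow> 0) at_top" for k c
    using tendsto_mult_left by fastforce
  have "poly q x * exp (- x) = (\<Sum>i\<le>degree q. coeff q i * (x ^ i * exp (- x)))" for q and x :: real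
    by (simp add: poly_altdef sum_distrib_right mult.assoc)
  moreover have "((\<lambda>x::real. \<Sum>i\<le>degree (pCons a p). coeff (pCons a p) i * (x ^ i * exp (- x))) \<longlongrightarrow> 0) at_top"
    using tendsto_sum[of "{..degree (pCons a p)}", OF m] by simp
  ultimately show ?case by presburger
qed simp

lemma flat_tendsto_0: "(flat p \<longlongrightarrow> 0) (at 0)"
proof -
  have "((\<lambda>t. poly p (1 / t) * exp (- (1 / t))) \<longlongrightarrow> 0) (at_right 0)"
    using filterlim_compose[OF poly_exp_tendsto_0 filterlim_inverse_at_top_right]
    by (simp add: inverse_eq_divide)
  then have "(flat p \<longlongrightarrow> 0) (at_right 0)"
    by (rule Lim_transform_eventually) (auto simp: flat_def eventually_at_filter)
  moreover have "(flat p \<longlongrightarrow> 0) (at_left 0)"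
    by (rule Lim_transform_eventually[OF tendsto_const]) (auto simp: flat_def eventually_at_filter)
  ultimately show ?thesis by (simp add: filterlim_split_at)
qed

lemma flat_has_derivative:
  "(flat p has_real_derivative flat ([:0, 0, 1:] * (p - pderiv p)) t) (at t)"
proof -
  consider "t > 0" | "t < 0" | "t = 0" by linarith
  then show ?thesis
  proof cases
    case 1
    have "((\<lambda>t. poly p (1 / t) * exp (- (1 / t))) has_real_derivative
        flat ([:0, 0, 1:] * (p - pderiv p)) t) (at t)"
      using 1 by (auto intro!: derivative_eq_intros DERIV_chain2[OF poly_DERIV] simp: flat_def field_simps power2_eq_square)
    then show ?thesis
      by (rule has_field_derivative_transform_within_open[of _ _ _ "{0<..}"]) (use 1 in \<open>auto simp: flat_def\<close>)
  next
    case 2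
    have "((\<lambda>t. 0) has_real_derivative flat ([:0, 0, 1:] * (p - pderiv p)) t) (at t)"
      using 2 by (simp add: flat_def)
    then show ?thesis
      by (rule has_field_derivative_transform_within_open[of _ _ _ "{..<0}"]) (use 2 in \<open>auto simp: flat_def\<close>)
  next
    case 3
    have "flat (pCons 0 p) = (\<lambda>h. (flat p (0 + h) - flat p 0) / h)"
      by (simp add: flat_def field_simps fun_eq_iff)
    then have "((\<lambda>h. (flat p (0 + h) - flat p 0) / h) \<longlongrightarrow> 0) (at 0)"
      using flat_tendsto_0[of "pCons 0 p"] by (simp only:)
    then show ?thesis using 3 by (simp add: DERIV_def flat_def)
  qed
qed

lemma smooth_on_flat: "smooth_on UNIV (flat p)"
  unfolding smooth_on_def
proof
  fix k show "C_k_on k UNIV (flat p)"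
  proof (induction k arbitrary: p)
    case 0
    have "isCont (flat p) t" for t using DERIV_isCont[OF flat_has_derivative] .
    then show ?case by (simp add: continuous_at_imp_continuous_on)
  next
    case (Suc k)
    show ?case
    proof (rule C_k_on_derivative)
      show "(flat p has_derivative (\<lambda>h. flat ([:0, 0, 1:] * (p - pderiv p)) t * h)) (at t)" for t
        using flat_has_derivative unfolding has_field_derivative_def .
      show "C_k_on k UNIV (\<lambda>t. flat ([:0, 0, 1:] * (p - pderiv p)) t * v)" for v
        by (intro C_k_on_bilinear[OF bounded_bilinear_mult] Suc C_k_on_const) simp
    qed simp
  qed
qed

lemma bump_function_exists:
  fixes c :: "'e::euclidean_space"
  assumes "r > 0"
  obtains \<beta> :: "'e \<Rightarrow> real" where "smooth_on UNIV \<beta>" "\<beta> c = 1" "\<And>x. x \<notin> ball c r \<Longrightarrow> \<beta> x = 0"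
proof
  \<comment> \<open>the constant normalises the value at c to 1; the inner product is the squared distance to c\<close>
  let ?\<beta> = "\<lambda>x. flat [:exp (1 / r\<^sup>2):] (r\<^sup>2 + (- 1) * ((x + - c) \<bullet> (x + - c)))"
  show "smooth_on UNIV ?\<beta>"
    by (rule smooth_on_compose[OF _ _ smooth_on_flat])
      (intro open_UNIV smooth_on_add smooth_on_mult smooth_on_inner smooth_on_const smooth_on_ident | simp)+
  show "?\<beta> c = 1" using assms by (simp add: flat_def exp_minus)
  show "?\<beta> x = 0" if "x \<notin> ball c r" for x
  proof -
    have "r\<^sup>2 \<le> (norm (x - c))\<^sup>2"
      using that assms by (intro power_mono) (auto simp: dist_norm norm_minus_commute)
    then show ?thesis by (simp add: flat_def power2_norm_eq_inner)
  qed
qed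

lemma sum_fun_apply: "(\<Sum>i\<in>I. f i) x = (\<Sum>i\<in>I. f i x :: 'b::comm_monoid_add)"
  by (induction I rule: infinite_finite_induct) auto

locale smooth_manifold =
  fixes A :: "('m::t2_space, 'e::euclidean_space) chart set"
  assumes atlas: "smooth_atlas A"
begin

lemma chart_at: obtains U \<phi> where "(U, \<phi>) \<in> A" "p \<in> U"
proof -
  have "p \<in> (\<Union>(U, \<phi>)\<in>A. U)" using atlas by (simp add: smooth_atlas_def)
  then show thesis using that by auto
qed

lemma chart_open: "(U, \<phi>) \<in> A \<Longrightarrow> open U" "(U, \<phi>) \<in> A \<Longrightarrow> open (\<phi> ` U)"
  and chart_homeomorphism: "(U, \<phi>) \<in> A \<Longrightarrow> homeomorphism U (\<phi> ` U) \<phi> (inv_into U \<phi>)"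
  using atlas unfolding smooth_atlas_def by blast+

lemma transition_smooth:
  "(U, \<phi>) \<in> A \<Longrightarrow> (V, \<psi>) \<in> A \<Longrightarrow> smooth_on (\<phi> ` (U \<inter> V)) (\<psi> \<circ> inv_into U \<phi>)"
  using atlas unfolding smooth_atlas_def by blast

lemma chart_inj: "(U, \<phi>) \<in> A \<Longrightarrow> inj_on \<phi> U"
  by (rule inj_on_inverseI) (rule homeomorphism_apply1[OF chart_homeomorphism])

lemma chart_inverse [simp]: "(U, \<phi>) \<in> A \<Longrightarrow> p \<in> U \<Longrightarrow> inv_into U \<phi> (\<phi> p) = p"
  by (simp add: chart_inj inv_into_f_f)

lemma chart_image_open:
  assumes "(U, \<phi>) \<in> A" "open T"
  shows "open (\<phi> ` (U \<inter> T))"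
proof -
  have "openin (top_of_set (\<phi> ` U)) (\<phi> ` (U \<inter> T))"
    by (rule homeomorphism_imp_open_map[OF chart_homeomorphism[OF assms(1)]])
      (simp add: assms(2) openin_open_Int)
  then show ?thesis using chart_open(2)[OF assms(1)] openin_open_trans by blast
qed

lemma smooth_functionsD:
  "f \<in> smooth_functions A \<Longrightarrow> (U, \<phi>) \<in> A \<Longrightarrow> smooth_on (\<phi> ` U) (\<lambda>x. f (inv_into U \<phi> x))"
  unfolding smooth_functions_def o_def by blast

lemma smooth_functionsI_local:
  assumes "\<And>p. \<exists>U \<phi> W. (U, \<phi>) \<in> A \<and> open W \<and> p \<in> W \<and> W \<subseteq> U \<and> smooth_on (\<phi> ` W) (\<lambda>x. f (inv_into U \<phi> x))"
  shows "f \<in> smooth_functions A"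
proof -
  have "smooth_on (\<psi> ` V) (f \<circ> inv_into V \<psi>)" if V: "(V, \<psi>) \<in> A" for V \<psi>
  proof (rule smooth_on_local)
    fix x assume "x \<in> \<psi> ` V"
    then obtain p where p: "p \<in> V" "x = \<psi> p" by blast
    obtain U \<phi> W where U: "(U, \<phi>) \<in> A" "open W" "p \<in> W" "W \<subseteq> U"
      and sm: "smooth_on (\<phi> ` W) (\<lambda>x. f (inv_into U \<phi> x))" using assms by blast
    let ?T = "\<psi> ` (V \<inter> W)"
    have T: "open ?T" using chart_image_open[OF V U(2)] .
    have "smooth_on ?T (\<lambda>x. \<phi> (inv_into V \<psi> x))"
      by (rule smooth_on_subset[OF transition_smooth[OF V U(1), unfolded o_def]]) (use U(4) in blast)
    moreover have "(\<lambda>x. \<phi> (inv_into V \<psi> x)) ` ?T \<subseteq> \<phi> ` W" using V by auto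
    ultimately have "smooth_on ?T (\<lambda>x. f (inv_into U \<phi> (\<phi> (inv_into V \<psi> x))))"
      using smooth_on_compose[OF T _ sm] by blast
    then have "smooth_on ?T (f \<circ> inv_into V \<psi>)"
      by (rule smooth_on_cong[OF T, rotated]) (use U V in auto)
    then show "\<exists>T. open T \<and> x \<in> T \<and> smooth_on T (f \<circ> inv_into V \<psi>)" using T p U(3) by blast
  qed
  then show ?thesis by (auto simp: smooth_functions_def)
qed

lemma smooth_functions_const: "(\<lambda>_. c) \<in> smooth_functions A"
  by (auto simp: smooth_functions_def o_def smooth_on_const)

lemma smooth_functions_0: "0 \<in> smooth_functions A"
  using smooth_functions_const[of 0] by (simp add: zero_fun_def)

lemma smooth_functions_1: "1 \<in> smooth_functions A"
  using smooth_functions_const[of 1] by (simp add: one_fun_def)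

lemma smooth_functions_add: "f \<in> smooth_functions A \<Longrightarrow> h \<in> smooth_functions A \<Longrightarrow> f + h \<in> smooth_functions A"
  unfolding smooth_functions_def using smooth_on_add[OF chart_open(2)] by (fastforce simp: o_def)

lemma smooth_functions_mult: "f \<in> smooth_functions A \<Longrightarrow> h \<in> smooth_functions A \<Longrightarrow> f * h \<in> smooth_functions A"
  unfolding smooth_functions_def using smooth_on_mult[OF chart_open(2)] by (fastforce simp: o_def)

lemma smooth_functions_scale: "f \<in> smooth_functions A \<Longrightarrow> c *\<^sub>R f \<in> smooth_functions A"
proof -
  have "c *\<^sub>R f = (\<lambda>_. c) * f" by (simp add: scaleR_fun_def fun_eq_iff)
  then show "f \<in> smooth_functions A \<Longrightarrow> c *\<^sub>R f \<in> smooth_functions A"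
    using smooth_functions_mult[OF smooth_functions_const] by simp
qed

lemma smooth_functions_uminus: "f \<in> smooth_functions A \<Longrightarrow> - f \<in> smooth_functions A"
  using smooth_functions_scale[of f "-1"] by simp

lemma smooth_functions_diff: "f \<in> smooth_functions A \<Longrightarrow> h \<in> smooth_functions A \<Longrightarrow> f - h \<in> smooth_functions A"
  using smooth_functions_add[OF _ smooth_functions_uminus, of f h] by simp

lemma smooth_functions_sum: "(\<And>i. i \<in> I \<Longrightarrow> f i \<in> smooth_functions A) \<Longrightarrow> (\<Sum>i\<in>I. f i) \<in> smooth_functions A"
  by (induction I rule: infinite_finite_induct) (auto simp: smooth_functions_0 smooth_functions_add)

text \<open>
Away from the chart the extension vanishes near every point, since the compact set \<open>K\<close> corresponds to a closed
subset of the Hausdorff manifold.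
\<close>
lemma smooth_functions_chart_extension:
  assumes U: "(U, \<phi>) \<in> A" and k: "smooth_on (\<phi> ` U) k" and K: "compact K" "K \<subseteq> \<phi> ` U"
    and zero: "\<And>x. x \<notin> K \<Longrightarrow> k x = 0"
  shows "(\<lambda>m. if m \<in> U then k (\<phi> m) else 0) \<in> smooth_functions A"
proof (rule smooth_functionsI_local)
  fix p
  let ?f = "\<lambda>m. if m \<in> U then k (\<phi> m) else 0"
  show "\<exists>V \<psi> W. (V, \<psi>) \<in> A \<and> open W \<and> p \<in> W \<and> W \<subseteq> V \<and> smooth_on (\<psi> ` W) (\<lambda>x. ?f (inv_into V \<psi> x))"
  proof (cases "p \<in> U")
    case True
    have "smooth_on (\<phi> ` U) (\<lambda>x. ?f (inv_into U \<phi> x))"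
      by (rule smooth_on_cong[OF chart_open(2)[OF U] _ k]) (use U in auto)
    then show ?thesis using U chart_open(1)[OF U] True by blast
  next
    case False
    obtain V \<psi> where V: "(V, \<psi>) \<in> A" "p \<in> V" by (rule chart_at)
    define C where "C = inv_into U \<phi> ` K"
    have "continuous_on K (inv_into U \<phi>)"
      using chart_homeomorphism[OF U] K(2) by (meson continuous_on_subset homeomorphism_cont2)
    then have "closed C" unfolding C_def using K(1) by (intro compact_imp_closed compact_continuous_image)
    have C_U: "C \<subseteq> U" using K(2) by (auto simp: C_def inv_into_into)
    let ?W = "V - C"
    have W: "open ?W" using chart_open(1)[OF V(1)] \<open>closed C\<close> by blast
    have zeroW: "k (\<phi> m) = 0" if "m \<notin> C" "m \<in> U" for m
    proof -
      have "\<phi> m \<notin> K" using that U unfolding C_def by (metis chart_inverse imageI)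
      then show ?thesis by (rule zero)
    qed
    have "\<psi> ` ?W = \<psi> ` (V \<inter> ?W)" by blast
    then have "open (\<psi> ` ?W)" using chart_image_open[OF V(1) W] by simp
    then have "smooth_on (\<psi> ` ?W) (\<lambda>x. ?f (inv_into V \<psi> x))"
      by (rule smooth_on_cong[OF _ _ smooth_on_const[of _ 0]]) (use zeroW V in auto)
    then show ?thesis using V W False C_U by blast
  qed
qed

text \<open>
A chart around \<open>p\<close> with a ball inside its image and a bump function at \<open>p\<close>. The bump is supported in the ball of
half the radius, so that products with functions on the whole ball extend smoothly by zero.
\<close>
definition local_coordinates :: "'m \<Rightarrow> 'm set \<Rightarrow> ('m \<Rightarrow> 'e) \<Rightarrow> real \<Rightarrow> ('e \<Rightarrow> real) \<Rightarrow> bool" where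
  "local_coordinates p U \<phi> r \<beta> \<longleftrightarrow> (U, \<phi>) \<in> A \<and> p \<in> U \<and> r > 0 \<and> cball (\<phi> p) r \<subseteq> \<phi> ` U \<and>
     smooth_on UNIV \<beta> \<and> \<beta> (\<phi> p) = 1 \<and> (\<forall>x. x \<notin> ball (\<phi> p) (r / 2) \<longrightarrow> \<beta> x = 0)"

lemma local_coordinates_exist:
  assumes "(U, \<phi>) \<in> A" "p \<in> U"
  obtains r \<beta> where "local_coordinates p U \<phi> r \<beta>"
proof -
  obtain r where r: "r > 0" "cball (\<phi> p) r \<subseteq> \<phi> ` U"
    using chart_open(2)[OF assms(1)] assms(2) by (metis imageI open_contains_cball)
  obtain \<beta> :: "'e \<Rightarrow> real" where "smooth_on UNIV \<beta>" "\<beta> (\<phi> p) = 1" "\<And>x. x \<notin> ball (\<phi> p) (r / 2) \<Longrightarrow> \<beta> x = 0"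
    by (rule bump_function_exists[OF half_gt_zero[OF r(1)], of "\<phi> p"]) blast
  then show thesis using that assms r by (auto simp: local_coordinates_def)
qed

definition cutoff :: "'m \<Rightarrow> 'm set \<Rightarrow> ('m \<Rightarrow> 'e) \<Rightarrow> real \<Rightarrow> ('e \<Rightarrow> real) \<Rightarrow> ('e \<Rightarrow> real) \<Rightarrow> 'm \<Rightarrow> real" where
  "cutoff p U \<phi> r \<beta> h = (\<lambda>m. if m \<in> U then (if \<phi> m \<in> ball (\<phi> p) r then \<beta> (\<phi> m) * h (\<phi> m) else 0) else 0)"

lemma cutoff_smooth:
  assumes c: "local_coordinates p U \<phi> r \<beta>" and h: "smooth_on (ball (\<phi> p) r) h"
  shows "cutoff p U \<phi> r \<beta> h \<in> smooth_functions A"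
proof -
  let ?k = "\<lambda>x. if x \<in> ball (\<phi> p) r then \<beta> x * h x else 0"
  have lc: "(U, \<phi>) \<in> A" "r > 0" "cball (\<phi> p) r \<subseteq> \<phi> ` U" "smooth_on UNIV \<beta>"
    "\<And>x. x \<notin> ball (\<phi> p) (r / 2) \<Longrightarrow> \<beta> x = 0"
    using c by (auto simp: local_coordinates_def)
  have "smooth_on (\<phi> ` U) ?k"
  proof (rule smooth_on_local)
    fix x
    show "\<exists>T. open T \<and> x \<in> T \<and> smooth_on T ?k"
    proof (cases "x \<in> ball (\<phi> p) r")
      case True
      have "smooth_on (ball (\<phi> p) r) (\<lambda>x. \<beta> x * h x)"
        by (intro smooth_on_mult open_ball h smooth_on_subset[OF lc(4)]) simp
      then have "smooth_on (ball (\<phi> p) r) ?k" by (rule smooth_on_cong[OF open_ball, rotated]) simp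
      then show ?thesis using True by blast
    next
      case False
      let ?T = "- cball (\<phi> p) (r / 2)"
      have T: "open ?T" by (simp add: open_Compl)
      have "smooth_on ?T ?k"
        by (rule smooth_on_cong[OF T _ smooth_on_const[of _ 0]]) (use lc(5) in auto)
      moreover have "x \<in> ?T" using False lc(2) by auto
      ultimately show ?thesis using T by blast
    qed
  qed
  then have "(\<lambda>m. if m \<in> U then ?k (\<phi> m) else 0) \<in> smooth_functions A"
  proof (rule smooth_functions_chart_extension[OF lc(1)])
    have "cball (\<phi> p) (r / 2) \<subseteq> cball (\<phi> p) r" using lc(2) by (intro subset_cball) simp
    then show "cball (\<phi> p) (r / 2) \<subseteq> \<phi> ` U" using lc(3) by (rule order_trans)
    show "?k x = 0" if "x \<notin> cball (\<phi> p) (r / 2)" for x using lc(5)[of x] that by auto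
  qed simp
  then show ?thesis by (simp add: cutoff_def)
qed

text \<open>
Every derivation at a point is a directional derivative. Hadamard's formula \<open>f - f p = \<Sum> (x\<^sub>b - p\<^sub>b) h\<^sub>b\<close> holds only on a
coordinate ball; multiplied by the square of a bump function it becomes an identity between globally smooth
functions, to which the derivation and the Leibniz rule apply.
\<close>
lemma point_derivation:
  assumes U: "(U, \<phi>) \<in> A" "p \<in> U"
    and add: "\<And>f h. f \<in> smooth_functions A \<Longrightarrow> h \<in> smooth_functions A \<Longrightarrow> v (f + h) = v f + v h"
    and scale: "\<And>c f. f \<in> smooth_functions A \<Longrightarrow> v (c *\<^sub>R f) = c * v f"
    and leibniz: "\<And>f h. f \<in> smooth_functions A \<Longrightarrow> h \<in> smooth_functions A \<Longrightarrow> v (f * h) = f p * v h + h p * v f"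
  obtains w where "\<And>f. f \<in> smooth_functions A \<Longrightarrow> v f = frechet_derivative (\<lambda>x. f (inv_into U \<phi> x)) (at (\<phi> p)) w"
proof -
  obtain r \<beta> where c: "local_coordinates p U \<phi> r \<beta>" using local_coordinates_exist[OF U] .
  have r: "r > 0" "\<beta> (\<phi> p) = 1" "cball (\<phi> p) r \<subseteq> \<phi> ` U" "\<And>x. x \<notin> ball (\<phi> p) (r / 2) \<Longrightarrow> \<beta> x = 0"
    using c by (auto simp: local_coordinates_def)
  let ?ext = "cutoff p U \<phi> r \<beta>"
  let ?x = "\<lambda>b x. (x - \<phi> p) \<bullet> b"
  have smx: "?ext (?x b) \<in> smooth_functions A" for b
  proof (rule cutoff_smooth[OF c])
    have "smooth_on (ball (\<phi> p) r) (\<lambda>x. (x + - \<phi> p) \<bullet> b)"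
      by (intro smooth_on_inner smooth_on_add smooth_on_const smooth_on_ident open_ball)
    then show "smooth_on (ball (\<phi> p) r) (?x b)" by simp
  qed
  define w where "w = (\<Sum>b\<in>Basis. v (?ext (?x b)) *\<^sub>R b)"
  have v1: "v 1 = 0" using leibniz[OF smooth_functions_1 smooth_functions_1] by simp
  have vconst: "v (\<lambda>_. a) = 0" for a
  proof -
    have "(\<lambda>_. a) = a *\<^sub>R (1 :: 'm \<Rightarrow> real)" by (simp add: scaleR_fun_def)
    then show ?thesis using scale[OF smooth_functions_1] v1 by simp
  qed
  have vsum: "v (\<Sum>b\<in>I. F b) = (\<Sum>b\<in>I. v (F b))" if "\<And>b. F b \<in> smooth_functions A" for I and F :: "'e \<Rightarrow> _"
  proof (induction I rule: infinite_finite_induct)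
    case (insert b I)
    have "v (\<Sum>b\<in>insert b I. F b) = v (F b + (\<Sum>b\<in>I. F b))"
      by (simp only: sum.insert[OF insert(1,2)])
    also have "\<dots> = v (F b) + (\<Sum>b\<in>I. v (F b))"
      unfolding add[OF that smooth_functions_sum[OF that]] insert(3) ..
    finally show ?case by (simp only: sum.insert[OF insert(1,2)])
  qed (use vconst[of 0] in \<open>simp_all add: zero_fun_def\<close>)
  have "v f = frechet_derivative (\<lambda>x. f (inv_into U \<phi> x)) (at (\<phi> p)) w" if f: "f \<in> smooth_functions A" for f
  proof -
    let ?G = "\<lambda>x. f (inv_into U \<phi> x)"
    have G: "smooth_on (ball (\<phi> p) r) ?G"
      by (rule smooth_on_subset[OF smooth_functionsD[OF f U(1)]]) (use r(3) ball_subset_cball in blast)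
    obtain h where h: "\<And>b. smooth_on (ball (\<phi> p) r) (h b)"
      "\<And>x. x \<in> ball (\<phi> p) r \<Longrightarrow> ?G x - ?G (\<phi> p) = (\<Sum>b\<in>Basis. ((x - \<phi> p) \<bullet> b) * h b x)"
      "\<And>b. h b (\<phi> p) = frechet_derivative ?G (at (\<phi> p)) b"
      by (rule hadamard[OF G]) blast
    let ?g = "f - (\<lambda>_. f p)"
    let ?bump = "?ext (\<lambda>_. 1)"
    have smg: "?g \<in> smooth_functions A" using f smooth_functions_const smooth_functions_diff by blast
    have smb: "?bump \<in> smooth_functions A" by (rule cutoff_smooth[OF c smooth_on_const])
    have smh: "?ext (h b) \<in> smooth_functions A" for b by (rule cutoff_smooth[OF c h(1)])
    have eq: "?g * (?bump * ?bump) = (\<Sum>b\<in>Basis. ?ext (?x b) * ?ext (h b))"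
    proof
      fix m
      show "(?g * (?bump * ?bump)) m = (\<Sum>b\<in>Basis. ?ext (?x b) * ?ext (h b)) m"
      proof (cases "m \<in> U \<and> \<phi> m \<in> ball (\<phi> p) r")
        case True
        then have "f m - f p = (\<Sum>b\<in>Basis. ((\<phi> m - \<phi> p) \<bullet> b) * h b (\<phi> m))"
          using h(2)[of "\<phi> m"] U by simp
        then show ?thesis using True
          by (simp add: cutoff_def sum_fun_apply sum_distrib_left mult_ac del: mem_ball)
      next
        case False
        then show ?thesis by (simp add: cutoff_def sum_fun_apply del: mem_ball)
      qed
    qed
    \<comment> \<open>?g vanishes at p and the bump function is 1 there\<close>
    have "v (?g * (?bump * ?bump)) = v ?g"
      unfolding leibniz[OF smg smooth_functions_mult[OF smb smb]] using U r by (simp add: cutoff_def)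
    also have "v ?g = v f"
    proof -
      have "v f = v (?g + (\<lambda>_. f p))" by simp
      then show ?thesis unfolding add[OF smg smooth_functions_const] vconst by simp
    qed
    finally have "v f = (\<Sum>b\<in>Basis. v (?ext (?x b) * ?ext (h b)))"
      unfolding eq using vsum[of "\<lambda>b. ?ext (?x b) * ?ext (h b)"] smx smh smooth_functions_mult by simp
    also have "\<dots> = (\<Sum>b\<in>Basis. v (?ext (?x b)) * frechet_derivative ?G (at (\<phi> p)) b)"
      unfolding leibniz[OF smx smh] using U r by (simp add: cutoff_def h(3) mult.commute)
    also have "\<dots> = frechet_derivative ?G (at (\<phi> p)) w"
    proof -
      have "linear (frechet_derivative ?G (at (\<phi> p)))"
        using has_derivative_linear[OF smooth_on_has_derivative[OF G]] r(1) by simp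
      then show ?thesis by (simp add: w_def linear_sum linear_scale)
    qed
    finally show ?thesis .
  qed
  then show thesis using that by blast
qed

text \<open>
The coordinate function in direction \<open>w\<close>, cut off to a global function, has derivative \<open>\<parallel>w\<parallel>\<^sup>2\<close> along \<open>w\<close>.
\<close>
lemma tangent_vector_separated:
  assumes U: "(U, \<phi>) \<in> A" "p \<in> U"
    and zero: "\<And>f. f \<in> smooth_functions A \<Longrightarrow> frechet_derivative (\<lambda>x. f (inv_into U \<phi> x)) (at (\<phi> p)) w = 0"
  shows "w = 0"
proof -
  obtain r \<beta> where c: "local_coordinates p U \<phi> r \<beta>" using local_coordinates_exist[OF U] .
  have r: "r > 0" "\<beta> (\<phi> p) = 1" "cball (\<phi> p) r \<subseteq> \<phi> ` U" "smooth_on UNIV \<beta>"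
    using c by (auto simp: local_coordinates_def)
  let ?f = "cutoff p U \<phi> r \<beta> (\<lambda>x. (x - \<phi> p) \<bullet> w)"
  have sm: "?f \<in> smooth_functions A"
  proof (rule cutoff_smooth[OF c])
    have "smooth_on (ball (\<phi> p) r) (\<lambda>x. (x + - \<phi> p) \<bullet> w)"
      by (intro smooth_on_inner smooth_on_add smooth_on_const smooth_on_ident open_ball)
    then show "smooth_on (ball (\<phi> p) r) (\<lambda>x. (x - \<phi> p) \<bullet> w)" by simp
  qed
  have "(\<beta> has_derivative frechet_derivative \<beta> (at (\<phi> p))) (at (\<phi> p))"
    using smooth_on_has_derivative[OF r(4)] by simp
  moreover have "((\<lambda>x. (x - \<phi> p) \<bullet> w) has_derivative (\<lambda>u. u \<bullet> w)) (at (\<phi> p))"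
    by (auto intro!: derivative_eq_intros)
  ultimately have "((\<lambda>x. \<beta> x * ((x - \<phi> p) \<bullet> w)) has_derivative (\<lambda>u. u \<bullet> w)) (at (\<phi> p))"
    using has_derivative_mult[of \<beta>] r(2) by fastforce
  then have "((\<lambda>x. ?f (inv_into U \<phi> x)) has_derivative (\<lambda>u. u \<bullet> w)) (at (\<phi> p))"
  proof (rule has_derivative_transform_within_open[OF _ open_ball[of "\<phi> p" r]])
    fix x assume x: "x \<in> ball (\<phi> p) r"
    then have "x \<in> \<phi> ` U" using r(3) ball_subset_cball by blast
    then show "\<beta> x * ((x - \<phi> p) \<bullet> w) = ?f (inv_into U \<phi> x)"
      using U(1) x by (auto simp: cutoff_def)
  qed (use r in simp)
  then have "frechet_derivative (\<lambda>x. ?f (inv_into U \<phi> x)) (at (\<phi> p)) = (\<lambda>u. u \<bullet> w)"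
    by (rule frechet_derivative_at[symmetric])
  then show ?thesis using zero[OF sm] by (metis inner_eq_zero_iff)
qed

end

section \<open>Vector fields and left invariant fields on Lie groups\<close>

context smooth_manifold
begin

abbreviation "SF \<equiv> smooth_functions A"
abbreviation "VF \<equiv> vector_fields A"

lemma vector_field_smooth: "X \<in> VF \<Longrightarrow> f \<in> SF \<Longrightarrow> X f \<in> SF"
  and vector_field_add: "X \<in> VF \<Longrightarrow> f \<in> SF \<Longrightarrow> h \<in> SF \<Longrightarrow> X (f + h) = X f + X h"
  and vector_field_scale: "X \<in> VF \<Longrightarrow> f \<in> SF \<Longrightarrow> X (c *\<^sub>R f) = c *\<^sub>R X f"
  and vector_field_mult: "X \<in> VF \<Longrightarrow> f \<in> SF \<Longrightarrow> h \<in> SF \<Longrightarrow> X (f * h) = f * X h + h * X f"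
  and vector_field_nonsmooth: "X \<in> VF \<Longrightarrow> f \<notin> SF \<Longrightarrow> X f = 0"
  by (auto simp: vector_fields_def)

lemma vector_field_0: "X \<in> VF \<Longrightarrow> X 0 = 0"
  using vector_field_scale[OF _ smooth_functions_0, of X 0] by simp

lemma vector_field_const: "X \<in> VF \<Longrightarrow> X (\<lambda>_. c) = 0"
proof -
  assume X: "X \<in> VF"
  have "X 1 = 0" using vector_field_mult[OF X smooth_functions_1 smooth_functions_1] by simp
  moreover have "(\<lambda>_. c) = c *\<^sub>R (1 :: 'm \<Rightarrow> real)" by (simp add: scaleR_fun_def)
  ultimately show ?thesis using vector_field_scale[OF X smooth_functions_1] by simp
qed

lemma vector_field_uminus_fun: "X \<in> VF \<Longrightarrow> f \<in> SF \<Longrightarrow> X (- f) = - X f"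
  using vector_field_scale[of X f "-1"] by simp

lemma vector_field_diff_fun: "X \<in> VF \<Longrightarrow> f \<in> SF \<Longrightarrow> h \<in> SF \<Longrightarrow> X (f - h) = X f - X h"
  using vector_field_add[of X f "- h"] vector_field_uminus_fun[of X h] smooth_functions_uminus by simp

lemma vector_fieldI:
  assumes "\<And>f. f \<in> SF \<Longrightarrow> X f \<in> SF"
    and "\<And>f h. f \<in> SF \<Longrightarrow> h \<in> SF \<Longrightarrow> X (f + h) = X f + X h"
    and "\<And>c f. f \<in> SF \<Longrightarrow> X (c *\<^sub>R f) = c *\<^sub>R X f"
    and "\<And>f h. f \<in> SF \<Longrightarrow> h \<in> SF \<Longrightarrow> X (f * h) = f * X h + h * X f"
    and "\<And>f. f \<notin> SF \<Longrightarrow> X f = 0"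
  shows "X \<in> VF"
  using assms by (simp add: vector_fields_def)

lemma vector_fields_add:
  assumes X: "X \<in> VF" and Y: "Y \<in> VF"
  shows "X + Y \<in> VF"
proof (rule vector_fieldI)
  fix f h :: "'m \<Rightarrow> real" and c :: real
  show "(X + Y) f = 0" if "f \<notin> SF"
    by (simp only: plus_fun_apply vector_field_nonsmooth[OF X that] vector_field_nonsmooth[OF Y that] add_0)
  assume f: "f \<in> SF"
  show "(X + Y) f \<in> SF"
    by (simp only: plus_fun_apply smooth_functions_add vector_field_smooth[OF X f] vector_field_smooth[OF Y f])
  show "(X + Y) (c *\<^sub>R f) = c *\<^sub>R (X + Y) f"
    by (simp only: plus_fun_apply vector_field_scale[OF X f] vector_field_scale[OF Y f] scaleR_add_right)
  assume h: "h \<in> SF"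
  show "(X + Y) (f + h) = (X + Y) f + (X + Y) h"
    by (simp only: plus_fun_apply vector_field_add[OF X f h] vector_field_add[OF Y f h] add_ac)
  show "(X + Y) (f * h) = f * (X + Y) h + h * (X + Y) f"
    by (simp only: plus_fun_apply vector_field_mult[OF X f h] vector_field_mult[OF Y f h] distrib_left add_ac)
qed

lemma vector_fields_fscale:
  assumes X: "X \<in> VF" and k: "k \<in> SF"
  shows "fscale k X \<in> VF"
proof (rule vector_fieldI)
  fix f h :: "'m \<Rightarrow> real" and c :: real
  show "fscale k X f = 0" if "f \<notin> SF"
    by (simp only: fscale_def vector_field_nonsmooth[OF X that] mult_zero_right)
  assume f: "f \<in> SF"
  show "fscale k X f \<in> SF"
    by (simp only: fscale_def smooth_functions_mult[OF k vector_field_smooth[OF X f]])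
  show "fscale k X (c *\<^sub>R f) = c *\<^sub>R fscale k X f"
    unfolding fscale_def vector_field_scale[OF X f] by (simp add: fun_eq_iff scaleR_fun_def)
  assume h: "h \<in> SF"
  show "fscale k X (f + h) = fscale k X f + fscale k X h"
    by (simp only: fscale_def vector_field_add[OF X f h] distrib_left)
  show "fscale k X (f * h) = f * fscale k X h + h * fscale k X f"
    by (simp only: fscale_def vector_field_mult[OF X f h] distrib_left mult.left_commute)
qed

lemma vector_fields_zero: "0 \<in> VF"
  by (rule vector_fieldI) (simp_all add: smooth_functions_0)

lemma fscale_const: "fscale (\<lambda>_. c) X = c *\<^sub>R X"
  by (simp add: fscale_def scaleR_fun_def fun_eq_iff)

lemma vector_fields_scaleR: "X \<in> VF \<Longrightarrow> c *\<^sub>R X \<in> VF"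
  using vector_fields_fscale[OF _ smooth_functions_const] by (simp add: fscale_const)

lemma vector_fields_uminus: "X \<in> VF \<Longrightarrow> - X \<in> VF"
  using vector_fields_scaleR[of X "-1"] by simp

lemma vector_fields_diff: "X \<in> VF \<Longrightarrow> Y \<in> VF \<Longrightarrow> X - Y \<in> VF"
  using vector_fields_add[OF _ vector_fields_uminus, of X Y] by simp

lemma vector_fields_sum: "(\<And>i. i \<in> I \<Longrightarrow> X i \<in> VF) \<Longrightarrow> (\<Sum>i\<in>I. X i) \<in> VF"
  by (induction I rule: infinite_finite_induct) (auto simp: vector_fields_zero vector_fields_add)

lemma vector_fields_bracket:
  assumes X: "X \<in> VF" and Y: "Y \<in> VF"
  shows "lie_bracket X Y \<in> VF"
proof (rule vector_fieldI)
  fix f h :: "'m \<Rightarrow> real" and c :: real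
  show "lie_bracket X Y f = 0" if "f \<notin> SF"
    by (simp only: lie_bracket_def vector_field_nonsmooth[OF X that] vector_field_nonsmooth[OF Y that]
        vector_field_0[OF X] vector_field_0[OF Y] diff_0_right)
  assume f: "f \<in> SF"
  have Xf: "X f \<in> SF" and Yf: "Y f \<in> SF" using vector_field_smooth X Y f by auto
  show "lie_bracket X Y f \<in> SF"
    by (simp only: lie_bracket_def smooth_functions_diff vector_field_smooth[OF X Yf] vector_field_smooth[OF Y Xf])
  show "lie_bracket X Y (c *\<^sub>R f) = c *\<^sub>R lie_bracket X Y f"
    by (simp only: lie_bracket_def vector_field_scale[OF X f] vector_field_scale[OF Y f]
        vector_field_scale[OF X Yf] vector_field_scale[OF Y Xf] scaleR_diff_right)
  assume h: "h \<in> SF"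
  have Xh: "X h \<in> SF" and Yh: "Y h \<in> SF" using vector_field_smooth X Y h by auto
  show "lie_bracket X Y (f + h) = lie_bracket X Y f + lie_bracket X Y h"
    unfolding lie_bracket_def vector_field_add[OF X f h] vector_field_add[OF Y f h]
      vector_field_add[OF X Yf Yh] vector_field_add[OF Y Xf Xh] by (simp add: fun_eq_iff)
  show "lie_bracket X Y (f * h) = f * lie_bracket X Y h + h * lie_bracket X Y f"
    unfolding lie_bracket_def vector_field_mult[OF X f h] vector_field_mult[OF Y f h]
      vector_field_add[OF X smooth_functions_mult[OF f Yh] smooth_functions_mult[OF h Yf]]
      vector_field_add[OF Y smooth_functions_mult[OF f Xh] smooth_functions_mult[OF h Xf]]
      vector_field_mult[OF X f Yh] vector_field_mult[OF X h Yf] vector_field_mult[OF Y f Xh] vector_field_mult[OF Y h Xf]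
    by (simp add: fun_eq_iff algebra_simps)
qed

end

locale lie_group_manifold = smooth_manifold A
  for A :: "('m::{t2_space, second_countable_topology}, 'e::euclidean_space) chart set" +
  fixes mul :: "'m \<Rightarrow> 'm \<Rightarrow> 'm" and one :: 'm and ginv :: "'m \<Rightarrow> 'm"
  assumes lie_group: "lie_group A mul one ginv"
begin

lemma group: "Groups.group mul one ginv"
  using lie_group by (simp add: lie_group_def)

sublocale G: Groups.group mul one ginv by (rule group)

lemma mul_cancel [simp]: "mul (ginv a) (mul a x) = x" "mul a (mul (ginv a) x) = x"
proof -
  have "mul (mul (ginv a) a) x = x" "mul (mul a (ginv a)) x = x" by simp_all
  then show "mul (ginv a) (mul a x) = x" "mul a (mul (ginv a) x) = x" by (simp_all only: G.assoc)
qed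

lemma inv_mul: "inv (mul a) = mul (ginv a)"
  by (rule inv_unique_comp) (simp_all add: fun_eq_iff)

lemma pushforward_mul: "pushforward (mul a) X f = (\<lambda>x. X (\<lambda>y. f (mul a y)) (mul (ginv a) x))"
  by (simp add: pushforward_def inv_mul o_def)

lemma inv_into_map_prod:
  assumes "(U, \<phi>) \<in> A" "(V, \<psi>) \<in> A" "x \<in> \<phi> ` U" "y \<in> \<psi> ` V"
  shows "inv_into (U \<times> V) (map_prod \<phi> \<psi>) (x, y) = (inv_into U \<phi> x, inv_into V \<psi> y)"
proof -
  obtain a b where ab: "a \<in> U" "x = \<phi> a" "b \<in> V" "y = \<psi> b" using assms(3,4) by blast
  have inj: "inj_on (map_prod \<phi> \<psi>) (U \<times> V)"
    using chart_inj assms(1,2) by (auto simp: inj_on_def)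
  have "inv_into (U \<times> V) (map_prod \<phi> \<psi>) (map_prod \<phi> \<psi> (a, b)) = (a, b)"
    by (rule inv_into_f_f[OF inj]) (use ab in simp)
  then show ?thesis using ab assms by simp
qed

text \<open>
Smooth maps are specified by a pair of charts; here the target chart varies with the point, so the coordinate
expression of \<open>f\<close> after multiplication has to be glued from neighbourhoods.
\<close>
lemma smooth_mul:
  assumes f: "f \<in> SF" and U: "(U, \<phi>) \<in> A" and V: "(V, \<psi>) \<in> A"
  shows "smooth_on (\<phi> ` U \<times> \<psi> ` V) (\<lambda>p. f (mul (inv_into U \<phi> (fst p)) (inv_into V \<psi> (snd p))))"
proof (rule smooth_on_local)
  fix p assume p: "p \<in> \<phi> ` U \<times> \<psi> ` V"
  let ?i = "\<lambda>p. (inv_into U \<phi> (fst p), inv_into V \<psi> (snd p))"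
  let ?m = "\<lambda>(x, y). mul x y"
  have sm: "smooth_map (prod_atlas A A) A ?m" using lie_group by (simp add: lie_group_def)
  obtain W \<kappa> where W: "(W, \<kappa>) \<in> A" "?m (?i p) \<in> W" by (rule chart_at)
  let ?S = "(U \<times> V) \<inter> ?m -` W"
  let ?T = "map_prod \<phi> \<psi> ` ?S"
  have UV: "(U \<times> V, map_prod \<phi> \<psi>) \<in> prod_atlas A A" using U V by (auto simp: prod_atlas_def)
  have smT: "smooth_on ?T (\<kappa> \<circ> ?m \<circ> inv_into (U \<times> V) (map_prod \<phi> \<psi>))"
    using sm UV W(1) unfolding smooth_map_def by blast
  have T_sub: "?T \<subseteq> \<phi> ` U \<times> \<psi> ` V" by auto
  have T_eq: "?T = (\<phi> ` U \<times> \<psi> ` V) \<inter> ?i -` ?S"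
  proof (intro equalityI subsetI)
    fix q assume "q \<in> ?T" then show "q \<in> (\<phi> ` U \<times> \<psi> ` V) \<inter> ?i -` ?S" using U V by auto
  next
    fix q assume "q \<in> (\<phi> ` U \<times> \<psi> ` V) \<inter> ?i -` ?S"
    then obtain a b where "a \<in> U" "b \<in> V" "q = (\<phi> a, \<psi> b)" "(a, b) \<in> ?S" using U V by auto
    then show "q \<in> ?T" by (intro image_eqI[of _ _ "(a, b)"]) auto
  qed
  have "continuous_on (\<phi> ` U \<times> \<psi> ` V) ?i"
  proof (rule continuous_on_Pair)
    show "continuous_on (\<phi> ` U \<times> \<psi> ` V) (\<lambda>p. inv_into U \<phi> (fst p))"
      by (rule continuous_on_compose2[OF homeomorphism_cont2[OF chart_homeomorphism[OF U]]])
        (auto intro: continuous_on_fst continuous_on_id)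
    show "continuous_on (\<phi> ` U \<times> \<psi> ` V) (\<lambda>p. inv_into V \<psi> (snd p))"
      by (rule continuous_on_compose2[OF homeomorphism_cont2[OF chart_homeomorphism[OF V]]])
        (auto intro: continuous_on_snd continuous_on_id)
  qed
  moreover have "continuous_on UNIV ?m" using sm by (simp add: smooth_map_def)
  then have "open (?m -` W)" using chart_open(1)[OF W(1)] by (simp add: open_vimage)
  then have "open ?S" using chart_open(1)[OF U] chart_open(1)[OF V] by (intro open_Int open_Times)
  ultimately have T: "open ?T" unfolding T_eq
    using continuous_open_preimage[OF _ open_Times[OF chart_open(2)[OF U] chart_open(2)[OF V]]] by blast
  have inv_T: "inv_into (U \<times> V) (map_prod \<phi> \<psi>) q = ?i q" if "q \<in> ?T" for q
    using inv_into_map_prod[OF U V, of "fst q" "snd q"] T_sub that by auto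
  have "smooth_on ?T (\<lambda>q. \<kappa> (?m (?i q)))"
    by (rule smooth_on_cong[OF T _ smT]) (simp add: inv_T)
  moreover have mW: "?m (?i q) \<in> W" if "q \<in> ?T" for q
    using that unfolding T_eq by blast
  ultimately have "smooth_on ?T (\<lambda>q. f (inv_into W \<kappa> (\<kappa> (?m (?i q)))))"
    by (intro smooth_on_compose[OF T _ smooth_functionsD[OF f W(1)]] image_subsetI imageI)
  then have "smooth_on ?T (\<lambda>q. f (?m (?i q)))"
    by (rule smooth_on_cong[OF T, rotated]) (use mW W(1) in simp)
  moreover have "p \<in> ?T"
  proof -
    have "?i p \<in> U \<times> V" using p by (auto simp: inv_into_into)
    then show ?thesis unfolding T_eq using p W(2) by blast
  qed
  ultimately show "\<exists>T. open T \<and> p \<in> T \<and> smooth_on T (\<lambda>p. f (mul (inv_into U \<phi> (fst p)) (inv_into V \<psi> (snd p))))"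
    using T unfolding prod.case by blast
qed

lemma smooth_left_translate:
  assumes f: "f \<in> SF"
  shows "(\<lambda>x. f (mul a x)) \<in> SF"
  unfolding smooth_functions_def
proof (clarsimp simp: o_def)
  fix V \<psi> assume V: "(V, \<psi>) \<in> A"
  obtain U \<phi> where U: "(U, \<phi>) \<in> A" "a \<in> U" by (rule chart_at)
  have "smooth_on (\<psi> ` V) (\<lambda>y. (\<phi> a, y))"
    by (intro smooth_on_Pair smooth_on_const smooth_on_ident chart_open(2)[OF V])
  from smooth_on_compose[OF chart_open(2)[OF V] this smooth_mul[OF f U(1) V]]
  show "smooth_on (\<psi> ` V) (\<lambda>y. f (mul a (inv_into V \<psi> y)))" using U by auto
qed

lemma smooth_left_translate_iff: "(\<lambda>x. f (mul a x)) \<in> SF \<longleftrightarrow> f \<in> SF"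
  using smooth_left_translate[of "\<lambda>x. f (mul a x)" "ginv a"] smooth_left_translate[of f a] by auto

lemma identity_chart_exists: "\<exists>c. c \<in> A \<and> one \<in> fst c"
  by (rule chart_at[of one]) force

definition "U1 = fst (SOME c. c \<in> A \<and> one \<in> fst c)"
definition "\<phi>1 = snd (SOME c. c \<in> A \<and> one \<in> fst c)"

lemma identity_chart: "(U1, \<phi>1) \<in> A" "one \<in> U1"
  using someI_ex[OF identity_chart_exists] by (simp_all add: U1_def \<phi>1_def)

definition at_one :: "('m \<Rightarrow> real) \<Rightarrow> 'e \<Rightarrow> real"
  where "at_one f w = frechet_derivative (\<lambda>x. f (inv_into U1 \<phi>1 x)) (at (\<phi>1 one)) w"

lemma at_one_has_derivative:
  "f \<in> SF \<Longrightarrow> ((\<lambda>x. f (inv_into U1 \<phi>1 x)) has_derivative at_one f) (at (\<phi>1 one))"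
  unfolding at_one_def using smooth_on_has_derivative[OF smooth_functionsD[OF _ identity_chart(1)]] identity_chart(2)
  by blast

lemma at_oneI:
  "((\<lambda>x. f (inv_into U1 \<phi>1 x)) has_derivative f') (at (\<phi>1 one)) \<Longrightarrow> at_one f w = f' w"
  unfolding at_one_def using frechet_derivative_at by metis

lemma at_one_add: "f \<in> SF \<Longrightarrow> h \<in> SF \<Longrightarrow> at_one (f + h) w = at_one f w + at_one h w"
  using at_oneI[of "f + h" "\<lambda>w. at_one f w + at_one h w"]
    has_derivative_add[OF at_one_has_derivative at_one_has_derivative] by simp

lemma at_one_scale: "f \<in> SF \<Longrightarrow> at_one (c *\<^sub>R f) w = c * at_one f w"
  using at_oneI[of "c *\<^sub>R f" "\<lambda>w. c * at_one f w"]
    has_derivative_mult_right[OF at_one_has_derivative, of f c] by (simp add: scaleR_fun_def)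

lemma at_one_mult: "f \<in> SF \<Longrightarrow> h \<in> SF \<Longrightarrow> at_one (f * h) w = f one * at_one h w + h one * at_one f w"
  using at_oneI[of "f * h" "\<lambda>w. f one * at_one h w + at_one f w * h one"]
    has_derivative_mult[OF at_one_has_derivative at_one_has_derivative] identity_chart by simp

lemma at_one_linear: "f \<in> SF \<Longrightarrow> linear (at_one f)"
  using at_one_has_derivative has_derivative_linear by blast

text \<open>
The left invariant field with value \<open>w\<close> at the identity. A vector field sends functions that are not smooth to zero,
which explains the second case.
\<close>
definition left_field :: "'e \<Rightarrow> 'm vfield"
  where "left_field w f = (if f \<in> SF then \<lambda>a. at_one (\<lambda>x. f (mul a x)) w else 0)"

text \<open>
The value at \<open>a\<close> is a partial derivative in the second variable of the smooth function \<open>(a, x) \<mapsto> f (a x)\<close>.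
\<close>
lemma left_field_smooth:
  assumes f: "f \<in> SF"
  shows "left_field w f \<in> SF"
  unfolding smooth_functions_def
proof (clarsimp simp: o_def)
  fix U \<phi> assume U: "(U, \<phi>) \<in> A"
  let ?G = "\<lambda>p. f (mul (inv_into U \<phi> (fst p)) (inv_into U1 \<phi>1 (snd p)))"
  let ?c = "\<phi>1 one"
  have G: "smooth_on (\<phi> ` U \<times> \<phi>1 ` U1) ?G" by (rule smooth_mul[OF f U identity_chart(1)])
  have c: "?c \<in> \<phi>1 ` U1" using identity_chart(2) by blast
  have "smooth_on (\<phi> ` U) (\<lambda>x. (x, ?c))"
    by (intro smooth_on_Pair smooth_on_const smooth_on_ident chart_open(2)[OF U])
  then have sm: "smooth_on (\<phi> ` U) (\<lambda>x. frechet_derivative ?G (at (x, ?c)) (0, w))"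
    by (rule smooth_on_compose[OF chart_open(2)[OF U] _ smooth_on_frechet_derivative[OF G]]) (use c in auto)
  show "smooth_on (\<phi> ` U) (\<lambda>x. left_field w f (inv_into U \<phi> x))"
  proof (rule smooth_on_cong[OF chart_open(2)[OF U] _ sm])
    fix x assume x: "x \<in> \<phi> ` U"
    have d: "(?G has_derivative frechet_derivative ?G (at (x, ?c))) (at (x, ?c))"
      using smooth_on_has_derivative[OF G] x c by blast
    have "((\<lambda>y. (x, y)) has_derivative (\<lambda>h. (0, h))) (at ?c)"
      by (auto intro!: derivative_eq_intros)
    from has_derivative_compose[OF this d]
    have "((\<lambda>y. f (mul (inv_into U \<phi> x) (inv_into U1 \<phi>1 y))) has_derivative
        (\<lambda>h. frechet_derivative ?G (at (x, ?c)) (0, h))) (at ?c)" by simp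
    then show "frechet_derivative ?G (at (x, ?c)) (0, w) = left_field w f (inv_into U \<phi> x)"
      using f by (simp add: left_field_def at_oneI)
  qed
qed

lemma translate_ops:
  "(\<lambda>x. (f + h) (mul a x)) = (\<lambda>x. f (mul a x)) + (\<lambda>x. h (mul a x))"
  "(\<lambda>x. (f * h) (mul a x)) = (\<lambda>x. f (mul a x)) * (\<lambda>x. h (mul a x))"
  "(\<lambda>x. (c *\<^sub>R f) (mul a x)) = c *\<^sub>R (\<lambda>x. f (mul a x) :: real)"
  by (simp_all add: fun_eq_iff scaleR_fun_def)

lemma left_field_vector_field: "left_field w \<in> VF"
proof (rule vector_fieldI)
  show "left_field w f \<in> SF" if "f \<in> SF" for f using left_field_smooth[OF that] .
  show "left_field w (f + h) = left_field w f + left_field w h" if "f \<in> SF" "h \<in> SF" for f h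
    unfolding left_field_def translate_ops
    using that smooth_functions_add[OF that] at_one_add[OF smooth_left_translate smooth_left_translate]
    by (simp add: fun_eq_iff)
  show "left_field w (c *\<^sub>R f) = c *\<^sub>R left_field w f" if "f \<in> SF" for c f
    unfolding left_field_def translate_ops
    using that smooth_functions_scale[OF that] at_one_scale[OF smooth_left_translate]
    by (simp add: fun_eq_iff scaleR_fun_def)
  show "left_field w (f * h) = f * left_field w h + h * left_field w f" if "f \<in> SF" "h \<in> SF" for f h
    unfolding left_field_def translate_ops
    using that smooth_functions_mult[OF that] at_one_mult[OF smooth_left_translate smooth_left_translate]
    by (simp add: fun_eq_iff)
qed (simp add: left_field_def)

lemma left_field_left_invariant: "left_field w \<in> lie_algebra A mul"
proof -
  have "pushforward (mul b) (left_field w) f = left_field w f" for b f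
    unfolding pushforward_mul left_field_def smooth_left_translate_iff
    by (auto simp: fun_eq_iff G.assoc[symmetric])
  then show ?thesis using left_field_vector_field by (auto simp: lie_algebra_def)
qed

text \<open>
Translate the derivation at \<open>p\<close> back to the identity and apply \<open>point_derivation\<close>.
\<close>
lemma vector_field_at_point:
  assumes "X \<in> VF"
  obtains w where "\<And>f. f \<in> SF \<Longrightarrow> X f p = left_field w f p"
proof -
  let ?v = "\<lambda>f. X (\<lambda>x. f (mul (ginv p) x)) p"
  obtain w where w: "\<And>f. f \<in> SF \<Longrightarrow> ?v f = frechet_derivative (\<lambda>x. f (inv_into U1 \<phi>1 x)) (at (\<phi>1 one)) w"
  proof (rule point_derivation[OF identity_chart, of ?v])
    show "?v (f + h) = ?v f + ?v h" if "f \<in> SF" "h \<in> SF" for f h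
      unfolding translate_ops using vector_field_add[OF assms] that smooth_left_translate by simp
    show "?v (c *\<^sub>R f) = c * ?v f" if "f \<in> SF" for c f
      unfolding translate_ops using vector_field_scale[OF assms] that smooth_left_translate
      by (simp add: scaleR_fun_def)
    show "?v (f * h) = f one * ?v h + h one * ?v f" if "f \<in> SF" "h \<in> SF" for f h
      unfolding translate_ops using vector_field_mult[OF assms] that smooth_left_translate by simp
  qed blast
  have "X f p = left_field w f p" if f: "f \<in> SF" for f
    using w[OF smooth_left_translate[OF f, of p]] f by (simp add: left_field_def at_one_def)
  then show thesis using that by blast
qed

lemma left_invariant_eq_left_field:
  assumes "X \<in> lie_algebra A mul"
  obtains w where "X = left_field w"
proof -
  have X: "X \<in> VF" "\<And>a. pushforward (mul a) X = X" using assms by (auto simp: lie_algebra_def)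
  obtain w where w: "\<And>f. f \<in> SF \<Longrightarrow> X f one = left_field w f one"
    by (rule vector_field_at_point[OF X(1)]) blast
  have "X f a = left_field w f a" for f a
  proof (cases "f \<in> SF")
    case True
    have "X f a = X (\<lambda>y. f (mul a y)) one" using X(2)[of a] pushforward_mul[of a X f] by simp
    also have "\<dots> = left_field w f a"
      using w[OF smooth_left_translate[OF True]] True smooth_left_translate[OF True] by (simp add: left_field_def)
    finally show ?thesis .
  qed (use X(1) in \<open>simp add: left_field_def vector_field_nonsmooth\<close>)
  then show thesis using that[of w] by (simp add: fun_eq_iff)
qed

lemma linear_left_field: "linear left_field"
proof (rule linearI)
  fix v w :: 'e and c :: real
  show "left_field (v + w) = left_field v + left_field w"
    using at_one_linear[OF smooth_left_translate] by (auto simp: left_field_def fun_eq_iff linear_add)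
  show "left_field (c *\<^sub>R w) = c *\<^sub>R left_field w"
    using at_one_linear[OF smooth_left_translate] by (auto simp: left_field_def fun_eq_iff scaleR_fun_def linear_scale)
qed

lemma left_field_eq_0:
  assumes "\<And>f. f \<in> SF \<Longrightarrow> left_field w f p = 0"
  shows "w = 0"
proof (rule tangent_vector_separated[OF identity_chart])
  fix f assume f: "f \<in> SF"
  have "left_field w (\<lambda>x. f (mul (ginv p) x)) p = 0" by (rule assms[OF smooth_left_translate[OF f]])
  then show "frechet_derivative (\<lambda>x. f (inv_into U1 \<phi>1 x)) (at (\<phi>1 one)) w = 0"
    using smooth_left_translate[OF f] by (simp add: left_field_def at_one_def)
qed

lemma range_left_field: "range left_field = lie_algebra A mul"
proof
  show "range left_field \<subseteq> lie_algebra A mul" using left_field_left_invariant by blast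
  show "lie_algebra A mul \<subseteq> range left_field" by (rule subsetI, erule left_invariant_eq_left_field) blast
qed

end

section \<open>The Euclidean model of the Lie algebra\<close>

locale lie_hermitian_manifold = lie_group_manifold A mul one ginv
  for A :: "('m::{t2_space, second_countable_topology}, 'e::euclidean_space) chart set"
    and mul :: "'m \<Rightarrow> 'm \<Rightarrow> 'm" and one :: 'm and ginv :: "'m \<Rightarrow> 'm" +
  fixes J :: "'m vfield \<Rightarrow> 'm vfield" and g :: "'m vfield \<Rightarrow> 'm vfield \<Rightarrow> 'm \<Rightarrow> real" and n :: nat
  assumes lie_hermitian: "lie_hermitian n A mul one ginv J g"
begin

abbreviation "L \<equiv> lie_algebra A mul"

lemma hermitian: "hermitian A J g" and complex: "complex_structure A J" and metric: "riemannian_metric A g"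
  using lie_hermitian by (auto simp: lie_hermitian_def hermitian_def)

lemma g_smooth: "X \<in> VF \<Longrightarrow> Y \<in> VF \<Longrightarrow> g X Y \<in> SF"
  and g_sym: "X \<in> VF \<Longrightarrow> Y \<in> VF \<Longrightarrow> g X Y = g Y X"
  and g_add_left: "X \<in> VF \<Longrightarrow> Y \<in> VF \<Longrightarrow> Z \<in> VF \<Longrightarrow> g (X + Y) Z = g X Z + g Y Z"
  and g_fscale_left: "f \<in> SF \<Longrightarrow> X \<in> VF \<Longrightarrow> Y \<in> VF \<Longrightarrow> g (fscale f X) Y = f * g X Y"
  and g_nonneg: "X \<in> VF \<Longrightarrow> 0 \<le> g X X p"
  and g_eq_0_iff: "X \<in> VF \<Longrightarrow> g X X p = 0 \<longleftrightarrow> (\<forall>f\<in>SF. X f p = 0)"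
  using metric unfolding riemannian_metric_def by blast+

lemma J_vf: "X \<in> VF \<Longrightarrow> J X \<in> VF"
  and J_add: "X \<in> VF \<Longrightarrow> Y \<in> VF \<Longrightarrow> J (X + Y) = J X + J Y"
  and J_fscale: "f \<in> SF \<Longrightarrow> X \<in> VF \<Longrightarrow> J (fscale f X) = fscale f (J X)"
  and J_J: "X \<in> VF \<Longrightarrow> J (J X) = - X"
  and J_integrable: "X \<in> VF \<Longrightarrow> Y \<in> VF \<Longrightarrow>
    lie_bracket (J X) (J Y) = lie_bracket X Y + J (lie_bracket (J X) Y) + J (lie_bracket X (J Y))"
  using complex unfolding complex_structure_def by blast+

lemma g_J: "X \<in> VF \<Longrightarrow> Y \<in> VF \<Longrightarrow> g (J X) (J Y) = g X Y"
  using hermitian by (simp add: hermitian_def)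

lemma g_add_right: "X \<in> VF \<Longrightarrow> Y \<in> VF \<Longrightarrow> Z \<in> VF \<Longrightarrow> g Z (X + Y) = g Z X + g Z Y"
  using g_add_left[of X Y Z] g_sym vector_fields_add by metis

lemma g_fscale_right: "f \<in> SF \<Longrightarrow> X \<in> VF \<Longrightarrow> Y \<in> VF \<Longrightarrow> g Y (fscale f X) = f * g Y X"
  using g_fscale_left[of f X Y] g_sym vector_fields_fscale by metis

lemma g_scaleR_left: "X \<in> VF \<Longrightarrow> Y \<in> VF \<Longrightarrow> g (c *\<^sub>R X) Y p = c * g X Y p"
  using g_fscale_left[OF smooth_functions_const, of X Y c] by (simp add: fscale_const)

lemma g_scaleR_right: "X \<in> VF \<Longrightarrow> Y \<in> VF \<Longrightarrow> g Y (c *\<^sub>R X) p = c * g Y X p"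
  using g_fscale_right[OF smooth_functions_const, of X Y c] by (simp add: fscale_const)

lemma g_minus_left: "X \<in> VF \<Longrightarrow> Y \<in> VF \<Longrightarrow> g (- X) Y = - g X Y"
  using g_scaleR_left[of X Y "-1"] by (simp add: fun_eq_iff)

lemma g_minus_right: "X \<in> VF \<Longrightarrow> Y \<in> VF \<Longrightarrow> g Y (- X) = - g Y X"
  using g_scaleR_right[of X Y "-1"] by (simp add: fun_eq_iff)

lemma g_diff_left: "X \<in> VF \<Longrightarrow> Y \<in> VF \<Longrightarrow> Z \<in> VF \<Longrightarrow> g (X - Y) Z = g X Z - g Y Z"
  using g_add_left[of X "- Y" Z] g_minus_left[of Y Z] vector_fields_uminus by simp

text \<open>
The metric is given on fields only; this says that \<open>g V Y p\<close> depends on the value of \<open>V\<close> at \<open>p\<close>. It is the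
Cauchy--Schwarz inequality for a \<open>V\<close> of length zero at \<open>p\<close>.
\<close>
lemma g_vanish:
  assumes V: "V \<in> VF" "\<And>f. f \<in> SF \<Longrightarrow> V f p = 0" and Y: "Y \<in> VF"
  shows "g V Y p = 0"
proof (rule nonneg_quadratic_linear_coeff_0)
  fix t
  have tY: "t *\<^sub>R Y \<in> VF" using Y by (rule vector_fields_scaleR)
  have "0 \<le> g (V + t *\<^sub>R Y) (V + t *\<^sub>R Y) p" by (rule g_nonneg[OF vector_fields_add[OF V(1) tY]])
  also have "\<dots> = g V V p + t * g V Y p + (t * g Y V p + t * (t * g Y Y p))"
    using g_add_left[OF V(1) tY vector_fields_add[OF V(1) tY]] g_add_right[OF V(1) tY V(1)]
      g_add_right[OF V(1) tY tY] g_scaleR_left[OF Y V(1), of t p] g_scaleR_right[OF Y V(1), of t p]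
      g_scaleR_left[OF Y tY, of t p] g_scaleR_right[OF Y Y, of t p] by simp
  also have "g V V p = 0" using V by (simp add: g_eq_0_iff)
  also have "g Y V p = g V Y p" using g_sym[OF Y V(1)] by simp
  finally show "0 \<le> 2 * t * g V Y p + t\<^sup>2 * g Y Y p" by (simp add: power2_eq_square algebra_simps)
qed

lemma J_scaleR: "X \<in> VF \<Longrightarrow> J (c *\<^sub>R X) = c *\<^sub>R J X"
  using J_fscale[OF smooth_functions_const, of X c] by (simp add: fscale_const)

lemma L_vf: "X \<in> L \<Longrightarrow> X \<in> VF"
  by (simp add: lie_algebra_def)

lemma subspace_L: "subspace L"
  unfolding range_left_field[symmetric] by (rule linear_subspace_image[OF linear_left_field subspace_UNIV])

lemma L_iff: "X \<in> L \<longleftrightarrow> X \<in> VF \<and> (\<forall>a f. X (\<lambda>y. f (mul a y)) = (\<lambda>y. X f (mul a y)))"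
proof -
  have "(\<forall>a. pushforward (mul a) X = X) \<longleftrightarrow> (\<forall>a f. X (\<lambda>y. f (mul a y)) = (\<lambda>y. X f (mul a y)))"
  proof (intro iffI allI ext)
    fix a f y assume "\<forall>a. pushforward (mul a) X = X"
    then have "pushforward (mul a) X f (mul a y) = X f (mul a y)" by simp
    then show "X (\<lambda>y. f (mul a y)) y = X f (mul a y)" by (simp add: pushforward_mul)
  next
    fix a f y assume "\<forall>a f. X (\<lambda>y. f (mul a y)) = (\<lambda>y. X f (mul a y))"
    then have "X (\<lambda>y. f (mul a y)) (mul (ginv a) y) = X f (mul a (mul (ginv a) y))" by meson
    then show "pushforward (mul a) X f y = X f y" by (simp add: pushforward_mul)
  qed
  then show ?thesis by (auto simp: lie_algebra_def)
qed

lemma bracket_L: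
  assumes "X \<in> L" "Y \<in> L"
  shows "lie_bracket X Y \<in> L"
proof -
  have X: "X (\<lambda>y. f (mul a y)) = (\<lambda>y. X f (mul a y))" and Y: "Y (\<lambda>y. f (mul a y)) = (\<lambda>y. Y f (mul a y))" for a f
    using assms L_iff by blast+
  have "lie_bracket X Y (\<lambda>y. f (mul a y)) = (\<lambda>y. lie_bracket X Y f (mul a y))" for a f
    by (simp only: lie_bracket_def X Y) (simp add: fun_eq_iff)
  then show ?thesis using assms vector_fields_bracket L_vf by (simp add: L_iff)
qed

lemma J_L: "X \<in> L \<Longrightarrow> J X \<in> L"
proof -
  assume X: "X \<in> L"
  have "pushforward (mul a) (J X) = J X" for a
  proof -
    have "J (pushforward (mul a) X) = pushforward (mul a) (J X)"
      using lie_hermitian L_vf[OF X] unfolding lie_hermitian_def by blast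
    then show ?thesis using X by (simp add: lie_algebra_def)
  qed
  then show ?thesis using J_vf[OF L_vf[OF X]] by (simp add: lie_algebra_def)
qed

lemma g_L_const:
  assumes "X \<in> L" "Y \<in> L"
  shows "g X Y p = g X Y one"
proof -
  have "g (pushforward (mul p) X) (pushforward (mul p) Y) \<circ> mul p = g X Y"
    using lie_hermitian assms L_vf unfolding lie_hermitian_def by blast
  then have "g X Y \<circ> mul p = g X Y" using assms by (simp add: lie_algebra_def)
  then have "g X Y (mul p one) = g X Y one" by (metis comp_apply)
  then show ?thesis by simp
qed

text \<open>
Left invariant fields correspond to tangent vectors at the identity, and inner products of left invariant fields are
constant; \<open>orthonormalizing_map_exists\<close> makes the correspondence isometric.
\<close>
lemma isometry_exists: "\<exists>\<Phi>. linear \<Phi> \<and> inj \<Phi> \<and> range \<Phi> = L \<and> (\<forall>x y. g (\<Phi> x) (\<Phi> y) = (\<lambda>_. x \<bullet> (y :: 'e)))"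
proof -
  define B where "B x y = g (left_field x) (left_field y) one" for x y
  note lf = linear_left_field left_field_vector_field
  have bil: "bilinear B"
    unfolding bilinear_def
    by (intro conjI allI linearI) (use lf in \<open>simp_all add: B_def linear_add linear_scale g_add_left g_add_right g_scaleR_left g_scaleR_right\<close>)
  have sym: "B x y = B y x" for x y
    unfolding B_def using g_sym[OF lf(2) lf(2), of x y] by simp
  have pos: "B x x > 0" if "x \<noteq> 0" for x
  proof -
    have "B x x \<noteq> 0" using that left_field_eq_0[of x one] g_eq_0_iff[OF lf(2)] by (auto simp: B_def)
    moreover have "B x x \<ge> 0" unfolding B_def using g_nonneg lf by blast
    ultimately show ?thesis by simp
  qed
  obtain T :: "'e \<Rightarrow> 'e" where T: "linear T" "bij T" "\<And>x y. B (T x) (T y) = x \<bullet> y"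
    by (rule orthonormalizing_map_exists[OF bil sym pos]) (assumption, blast)
  define \<Phi> where "\<Phi> x = left_field (T x)" for x
  have "linear \<Phi>" unfolding \<Phi>_def using linear_compose[OF T(1) lf(1)] by (simp add: o_def)
  moreover have range: "range \<Phi> = L"
  proof -
    have "range \<Phi> = left_field ` range T" by (simp add: \<Phi>_def image_image)
    then show ?thesis using bij_is_surj[OF T(2)] range_left_field by simp
  qed
  moreover have iso: "g (\<Phi> x) (\<Phi> y) = (\<lambda>_. x \<bullet> y)" for x y
  proof
    fix p
    have "\<Phi> x \<in> L" "\<Phi> y \<in> L" using range by blast+
    then show "g (\<Phi> x) (\<Phi> y) p = x \<bullet> y"
      using g_L_const[of "\<Phi> x" "\<Phi> y" p] T(3)[of x y] by (simp add: B_def \<Phi>_def)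
  qed
  moreover have "inj \<Phi>"
    unfolding linear_injective_0[OF \<open>linear \<Phi>\<close>]
  proof (intro allI impI)
    fix x assume "\<Phi> x = 0"
    then have "x \<bullet> x = g 0 (\<Phi> x) one" using fun_cong[OF iso[of x x], of one] by simp
    also have "\<dots> = 0" using g_scaleR_left[OF vector_fields_zero vector_fields_zero, of 0] \<open>\<Phi> x = 0\<close> by simp
    finally show "x = 0" by simp
  qed
  ultimately show ?thesis by blast
qed

definition \<Phi> :: "'e \<Rightarrow> 'm vfield"
  where "\<Phi> = (SOME \<Phi>. linear \<Phi> \<and> inj \<Phi> \<and> range \<Phi> = L \<and> (\<forall>x y. g (\<Phi> x) (\<Phi> y) = (\<lambda>_. x \<bullet> y)))"

lemma linear_\<Phi>: "linear \<Phi>" and inj_\<Phi>: "inj \<Phi>" and range_\<Phi>: "range \<Phi> = L"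
  and g_\<Phi>: "g (\<Phi> x) (\<Phi> y) = (\<lambda>_. x \<bullet> y)"
  using someI_ex[OF isometry_exists] unfolding \<Phi>_def[symmetric] by blast+

lemma \<Phi>_L: "\<Phi> x \<in> L"
  using range_\<Phi> by blast

lemma \<Phi>_vf: "\<Phi> x \<in> VF"
  using \<Phi>_L L_vf by blast

lemma \<Phi>_eq_iff: "\<Phi> x = \<Phi> y \<longleftrightarrow> x = y"
  using inj_\<Phi> by (auto simp: inj_def)

definition \<Psi> :: "'m vfield \<Rightarrow> 'e" where "\<Psi> = inv \<Phi>"

lemma \<Psi>_\<Phi> [simp]: "\<Psi> (\<Phi> x) = x"
  by (simp add: \<Psi>_def inj_\<Phi>)

lemma \<Phi>_\<Psi>: "X \<in> L \<Longrightarrow> \<Phi> (\<Psi> X) = X"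
  unfolding \<Psi>_def range_\<Phi>[symmetric] by (rule f_inv_into_f)

lemmas \<Phi>_simps = linear_add[OF linear_\<Phi>] linear_diff[OF linear_\<Phi>] linear_neg[OF linear_\<Phi>]
  linear_scale[OF linear_\<Phi>] linear_0[OF linear_\<Phi>] linear_sum[OF linear_\<Phi>]

lemma vector_field_at_point_\<Phi>:
  assumes "X \<in> VF"
  obtains x where "\<And>f. f \<in> SF \<Longrightarrow> X f p = \<Phi> x f p"
proof -
  obtain w where w: "\<And>f. f \<in> SF \<Longrightarrow> X f p = left_field w f p"
    by (rule vector_field_at_point[OF assms]) blast
  have "left_field w = \<Phi> (\<Psi> (left_field w))" using \<Phi>_\<Psi> left_field_left_invariant by metis
  then show thesis using that w by metis
qed

text \<open>
At each point \<open>V\<close> agrees with some \<open>\<Phi> x\<close>, whose components are the inner products with the orthonormal frame.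
\<close>
lemma frame_expansion:
  assumes V: "V \<in> VF"
  shows "V = (\<Sum>b\<in>Basis. fscale (g V (\<Phi> b)) (\<Phi> b))"
proof (intro ext)
  fix f p
  show "V f p = (\<Sum>b\<in>Basis. fscale (g V (\<Phi> b)) (\<Phi> b)) f p"
  proof (cases "f \<in> SF")
    case True
    obtain x where x: "\<And>f. f \<in> SF \<Longrightarrow> V f p = \<Phi> x f p" by (rule vector_field_at_point_\<Phi>[OF V]) blast
    have "g V (\<Phi> b) p = x \<bullet> b" for b
    proof -
      have "g (V - \<Phi> x) (\<Phi> b) p = 0"
        by (rule g_vanish) (use V \<Phi>_vf x in \<open>simp_all add: vector_fields_diff\<close>)
      then show ?thesis using g_diff_left[OF V \<Phi>_vf \<Phi>_vf, of x b] by (simp add: g_\<Phi>)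
    qed
    then have "(\<Sum>b\<in>Basis. fscale (g V (\<Phi> b)) (\<Phi> b)) f p = (\<Sum>b\<in>Basis. (x \<bullet> b) *\<^sub>R \<Phi> b) f p"
      by (simp add: sum_fun_apply fscale_def scaleR_fun_def)
    also have "(\<Sum>b\<in>Basis. (x \<bullet> b) *\<^sub>R \<Phi> b) = \<Phi> (\<Sum>b\<in>Basis. (x \<bullet> b) *\<^sub>R b)"
      by (simp add: \<Phi>_simps)
    finally show ?thesis using x[OF True] by (simp add: euclidean_representation)
  next
    case False
    then show ?thesis using V \<Phi>_vf by (simp add: vector_field_nonsmooth sum_fun_apply fscale_def)
  qed
qed

lemma frame_eqI:
  assumes "V \<in> VF" "V' \<in> VF" "\<And>b. b \<in> Basis \<Longrightarrow> g V (\<Phi> b) = g V' (\<Phi> b)"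
  shows "V = V'"
  using frame_expansion[OF assms(1)] frame_expansion[OF assms(2)] assms(3) by simp

lemma bracket_skew: "lie_bracket X Y = - lie_bracket Y X"
  by (simp add: lie_bracket_def fun_eq_iff)

lemma bracket_add_left:
  assumes "X \<in> VF" "Y \<in> VF" "Z \<in> VF"
  shows "lie_bracket (X + Y) Z = lie_bracket X Z + lie_bracket Y Z"
proof
  fix f
  show "lie_bracket (X + Y) Z f = (lie_bracket X Z + lie_bracket Y Z) f"
  proof (cases "f \<in> SF")
    case True
    show ?thesis
      by (simp only: lie_bracket_def plus_fun_apply
          vector_field_add[OF assms(3) vector_field_smooth[OF assms(1) True] vector_field_smooth[OF assms(2) True]])
        (simp only: algebra_simps)
  next
    case False
    then show ?thesis
      using vector_field_nonsmooth[OF vector_fields_bracket False] vector_fields_add assms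
      by (simp only: plus_fun_apply add_0)
  qed
qed

lemma bracket_fscale_left:
  assumes k: "k \<in> SF" and X: "X \<in> VF" and Z: "Z \<in> VF"
  shows "lie_bracket (fscale k X) Z = fscale k (lie_bracket X Z) - fscale (Z k) X"
proof
  fix f
  show "lie_bracket (fscale k X) Z f = (fscale k (lie_bracket X Z) - fscale (Z k) X) f"
  proof (cases "f \<in> SF")
    case True
    show ?thesis
      by (simp add: lie_bracket_def fscale_def vector_field_mult[OF Z k vector_field_smooth[OF X True]]
          fun_eq_iff algebra_simps)
  next
    case False
    then show ?thesis
      using vector_field_nonsmooth[OF vector_fields_bracket False] vector_field_nonsmooth[OF vector_fields_fscale False]
        vector_fields_bracket vector_fields_fscale vector_field_smooth assms
      by (simp only: minus_apply diff_0_right)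
  qed
qed

lemma bracket_scaleR_left: "X \<in> VF \<Longrightarrow> Z \<in> VF \<Longrightarrow> lie_bracket (c *\<^sub>R X) Z = c *\<^sub>R lie_bracket X Z"
  using bracket_fscale_left[OF smooth_functions_const, of X Z c] vector_field_const[of Z c]
  by (simp add: fscale_const) (simp add: fscale_def fun_eq_iff)

lemma bracket_jacobi:
  assumes X: "X \<in> VF" and Y: "Y \<in> VF" and Z: "Z \<in> VF"
  shows "lie_bracket X (lie_bracket Y Z) + lie_bracket Y (lie_bracket Z X) + lie_bracket Z (lie_bracket X Y) = 0"
proof
  fix f
  have d: "U (V (W f) - V' (W' f)) = U (V (W f)) - U (V' (W' f))"
    if "U \<in> VF" "V \<in> VF" "V' \<in> VF" "W \<in> VF" "W' \<in> VF" "f \<in> SF" for U V V' W W'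
    by (rule vector_field_diff_fun[OF that(1) vector_field_smooth[OF that(2) vector_field_smooth[OF that(4,6)]]
          vector_field_smooth[OF that(3) vector_field_smooth[OF that(5,6)]]])
  show "(lie_bracket X (lie_bracket Y Z) + lie_bracket Y (lie_bracket Z X) + lie_bracket Z (lie_bracket X Y)) f = 0 f"
  proof (cases "f \<in> SF")
    case True
    show ?thesis
      by (simp only: lie_bracket_def plus_fun_apply d[OF X Y Z Z Y True] d[OF Y Z X X Z True] d[OF Z X Y Y X True])
        (simp add: fun_eq_iff)
  next
    case False
    then show ?thesis
      using vector_field_nonsmooth[OF vector_fields_bracket False] vector_fields_bracket assms
      by (simp only: plus_fun_apply add_0 zero_fun_apply)
  qed
qed

definition br :: "'e \<Rightarrow> 'e \<Rightarrow> 'e" where "br x y = \<Psi> (lie_bracket (\<Phi> x) (\<Phi> y))"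
definition j :: "'e \<Rightarrow> 'e" where "j x = \<Psi> (J (\<Phi> x))"

lemma \<Phi>_br: "\<Phi> (br x y) = lie_bracket (\<Phi> x) (\<Phi> y)"
  unfolding br_def by (rule \<Phi>_\<Psi>[OF bracket_L[OF \<Phi>_L \<Phi>_L]])

lemma \<Phi>_j: "\<Phi> (j x) = J (\<Phi> x)"
  unfolding j_def by (rule \<Phi>_\<Psi>[OF J_L[OF \<Phi>_L]])

sublocale H: hermitian_lie_algebra br j
proof -
  have skew: "br x y = - br y x" for x y
    unfolding \<Phi>_eq_iff[symmetric] \<Phi>_simps \<Phi>_br by (rule bracket_skew)
  have lin: "linear (\<lambda>x. br x y)" for y
    by (rule linearI; unfold \<Phi>_eq_iff[symmetric] \<Phi>_simps \<Phi>_br)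
      (simp_all add: bracket_add_left bracket_scaleR_left \<Phi>_vf)
  have "linear (\<lambda>y. br x y)" for x
    unfolding skew[of x] by (intro linear_compose_neg lin)
  with lin have bil: "bilinear br" by (simp add: bilinear_def)
  have jac: "br x (br y z) + br y (br z x) + br z (br x y) = 0" for x y z
    unfolding \<Phi>_eq_iff[symmetric] \<Phi>_simps \<Phi>_br by (rule bracket_jacobi[OF \<Phi>_vf \<Phi>_vf \<Phi>_vf])
  have linj: "linear j"
    by (rule linearI; unfold \<Phi>_eq_iff[symmetric] \<Phi>_simps \<Phi>_j) (simp_all add: J_add J_scaleR \<Phi>_vf)
  have jj: "j (j x) = - x" for x
    unfolding \<Phi>_eq_iff[symmetric] \<Phi>_simps \<Phi>_j by (rule J_J[OF \<Phi>_vf])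
  have iso: "j x \<bullet> j y = x \<bullet> y" for x y
    using g_J[OF \<Phi>_vf \<Phi>_vf, of x y] unfolding \<Phi>_j[symmetric] g_\<Phi> by (rule fun_cong)
  have int: "br (j x) (j y) = br x y + j (br (j x) y) + j (br x (j y))" for x y
    unfolding \<Phi>_eq_iff[symmetric] \<Phi>_simps \<Phi>_br \<Phi>_j by (rule J_integrable[OF \<Phi>_vf \<Phi>_vf])
  show "hermitian_lie_algebra br j"
    unfolding hermitian_lie_algebra_def using bil skew jac linj jj iso int by blast
qed

lemma bracket_space_\<Phi>: "bracket_space (range \<Phi>) (\<Phi> ` S) = \<Phi> ` span {br x y |x y. y \<in> S}"
proof -
  have "{lie_bracket X Y |X Y. X \<in> range \<Phi> \<and> Y \<in> \<Phi> ` S} = \<Phi> ` {br x y |x y. y \<in> S}"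
  proof (intro equalityI subsetI)
    fix v assume "v \<in> {lie_bracket X Y |X Y. X \<in> range \<Phi> \<and> Y \<in> \<Phi> ` S}"
    then obtain x y where "y \<in> S" "v = lie_bracket (\<Phi> x) (\<Phi> y)" by blast
    then show "v \<in> \<Phi> ` {br x y |x y. y \<in> S}" unfolding \<Phi>_br[symmetric] by blast
  next
    fix v assume "v \<in> \<Phi> ` {br x y |x y. y \<in> S}"
    then obtain x y where "y \<in> S" "v = \<Phi> (br x y)" by blast
    then show "v \<in> {lie_bracket X Y |X Y. X \<in> range \<Phi> \<and> Y \<in> \<Phi> ` S}" unfolding \<Phi>_br by blast
  qed
  then show ?thesis unfolding bracket_space_def by (simp only: span_linear_image[OF linear_\<Phi>])
qed

lemma lower_central_\<Phi>: "lower_central L k = \<Phi> ` descending_series br k"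
  by (induction k) (simp_all add: range_\<Phi>[symmetric] bracket_space_\<Phi> descending_series.simps(2))

lemma derived_\<Phi>: "bracket_space L L = \<Phi> ` H.derived"
  using bracket_space_\<Phi>[of UNIV] by (simp add: range_\<Phi>[symmetric] H.derived_def)

end

section \<open>Left invariance of the Strominger connection\<close>

text \<open>
The difference of two Strominger connections, as a trilinear form, is a 3-form (it is skew in the last two
arguments and its alternation is skew too) for which \<open>J\<close> may be moved between the last two arguments, hence between any two. Moving
\<open>J\<close> once around the three arguments changes the sign, so the form is zero.
\<close>
lemma strominger_form_unique:
  fixes F :: "'a::group_add \<Rightarrow> 'a \<Rightarrow> 'a \<Rightarrow> real"
  assumes skew: "\<And>x y z. F x y z = - F x z y"
    and J: "\<And>x y z. F x (j y) (j z) = F x y z" and jj: "\<And>x. j (j x) = - x"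
    and neg: "\<And>x y z. F x y (- z) = - F x y z"
    and torsion: "\<And>x y z. F x y z - F y x z = - (F x z y - F z x y)"
  shows "F x y z = 0"
proof -
  have cyc: "F x y z = F z x y" for x y z
    using torsion[of x y z] skew[of x z y] skew[of y x z] torsion[of z x y] skew[of z y x] skew[of x z y] by linarith
  have move: "F x (j y) z = - F x y (j z)" for x y z
    using J[of x y "j z"] by (simp add: jj neg)
  have "F (j x) y z = 0" for x y z
  proof -
    have "F (j x) y z = F z (j x) y" by (rule cyc)
    also have "\<dots> = - F z x (j y)" by (rule move)
    also have "\<dots> = - F (j y) z x" by (simp add: cyc[of z x "j y"])
    also have "\<dots> = - F x (j y) z" by (simp add: cyc[of x "j y" z] cyc[of "j y" z x])
    also have "\<dots> = F x y (j z)" by (simp add: move)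
    also have "\<dots> = F y (j z) x" using cyc[of y "j z" x] by simp
    also have "\<dots> = - F y z (j x)" by (rule move)
    also have "\<dots> = - F (j x) y z" by (simp add: cyc[of y z "j x"])
    finally show ?thesis by simp
  qed
  from this[of "j (- x)"] show ?thesis by (simp add: jj)
qed

context lie_hermitian_manifold
begin

lemma \<Phi>_const: "\<Phi> x (\<lambda>_. c) = 0"
  by (rule vector_field_const[OF \<Phi>_vf])

lemma constant_components_in_L:
  assumes "V \<in> VF" "\<And>b p. b \<in> Basis \<Longrightarrow> g V (\<Phi> b) p = g V (\<Phi> b) one"
  shows "V \<in> L"
proof -
  have "V = (\<Sum>b\<in>Basis. fscale (g V (\<Phi> b)) (\<Phi> b))" by (rule frame_expansion[OF assms(1)])
  also have "\<dots> = (\<Sum>b\<in>Basis. g V (\<Phi> b) one *\<^sub>R \<Phi> b)"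
  proof (rule sum.cong[OF refl])
    fix b :: 'e assume "b \<in> Basis"
    then have "g V (\<Phi> b) = (\<lambda>_. g V (\<Phi> b) one)" using assms(2) by blast
    then show "fscale (g V (\<Phi> b)) (\<Phi> b) = g V (\<Phi> b) one *\<^sub>R \<Phi> b" by (metis fscale_const)
  qed
  also have "\<dots> \<in> L" using subspace_L \<Phi>_L by (intro subspace_sum subspace_scale)
  finally show ?thesis .
qed

text \<open>
The components \<open>g (D X Y) Z\<close> for left invariant \<open>X, Y, Z\<close> satisfy at every point the same inhomogeneous linear
equations; by \<open>strominger_form_unique\<close> their values at any two points agree. So they are constant.
\<close>
lemma strominger_connection_left_invariant:
  assumes D: "strominger_connection A J g D"
  shows "D (\<Phi> x) (\<Phi> y) \<in> L"
proof (rule constant_components_in_L)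
  have mc: "metric_connection A g D" and DJ: "\<And>X Y. X \<in> VF \<Longrightarrow> Y \<in> VF \<Longrightarrow> D X (J Y) = J (D X Y)"
    and tor: "\<And>X Y Z. X \<in> VF \<Longrightarrow> Y \<in> VF \<Longrightarrow> Z \<in> VF \<Longrightarrow> g (torsion D X Y) Z = - g (torsion D X Z) Y"
    using D unfolding strominger_connection_def by blast+
  have D_vf: "\<And>X Y. X \<in> VF \<Longrightarrow> Y \<in> VF \<Longrightarrow> D X Y \<in> VF"
    and D_metric: "\<And>X Y Z. X \<in> VF \<Longrightarrow> Y \<in> VF \<Longrightarrow> Z \<in> VF \<Longrightarrow> X (g Y Z) = g (D X Y) Z + g Y (D X Z)"
    using mc unfolding metric_connection_def connection_def by blast+
  show "D (\<Phi> x) (\<Phi> y) \<in> VF" by (rule D_vf[OF \<Phi>_vf \<Phi>_vf])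
  fix b p
  define f where "f q x y z = g (D (\<Phi> x) (\<Phi> y)) (\<Phi> z) q" for q x y z
  have f_skew: "f q x y z = - f q x z y" for q x y z
  proof -
    have "0 = g (D (\<Phi> x) (\<Phi> y)) (\<Phi> z) + g (\<Phi> y) (D (\<Phi> x) (\<Phi> z))"
      using D_metric[OF \<Phi>_vf \<Phi>_vf \<Phi>_vf, of x y z] by (simp add: g_\<Phi> \<Phi>_const)
    from fun_cong[OF this, of q] show ?thesis
      using g_sym[OF \<Phi>_vf D_vf[OF \<Phi>_vf \<Phi>_vf], of y x z] by (simp add: f_def)
  qed
  have f_J: "f q x (j y) (j z) = f q x y z" for q x y z
    unfolding f_def \<Phi>_j DJ[OF \<Phi>_vf \<Phi>_vf] g_J[OF D_vf[OF \<Phi>_vf \<Phi>_vf] \<Phi>_vf] ..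
  have f_neg: "f q x y (- z) = - f q x y z" for q x y z
    by (simp add: f_def \<Phi>_simps g_minus_right D_vf \<Phi>_vf)
  have f_torsion: "f q x y z - f q y x z - br x y \<bullet> z = - (f q x z y - f q z x y - br x z \<bullet> y)" for q x y z
  proof -
    have t: "g (torsion D (\<Phi> x) (\<Phi> y)) (\<Phi> z) q = f q x y z - f q y x z - br x y \<bullet> z" for x y z
      unfolding torsion_def \<Phi>_br[symmetric]
      by (simp add: g_diff_left D_vf \<Phi>_vf vector_fields_diff g_\<Phi> f_def)
    show ?thesis
      using fun_cong[OF tor[OF \<Phi>_vf \<Phi>_vf \<Phi>_vf, of x y z], of q] by (simp add: t)
  qed
  have "f p x y z - f one x y z = 0" for x y z
  proof (rule strominger_form_unique[where F = "\<lambda>x y z. f p x y z - f one x y z" and j = j])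
    show "f p x y z - f one x y z = - (f p x z y - f one x z y)" for x y z
      using f_skew[of p x y z] f_skew[of one x y z] by simp
    show "f p x y z - f one x y z - (f p y x z - f one y x z)
        = - (f p x z y - f one x z y - (f p z x y - f one z x y))" for x y z
      using f_torsion[of p x y z] f_torsion[of one x y z] by simp
  qed (simp_all add: f_J f_neg H.JJ)
  then show "g (D (\<Phi> x) (\<Phi> y)) (\<Phi> b) p = g (D (\<Phi> x) (\<Phi> y)) (\<Phi> b) one" by (simp add: f_def)
qed

lemma skl_algebra_exists:
  assumes "nilpotent_lie_group A mul" and "strominger_kahler_like A J g"
  shows "\<exists>nb. nilpotent_skl_algebra br j nb"
proof -
  obtain D where D: "strominger_connection A J g D" and K: "kahler_like A J g D"
    using assms(2) by (auto simp: strominger_kahler_like_def)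
  have DJ: "\<And>X Y. X \<in> VF \<Longrightarrow> Y \<in> VF \<Longrightarrow> D X (J Y) = J (D X Y)"
    and tor: "\<And>X Y Z. X \<in> VF \<Longrightarrow> Y \<in> VF \<Longrightarrow> Z \<in> VF \<Longrightarrow> g (torsion D X Y) Z = - g (torsion D X Z) Y"
    and mc: "metric_connection A g D"
    using D unfolding strominger_connection_def by blast+
  have D_add: "\<And>X Y Z. X \<in> VF \<Longrightarrow> Y \<in> VF \<Longrightarrow> Z \<in> VF \<Longrightarrow> D (X + Y) Z = D X Z + D Y Z \<and> D X (Y + Z) = D X Y + D X Z"
    and D_fscale: "\<And>f X Y. f \<in> SF \<Longrightarrow> X \<in> VF \<Longrightarrow> Y \<in> VF \<Longrightarrow> D (fscale f X) Y = fscale f (D X Y) \<and>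
        D X (fscale f Y) = fscale (X f) Y + fscale f (D X Y)"
    and D_metric: "\<And>X Y Z. X \<in> VF \<Longrightarrow> Y \<in> VF \<Longrightarrow> Z \<in> VF \<Longrightarrow> X (g Y Z) = g (D X Y) Z + g Y (D X Z)"
    using mc unfolding metric_connection_def connection_def by blast+
  define nb where "nb x y = \<Psi> (D (\<Phi> x) (\<Phi> y))" for x y
  have \<Phi>_nb: "\<Phi> (nb x y) = D (\<Phi> x) (\<Phi> y)" for x y
    unfolding nb_def by (rule \<Phi>_\<Psi>[OF strominger_connection_left_invariant[OF D]])
  have D_scaleR: "D (c *\<^sub>R \<Phi> x) (\<Phi> y) = c *\<^sub>R D (\<Phi> x) (\<Phi> y)" "D (\<Phi> x) (c *\<^sub>R \<Phi> y) = c *\<^sub>R D (\<Phi> x) (\<Phi> y)" for c x y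
  proof -
    have z: "fscale 0 (\<Phi> y) = 0" by (simp add: fscale_def fun_eq_iff)
    show "D (c *\<^sub>R \<Phi> x) (\<Phi> y) = c *\<^sub>R D (\<Phi> x) (\<Phi> y)" "D (\<Phi> x) (c *\<^sub>R \<Phi> y) = c *\<^sub>R D (\<Phi> x) (\<Phi> y)"
      using D_fscale[OF smooth_functions_const \<Phi>_vf \<Phi>_vf, of c x y] unfolding fscale_const \<Phi>_const z by simp_all
  qed
  have bil: "bilinear nb"
    unfolding bilinear_def
  proof (intro conjI allI)
    show "linear (nb x)" for x
      by (rule linearI; unfold \<Phi>_eq_iff[symmetric] \<Phi>_simps \<Phi>_nb) (simp_all add: D_add D_scaleR \<Phi>_vf)
    show "linear (\<lambda>x. nb x y)" for y
      by (rule linearI; unfold \<Phi>_eq_iff[symmetric] \<Phi>_simps \<Phi>_nb) (simp_all add: D_add D_scaleR \<Phi>_vf)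
  qed
  have skew: "nb x y \<bullet> w = - (y \<bullet> nb x w)" for x y w
  proof -
    have "(\<Phi> x) (g (\<Phi> y) (\<Phi> w)) = g (\<Phi> (nb x y)) (\<Phi> w) + g (\<Phi> y) (\<Phi> (nb x w))"
      using D_metric[OF \<Phi>_vf \<Phi>_vf \<Phi>_vf] by (simp only: \<Phi>_nb)
    then have "0 = (\<lambda>_ :: 'm. nb x y \<bullet> w) + (\<lambda>_. y \<bullet> nb x w)" unfolding g_\<Phi> \<Phi>_const .
    from fun_cong[OF this, of one] show ?thesis by simp
  qed
  have Jc: "nb x (j y) = j (nb x y)" for x y
    unfolding \<Phi>_eq_iff[symmetric] \<Phi>_nb \<Phi>_j by (rule DJ[OF \<Phi>_vf \<Phi>_vf])
  have torsion: "(nb x y - nb y x - br x y) \<bullet> w = - ((nb x w - nb w x - br x w) \<bullet> y)" for x y w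
  proof -
    have t: "torsion D (\<Phi> x) (\<Phi> y) = \<Phi> (nb x y - nb y x - br x y)" for x y
      by (simp add: torsion_def \<Phi>_simps \<Phi>_nb \<Phi>_br)
    show ?thesis
      using fun_cong[OF tor[OF \<Phi>_vf \<Phi>_vf \<Phi>_vf, of x y w], of one] unfolding t g_\<Phi> by simp
  qed
  define R where "R x y z = nb x (nb y z) - nb y (nb x z) - nb (br x y) z" for x y z
  have curv: "curvature g D (\<Phi> x) (\<Phi> y) (\<Phi> z) (\<Phi> w) = (\<lambda>_. R x y z \<bullet> w)" for x y z w
    unfolding curvature_def R_def g_\<Phi>[symmetric] by (simp add: \<Phi>_simps \<Phi>_nb \<Phi>_br)
  have bianchi: "R x y z + R y z x + R z x y = 0" for x y z
  proof -
    have "(R x y z + R y z x + R z x y) \<bullet> w = 0" for w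
    proof -
      have "curvature g D (\<Phi> x) (\<Phi> y) (\<Phi> z) (\<Phi> w) + curvature g D (\<Phi> y) (\<Phi> z) (\<Phi> x) (\<Phi> w)
          + curvature g D (\<Phi> z) (\<Phi> x) (\<Phi> y) (\<Phi> w) = 0"
        using K \<Phi>_vf unfolding kahler_like_def by blast
      from fun_cong[OF this, of one] show ?thesis by (simp add: curv inner_add_left)
    qed
    then show ?thesis by (metis inner_eq_zero_iff)
  qed
  have nil: "\<exists>K. descending_series br K = {0}"
  proof -
    obtain k where "lower_central L k = {0}" using assms(1) by (auto simp: nilpotent_lie_group_def)
    then have "\<Phi> ` descending_series br k = \<Phi> ` {0}" by (simp add: lower_central_\<Phi> \<Phi>_simps)
    then have "descending_series br k = {0}" unfolding inj_image_eq_iff[OF inj_\<Phi>] .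
    then show ?thesis by blast
  qed
  have "nilpotent_skl_algebra br j nb"
    by (intro nilpotent_skl_algebra.intro H.hermitian_lie_algebra_axioms nilpotent_skl_algebra_axioms.intro
        bil skew Jc torsion bianchi[unfolded R_def] nil)
  then show ?thesis by blast
qed

end

section \<open>Extending an algebraic connection to the manifold\<close>

lemma fscale_simps:
  "fscale (f + h) X = fscale f X + fscale h X" "fscale f (X + Y) = fscale f X + fscale f Y"
  "fscale (f * h) X = fscale f (fscale h X)" "fscale f (- X) = - fscale f X" "fscale f (X - Y) = fscale f X - fscale f Y"
  "fscale 0 X = 0" "fscale f 0 = 0" "fscale f X k = f * X k"
  by (simp_all add: fscale_def fun_eq_iff algebra_simps)

lemma fscale_sum: "fscale f (\<Sum>i\<in>I. X i) = (\<Sum>i\<in>I. fscale f (X i))"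
  by (induction I rule: infinite_finite_induct)
    (simp_all only: sum.infinite sum.empty sum.insert fscale_simps(2,7) simp_thms)

context lie_hermitian_manifold
begin

text \<open>
A function-linear map is determined by its values on the frame of left invariant fields.
\<close>
lemma tensorial_eq_0:
  assumes add: "\<And>X Y. X \<in> VF \<Longrightarrow> Y \<in> VF \<Longrightarrow> F (X + Y) = F X + (F Y :: 'm \<Rightarrow> real)"
    and scale: "\<And>f X. f \<in> SF \<Longrightarrow> X \<in> VF \<Longrightarrow> F (fscale f X) = f * F X"
    and zero: "\<And>b. F (\<Phi> b) = 0" and V: "V \<in> VF"
  shows "F V = 0"
proof -
  have F0: "F 0 = 0" using add[OF vector_fields_zero vector_fields_zero] by simp
  have "F (\<Sum>b\<in>I. fscale (g V (\<Phi> b)) (\<Phi> b)) = 0" for I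
  proof (induction I rule: infinite_finite_induct)
    case (insert b I)
    have "F (fscale (g V (\<Phi> b)) (\<Phi> b) + (\<Sum>b\<in>I. fscale (g V (\<Phi> b)) (\<Phi> b))) =
        F (fscale (g V (\<Phi> b)) (\<Phi> b)) + F (\<Sum>b\<in>I. fscale (g V (\<Phi> b)) (\<Phi> b))"
      by (intro add vector_fields_sum vector_fields_fscale \<Phi>_vf g_smooth V)
    also have "F (fscale (g V (\<Phi> b)) (\<Phi> b)) = 0"
      unfolding scale[OF g_smooth[OF V \<Phi>_vf] \<Phi>_vf] zero by simp
    finally show ?case using insert(3) by (simp only: sum.insert[OF insert(1,2)] add_0)
  qed (simp_all only: sum.infinite sum.empty F0 simp_thms)
  then show ?thesis using frame_expansion[OF V] by metis
qed

lemma tensorial3_eq_0: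
  assumes add1: "\<And>X X' Y Z. X \<in> VF \<Longrightarrow> X' \<in> VF \<Longrightarrow> Y \<in> VF \<Longrightarrow> Z \<in> VF \<Longrightarrow> F (X + X') Y Z = F X Y Z + (F X' Y Z :: 'm \<Rightarrow> real)"
    and scale1: "\<And>f X Y Z. f \<in> SF \<Longrightarrow> X \<in> VF \<Longrightarrow> Y \<in> VF \<Longrightarrow> Z \<in> VF \<Longrightarrow> F (fscale f X) Y Z = f * F X Y Z"
    and add2: "\<And>X Y Y' Z. X \<in> VF \<Longrightarrow> Y \<in> VF \<Longrightarrow> Y' \<in> VF \<Longrightarrow> Z \<in> VF \<Longrightarrow> F X (Y + Y') Z = F X Y Z + F X Y' Z"
    and scale2: "\<And>f X Y Z. f \<in> SF \<Longrightarrow> X \<in> VF \<Longrightarrow> Y \<in> VF \<Longrightarrow> Z \<in> VF \<Longrightarrow> F X (fscale f Y) Z = f * F X Y Z"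
    and add3: "\<And>X Y Z Z'. X \<in> VF \<Longrightarrow> Y \<in> VF \<Longrightarrow> Z \<in> VF \<Longrightarrow> Z' \<in> VF \<Longrightarrow> F X Y (Z + Z') = F X Y Z + F X Y Z'"
    and scale3: "\<And>f X Y Z. f \<in> SF \<Longrightarrow> X \<in> VF \<Longrightarrow> Y \<in> VF \<Longrightarrow> Z \<in> VF \<Longrightarrow> F X Y (fscale f Z) = f * F X Y Z"
    and zero: "\<And>a b c. F (\<Phi> a) (\<Phi> b) (\<Phi> c) = 0"
    and V: "X \<in> VF" "Y \<in> VF" "Z \<in> VF"
  shows "F X Y Z = 0"
proof -
  have 1: "F X (\<Phi> b) (\<Phi> c) = 0" if "X \<in> VF" for X b c
    by (rule tensorial_eq_0[of "\<lambda>X. F X (\<Phi> b) (\<Phi> c)"])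
      (simp_all only: add1 scale1 zero \<Phi>_vf that)
  have 2: "F X Y (\<Phi> c) = 0" if "X \<in> VF" "Y \<in> VF" for X Y c
    by (rule tensorial_eq_0[of "\<lambda>Y. F X Y (\<Phi> c)"])
      (simp_all only: add2 scale2 1 \<Phi>_vf that)
  show ?thesis
    by (rule tensorial_eq_0[of "\<lambda>Z. F X Y Z"])
      (simp_all only: add3 scale3 2 \<Phi>_vf V)
qed

text \<open>
For a cyclically symmetric expression, tensoriality in the first argument suffices.
\<close>
lemma tensorial_cyclic_eq_0:
  assumes add: "\<And>X X' Y Z. X \<in> VF \<Longrightarrow> X' \<in> VF \<Longrightarrow> Y \<in> VF \<Longrightarrow> Z \<in> VF \<Longrightarrow> F (X + X') Y Z = F X Y Z + (F X' Y Z :: 'm \<Rightarrow> real)"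
    and scale: "\<And>f X Y Z. f \<in> SF \<Longrightarrow> X \<in> VF \<Longrightarrow> Y \<in> VF \<Longrightarrow> Z \<in> VF \<Longrightarrow> F (fscale f X) Y Z = f * F X Y Z"
    and cyc: "\<And>X Y Z. X \<in> VF \<Longrightarrow> Y \<in> VF \<Longrightarrow> Z \<in> VF \<Longrightarrow> F X Y Z = F Y Z X"
    and zero: "\<And>a b c. F (\<Phi> a) (\<Phi> b) (\<Phi> c) = 0"
    and V: "X \<in> VF" "Y \<in> VF" "Z \<in> VF"
  shows "F X Y Z = 0"
proof -
  have 1: "F X (\<Phi> b) (\<Phi> c) = 0" if "X \<in> VF" for X b c
    by (rule tensorial_eq_0[of "\<lambda>X. F X (\<Phi> b) (\<Phi> c)"]) (simp_all only: add scale zero \<Phi>_vf that)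
  have one_step: "F (\<Phi> b) (\<Phi> c) X = 0" if "X \<in> VF" for X b c
    using 1[OF that] cyc[OF that \<Phi>_vf \<Phi>_vf] by metis
  have 2: "F Y (\<Phi> c) X = 0" if "X \<in> VF" "Y \<in> VF" for X Y c
    by (rule tensorial_eq_0[of "\<lambda>Y. F Y (\<Phi> c) X"]) (simp_all only: add scale one_step \<Phi>_vf that)
  have two_step': "F (\<Phi> c) X Y = 0" if "X \<in> VF" "Y \<in> VF" for X Y c
    using 2[OF that] cyc[OF that(2) \<Phi>_vf that(1)] by metis
  show ?thesis
    by (rule tensorial_eq_0[of "\<lambda>X. F X Y Z"]) (simp_all only: add scale two_step' \<Phi>_vf V)
qed

text \<open>
Closedness of the fundamental form is a tensorial condition, so it can be tested on left invariant fields, where the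
derivatives of the constants \<open>g (J X) Y\<close> drop out.
\<close>
lemma kahler_iff_left_invariant:
  "kahler A J g \<longleftrightarrow> (\<forall>x y z. j (br x y) \<bullet> z + j (br y z) \<bullet> x + j (br z x) \<bullet> y = 0)"
proof -
  define K where "K X Y Z = X (g (J Y) Z) + Y (g (J Z) X) + Z (g (J X) Y)
        - g (J (lie_bracket X Y)) Z - g (J (lie_bracket Y Z)) X - g (J (lie_bracket Z X)) Y" for X Y Z
  have K_eq: "K (\<Phi> x) (\<Phi> y) (\<Phi> z) = (\<lambda>_. - (j (br x y) \<bullet> z + j (br y z) \<bullet> x + j (br z x) \<bullet> y))" for x y z
    unfolding K_def \<Phi>_br[symmetric] \<Phi>_j[symmetric] g_\<Phi> \<Phi>_const by (simp add: fun_eq_iff)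
  have g_J_skew: "g (J X) Y = - g (J Y) X" if "X \<in> VF" "Y \<in> VF" for X Y
    using g_J[OF that(1) J_vf[OF that(2)]] g_minus_right[OF that(2) J_vf[OF that(1)]] J_J[OF that(2)]
      g_sym[OF that(1) J_vf[OF that(2)]] by (metis minus_minus)
  have "K X Y Z = 0" if "\<forall>x y z. j (br x y) \<bullet> z + j (br y z) \<bullet> x + j (br z x) \<bullet> y = 0"
    "X \<in> VF" "Y \<in> VF" "Z \<in> VF" for X Y Z
  proof (rule tensorial_cyclic_eq_0[of K])
    fix X X' Y Z f assume v: "X \<in> VF" "X' \<in> VF" "Y \<in> VF" "Z \<in> VF"
    have br: "lie_bracket Z (X + X') = lie_bracket Z X + lie_bracket Z X'"
      using bracket_add_left[OF v(1,2,4)] bracket_skew[of Z] by (metis add_uminus_conv_diff minus_add_distrib)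
    show "K (X + X') Y Z = K X Y Z + K X' Y Z"
      unfolding K_def br bracket_add_left[OF v(1,2,3)]
      by (simp add: v J_add J_vf g_add_left g_add_right vector_fields_bracket vector_fields_add g_smooth
          vector_field_add algebra_simps del: plus_fun_apply)
        (simp add: algebra_simps)
  next
    fix f X Y Z assume f: "f \<in> SF" and v: "X \<in> VF" "Y \<in> VF" "Z \<in> VF"
    have br: "lie_bracket Z (fscale f X) = fscale f (lie_bracket Z X) + fscale (Z f) X"
    proof -
      have "lie_bracket Z (fscale f X) = - (fscale f (lie_bracket X Z) - fscale (Z f) X)"
        using bracket_skew[of Z "fscale f X"] bracket_fscale_left[OF f v(1,3)] by simp
      also have "\<dots> = fscale f (- lie_bracket X Z) + fscale (Z f) X" by (simp add: fscale_simps)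
      finally show ?thesis using bracket_skew[of Z X] by simp
    qed
    have s: "g (J (fscale f (lie_bracket X Y) - fscale (Y f) X)) Z = f * g (J (lie_bracket X Y)) Z - Y f * g (J X) Z"
      "g (J (fscale f (lie_bracket Z X) + fscale (Z f) X)) Y = f * g (J (lie_bracket Z X)) Y + Z f * g (J X) Y"
    proof -
      have vf: "lie_bracket X Y \<in> VF" "lie_bracket Z X \<in> VF" "Y f \<in> SF" "Z f \<in> SF"
        using v f by (auto simp: vector_fields_bracket vector_field_smooth)
      have eq: "fscale f (lie_bracket X Y) - fscale (Y f) X = fscale f (lie_bracket X Y) + fscale (- Y f) X"
        by (simp add: fscale_def fun_eq_iff)
      note c = smooth_functions_uminus[OF vf(3)]
      show "g (J (fscale f (lie_bracket X Y) - fscale (Y f) X)) Z = f * g (J (lie_bracket X Y)) Z - Y f * g (J X) Z"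
        unfolding eq J_add[OF vector_fields_fscale[OF vf(1) f] vector_fields_fscale[OF v(1) c]]
          J_fscale[OF f vf(1)] J_fscale[OF c v(1)]
          g_add_left[OF vector_fields_fscale[OF J_vf[OF vf(1)] f] vector_fields_fscale[OF J_vf[OF v(1)] c] v(3)]
          g_fscale_left[OF f J_vf[OF vf(1)] v(3)] g_fscale_left[OF c J_vf[OF v(1)] v(3)]
        by (simp add: fun_eq_iff)
      show "g (J (fscale f (lie_bracket Z X) + fscale (Z f) X)) Y = f * g (J (lie_bracket Z X)) Y + Z f * g (J X) Y"
        using vf v f by (simp add: J_add J_fscale J_vf vector_fields_fscale g_add_left g_fscale_left)
    qed
    have m: "Y (f * g (J Z) X) = f * Y (g (J Z) X) + g (J Z) X * Y f"
      "Z (f * g (J X) Y) = f * Z (g (J X) Y) + g (J X) Y * Z f"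
      using v f by (simp_all add: vector_field_mult g_smooth J_vf fun_eq_iff)
    show "K (fscale f X) Y Z = f * K X Y Z"
      unfolding K_def bracket_fscale_left[OF f v(1,2)] br s J_fscale[OF f v(1)]
        g_fscale_left[OF f J_vf[OF v(1)] v(2)] g_fscale_right[OF f v(1) J_vf[OF v(3)]]
        g_fscale_right[OF f v(1) J_vf[OF vector_fields_bracket[OF v(2,3)]]] m fscale_simps(8)
        g_J_skew[OF v(1,3)]
      by (simp add: fun_eq_iff algebra_simps)
  next
    show "K X Y Z = K Y Z X" for X Y Z by (simp add: K_def algebra_simps)
    show "K (\<Phi> a) (\<Phi> b) (\<Phi> c) = 0" for a b c using that(1) by (simp add: K_eq fun_eq_iff)
  qed (use that in auto)
  moreover have "j (br x y) \<bullet> z + j (br y z) \<bullet> x + j (br z x) \<bullet> y = 0" if "K (\<Phi> x) (\<Phi> y) (\<Phi> z) = 0" for x y z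
    using fun_cong[OF that[unfolded K_eq], of one] by simp
  ultimately show ?thesis
    unfolding kahler_def K_def[symmetric] using hermitian \<Phi>_vf by blast
qed

end

text \<open>
An algebraic solution \<open>nb\<close> of the Kaehler-like Strominger equations on the Lie algebra, to be extended to a connection
on the manifold.
\<close>
locale left_invariant_connection = lie_hermitian_manifold A mul one ginv J g n
  for A :: "('m::{t2_space, second_countable_topology}, 'e::euclidean_space) chart set"
    and mul :: "'m \<Rightarrow> 'm \<Rightarrow> 'm" and one :: 'm and ginv :: "'m \<Rightarrow> 'm" and J g n +
  fixes nb :: "'e \<Rightarrow> 'e \<Rightarrow> 'e"
  assumes nb_bilinear: "bilinear nb"
    and nb_skew: "nb x y \<bullet> w = - (y \<bullet> nb x w)"
    and nb_J: "nb x (j y) = j (nb x y)"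
    and torsion_skew: "(nb x y - nb y x - br x y) \<bullet> w = - ((nb x w - nb w x - br x w) \<bullet> y)"
    and bianchi: "nb x (nb y z) - nb y (nb x z) - nb (br x y) z
      + (nb y (nb z x) - nb z (nb y x) - nb (br y z) x)
      + (nb z (nb x y) - nb x (nb z y) - nb (br z x) y) = 0"
begin

text \<open>
The connection with prescribed values on the left invariant frame: differentiate the components of \<open>Y\<close> and add
the \<open>nb\<close>-term.
\<close>
definition D :: "'m vfield \<Rightarrow> 'm vfield \<Rightarrow> 'm vfield" where
  "D X Y = (\<Sum>b\<in>Basis. fscale (X (g Y (\<Phi> b))) (\<Phi> b))
     + (\<Sum>a\<in>Basis. \<Sum>b\<in>Basis. fscale (g X (\<Phi> a) * g Y (\<Phi> b)) (\<Phi> (nb a b)))"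

lemma D_vf:
  assumes X: "X \<in> VF" and Y: "Y \<in> VF"
  shows "D X Y \<in> VF"
proof -
  have "fscale (X (g Y (\<Phi> b))) (\<Phi> b) \<in> VF" for b
    by (rule vector_fields_fscale[OF \<Phi>_vf vector_field_smooth[OF X g_smooth[OF Y \<Phi>_vf]]])
  moreover have "fscale (g X (\<Phi> a) * g Y (\<Phi> b)) (\<Phi> (nb a b)) \<in> VF" for a b
    by (rule vector_fields_fscale[OF \<Phi>_vf smooth_functions_mult[OF g_smooth[OF X \<Phi>_vf] g_smooth[OF Y \<Phi>_vf]]])
  ultimately show ?thesis
    unfolding D_def by (intro vector_fields_add vector_fields_sum) simp_all
qed

lemma D_add_left: "X \<in> VF \<Longrightarrow> Y \<in> VF \<Longrightarrow> Z \<in> VF \<Longrightarrow> D (X + Y) Z = D X Z + D Y Z"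
  by (simp add: D_def g_add_left \<Phi>_vf distrib_right fscale_simps sum.distrib del: fscale_simps(8))

lemma D_add_right: "X \<in> VF \<Longrightarrow> Y \<in> VF \<Longrightarrow> Z \<in> VF \<Longrightarrow> D X (Y + Z) = D X Y + D X Z"
  by (simp add: D_def g_add_left \<Phi>_vf g_smooth vector_field_add distrib_left fscale_simps sum.distrib
      del: fscale_simps(8) plus_fun_apply)

lemma D_fscale_left: "f \<in> SF \<Longrightarrow> X \<in> VF \<Longrightarrow> Y \<in> VF \<Longrightarrow> D (fscale f X) Y = fscale f (D X Y)"
  by (simp add: D_def g_fscale_left \<Phi>_vf mult.assoc fscale_simps fscale_sum)

lemma D_fscale_right:
  assumes f: "f \<in> SF" and X: "X \<in> VF" and Y: "Y \<in> VF"
  shows "D X (fscale f Y) = fscale (X f) Y + fscale f (D X Y)"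
proof -
  have 1: "X (f * g Y (\<Phi> b)) = f * X (g Y (\<Phi> b)) + X f * g Y (\<Phi> b)" for b
    using vector_field_mult[OF X f g_smooth[OF Y \<Phi>_vf]] by (simp add: mult.commute)
  have 2: "g X a * (f * h) = f * (g X a * h)" for a h by (simp add: mult.left_commute)
  have "fscale (X f) Y = fscale (X f) (\<Sum>b\<in>Basis. fscale (g Y (\<Phi> b)) (\<Phi> b))"
    using frame_expansion[OF Y] by metis
  then have 3: "fscale (X f) Y = (\<Sum>b\<in>Basis. fscale (X f * g Y (\<Phi> b)) (\<Phi> b))"
    by (simp only: fscale_sum fscale_simps(3))
  show ?thesis
    unfolding 3 D_def g_fscale_left[OF f Y \<Phi>_vf] 1 2 fscale_simps(1,2) sum.distrib fscale_sum fscale_simps(3)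
    by (simp only: add_ac)
qed

lemma D_\<Phi>: "D (\<Phi> x) (\<Phi> y) = \<Phi> (nb x y)"
proof -
  have z: "fscale (\<Phi> x (\<lambda>_. c)) X = 0" for c X by (simp add: \<Phi>_const fscale_simps(6))
  have "D (\<Phi> x) (\<Phi> y) = (\<Sum>a\<in>Basis. \<Sum>b\<in>Basis. ((x \<bullet> a) * (y \<bullet> b)) *\<^sub>R \<Phi> (nb a b))"
  proof -
    have "(\<lambda>_ :: 'm. x \<bullet> a) * (\<lambda>_. y \<bullet> b) = (\<lambda>_. (x \<bullet> a) * (y \<bullet> b))" for a b by (simp add: fun_eq_iff)
    then show ?thesis by (simp only: D_def g_\<Phi> z fscale_const sum.neutral_const add_0)
  qed
  also have "\<dots> = \<Phi> (\<Sum>a\<in>Basis. \<Sum>b\<in>Basis. ((x \<bullet> a) * (y \<bullet> b)) *\<^sub>R nb a b)"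
    by (simp only: \<Phi>_simps)
  also have "(\<Sum>a\<in>Basis. \<Sum>b\<in>Basis. ((x \<bullet> a) * (y \<bullet> b)) *\<^sub>R nb a b) = nb x y"
  proof -
    have lin: "linear (nb a)" "linear (\<lambda>x. nb x y)" for a y using nb_bilinear by (auto simp: bilinear_def)
    have "nb x y = nb (\<Sum>a\<in>Basis. (x \<bullet> a) *\<^sub>R a) y" by (simp only: euclidean_representation)
    also have "\<dots> = (\<Sum>a\<in>Basis. (x \<bullet> a) *\<^sub>R nb a y)"
      by (simp only: linear_sum[OF lin(2)] linear_scale[OF lin(2)])
    also have "\<dots> = (\<Sum>a\<in>Basis. (x \<bullet> a) *\<^sub>R nb a (\<Sum>b\<in>Basis. (y \<bullet> b) *\<^sub>R b))"
      by (simp only: euclidean_representation)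
    also have "\<dots> = (\<Sum>a\<in>Basis. \<Sum>b\<in>Basis. ((x \<bullet> a) * (y \<bullet> b)) *\<^sub>R nb a b)"
      by (simp only: linear_sum[OF lin(1)] linear_scale[OF lin(1)] scaleR_sum_right scaleR_scaleR)
    finally show ?thesis by simp
  qed
  finally show ?thesis .
qed

lemma D_connection: "connection A D"
  unfolding connection_def using D_vf D_add_left D_add_right D_fscale_left D_fscale_right by blast

lemma D_metric:
  assumes "X \<in> VF" "Y \<in> VF" "Z \<in> VF"
  shows "X (g Y Z) = g (D X Y) Z + g Y (D X Z)"
proof -
  define M where "M X Y Z = X (g Y Z) - (g (D X Y) Z + g Y (D X Z))" for X Y Z
  have M_sym: "M X Y Z = M X Z Y" if "X \<in> VF" "Y \<in> VF" "Z \<in> VF" for X Y Z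
    using g_sym[OF that(2,3)] g_sym[OF D_vf[OF that(1,2)] that(3)] g_sym[OF that(2) D_vf[OF that(1,3)]]
    by (simp only: M_def add.commute)
  have add2: "M X (Y + Y') Z = M X Y Z + M X Y' Z" if v: "X \<in> VF" "Y \<in> VF" "Y' \<in> VF" "Z \<in> VF" for X Y Y' Z
    unfolding M_def D_add_right[OF v(1,2,3)] g_add_left[OF v(2,3,4)] g_add_left[OF v(2,3) D_vf[OF v(1,4)]]
      g_add_left[OF D_vf[OF v(1,2)] D_vf[OF v(1,3)] v(4)] vector_field_add[OF v(1) g_smooth[OF v(2,4)] g_smooth[OF v(3,4)]]
    by (simp only: algebra_simps)
  have scale2: "M X (fscale f Y) Z = f * M X Y Z" if f: "f \<in> SF" and v: "X \<in> VF" "Y \<in> VF" "Z \<in> VF" for f X Y Z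
    unfolding M_def D_fscale_right[OF f v(1,2)] g_fscale_left[OF f v(2,3)] g_fscale_left[OF f v(2) D_vf[OF v(1,3)]]
      g_add_left[OF vector_fields_fscale[OF v(2) vector_field_smooth[OF v(1) f]] vector_fields_fscale[OF D_vf[OF v(1,2)] f] v(3)]
      g_fscale_left[OF vector_field_smooth[OF v(1) f] v(2,3)] g_fscale_left[OF f D_vf[OF v(1,2)] v(3)]
      vector_field_mult[OF v(1) f g_smooth[OF v(2,3)]]
    by (simp add: fun_eq_iff algebra_simps)
  have "M X Y Z = 0"
  proof (rule tensorial3_eq_0[of M])
    show "M (X + X') Y Z = M X Y Z + M X' Y Z" if v: "X \<in> VF" "X' \<in> VF" "Y \<in> VF" "Z \<in> VF" for X X' Y Z
      unfolding M_def D_add_left[OF v(1,2,3)] D_add_left[OF v(1,2,4)] plus_fun_apply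
        g_add_left[OF D_vf[OF v(1,3)] D_vf[OF v(2,3)] v(4)] g_add_right[OF D_vf[OF v(1,4)] D_vf[OF v(2,4)] v(3)]
      by (simp add: fun_eq_iff algebra_simps)
    show "M (fscale f X) Y Z = f * M X Y Z" if f: "f \<in> SF" and v: "X \<in> VF" "Y \<in> VF" "Z \<in> VF" for f X Y Z
      unfolding M_def D_fscale_left[OF f v(1,2)] D_fscale_left[OF f v(1,3)] fscale_simps(8)
        g_fscale_left[OF f D_vf[OF v(1,2)] v(3)] g_fscale_right[OF f D_vf[OF v(1,3)] v(2)]
      by (simp only: algebra_simps)
    show "M X Y (Z + Z') = M X Y Z + M X Y Z'" if v: "X \<in> VF" "Y \<in> VF" "Z \<in> VF" "Z' \<in> VF" for X Y Z Z'
      using add2[OF v(1,3,4,2)] M_sym[OF v(1,2) vector_fields_add[OF v(3,4)]] M_sym[OF v(1,2,3)] M_sym[OF v(1,2,4)] by simp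
    show "M X Y (fscale f Z) = f * M X Y Z" if f: "f \<in> SF" and v: "X \<in> VF" "Y \<in> VF" "Z \<in> VF" for f X Y Z
      using scale2[OF f v(1,3,2)] M_sym[OF v(1,2) vector_fields_fscale[OF v(3) f]] M_sym[OF v] by simp
    show "M (\<Phi> a) (\<Phi> b) (\<Phi> c) = 0" for a b c
      using nb_skew[of a b c] by (simp add: M_def D_\<Phi> g_\<Phi> \<Phi>_const fun_eq_iff)
  qed (use assms add2 scale2 in auto)
  then show ?thesis by (simp add: M_def)
qed

lemma D_J:
  assumes "X \<in> VF" "Y \<in> VF"
  shows "D X (J Y) = J (D X Y)"
proof (rule frame_eqI)
  fix c :: 'e
  define N where "N X Y = g (D X (J Y)) (\<Phi> c) - g (J (D X Y)) (\<Phi> c)" for X Y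
  note [simp] = J_vf D_vf \<Phi>_vf vector_fields_fscale vector_fields_add vector_field_smooth
  have "N X (\<Phi> b) = 0" if "X \<in> VF" for X b
  proof (rule tensorial_eq_0[of "\<lambda>X. N X (\<Phi> b)", OF _ _ _ that])
    show "N (X + Y) (\<Phi> b) = N X (\<Phi> b) + N Y (\<Phi> b)" if "X \<in> VF" "Y \<in> VF" for X Y
      using that by (simp only: N_def D_add_left J_add g_add_left J_vf D_vf \<Phi>_vf) (simp only: algebra_simps)
    show "N (fscale f X) (\<Phi> b) = f * N X (\<Phi> b)" if "f \<in> SF" "X \<in> VF" for f X
      using that by (simp only: N_def D_fscale_left J_fscale g_fscale_left J_vf D_vf \<Phi>_vf) (simp only: algebra_simps)
    show "N (\<Phi> a) (\<Phi> b) = 0" for a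
      by (simp only: N_def \<Phi>_j[symmetric] D_\<Phi> nb_J diff_self)
  qed
  then have "N X Y = 0"
  proof (intro tensorial_eq_0[of "\<lambda>Y. N X Y", OF _ _ _ assms(2)])
    show "N X (Y + Y') = N X Y + N X Y'" if "Y \<in> VF" "Y' \<in> VF" for Y Y'
      using that assms(1) by (simp only: N_def D_add_right J_add g_add_left J_vf D_vf \<Phi>_vf) (simp only: algebra_simps)
    show "N X (fscale f Y) = f * N X Y" if "f \<in> SF" "Y \<in> VF" for f Y
      using that assms(1)
      by (simp only: N_def D_fscale_right J_fscale J_add g_add_left g_fscale_left J_vf D_vf \<Phi>_vf
          vector_fields_fscale vector_field_smooth) (simp only: algebra_simps)
  qed (use assms in auto)
  then show "g (D X (J Y)) (\<Phi> c) = g (J (D X Y)) (\<Phi> c)" by (simp add: N_def)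
qed (use assms in \<open>simp_all add: D_vf J_vf\<close>)

lemma torsion_vf: "X \<in> VF \<Longrightarrow> Y \<in> VF \<Longrightarrow> torsion D X Y \<in> VF"
  unfolding torsion_def by (intro vector_fields_diff D_vf vector_fields_bracket)

lemma torsion_alt: "torsion D X Y = - torsion D Y X"
  using bracket_skew[of X Y] by (simp add: torsion_def)

lemma torsion_add: "X \<in> VF \<Longrightarrow> Y \<in> VF \<Longrightarrow> Z \<in> VF \<Longrightarrow> torsion D (X + Y) Z = torsion D X Z + torsion D Y Z"
  by (simp only: torsion_def D_add_left D_add_right bracket_add_left) (simp only: algebra_simps)

lemma torsion_fscale: "f \<in> SF \<Longrightarrow> X \<in> VF \<Longrightarrow> Y \<in> VF \<Longrightarrow> torsion D (fscale f X) Y = fscale f (torsion D X Y)"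
  by (simp only: torsion_def D_fscale_left D_fscale_right bracket_fscale_left fscale_simps(5)) (simp only: algebra_simps)

lemma torsion_add_right: "X \<in> VF \<Longrightarrow> Y \<in> VF \<Longrightarrow> Z \<in> VF \<Longrightarrow> torsion D Z (X + Y) = torsion D Z X + torsion D Z Y"
  using torsion_add[of X Y Z] torsion_alt[of Z] by simp

lemma torsion_fscale_right: "f \<in> SF \<Longrightarrow> X \<in> VF \<Longrightarrow> Y \<in> VF \<Longrightarrow> torsion D X (fscale f Y) = fscale f (torsion D X Y)"
  using torsion_fscale[of f Y X] torsion_alt[of X] by (simp add: fscale_simps(4))

lemma D_torsion_skew:
  assumes "X \<in> VF" "Y \<in> VF" "Z \<in> VF"
  shows "g (torsion D X Y) Z = - g (torsion D X Z) Y"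
proof -
  define S where "S X Y Z = g (torsion D X Y) Z + g (torsion D X Z) Y" for X Y Z
  have S_sym: "S X Y Z = S X Z Y" for X Y Z by (simp only: S_def add.commute)
  have add2: "S X (Y + Y') Z = S X Y Z + S X Y' Z" if v: "X \<in> VF" "Y \<in> VF" "Y' \<in> VF" "Z \<in> VF" for X Y Y' Z
    using v by (simp only: S_def torsion_add_right g_add_left g_add_right torsion_vf) (simp only: algebra_simps)
  have scale2: "S X (fscale f Y) Z = f * S X Y Z" if f: "f \<in> SF" and v: "X \<in> VF" "Y \<in> VF" "Z \<in> VF" for f X Y Z
    using v f by (simp only: S_def torsion_fscale_right g_fscale_left g_fscale_right torsion_vf) (simp only: algebra_simps)
  have "S X Y Z = 0"
  proof (rule tensorial3_eq_0[of S])
    show "S (X + X') Y Z = S X Y Z + S X' Y Z" if "X \<in> VF" "X' \<in> VF" "Y \<in> VF" "Z \<in> VF" for X X' Y Z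
      using that by (simp only: S_def torsion_add g_add_left torsion_vf) (simp only: algebra_simps)
    show "S (fscale f X) Y Z = f * S X Y Z" if "f \<in> SF" "X \<in> VF" "Y \<in> VF" "Z \<in> VF" for f X Y Z
      using that by (simp only: S_def torsion_fscale g_fscale_left torsion_vf) (simp only: algebra_simps)
    show "S X Y (Z + Z') = S X Y Z + S X Y Z'" if "X \<in> VF" "Y \<in> VF" "Z \<in> VF" "Z' \<in> VF" for X Y Z Z'
      unfolding S_sym[of X Y] by (rule add2[OF that(1,3,4,2)])
    show "S X Y (fscale f Z) = f * S X Y Z" if "f \<in> SF" "X \<in> VF" "Y \<in> VF" "Z \<in> VF" for f X Y Z
      unfolding S_sym[of X Y] by (rule scale2[OF that(1,2,4,3)])
    show "S (\<Phi> a) (\<Phi> b) (\<Phi> c) = 0" for a b c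
    proof -
      have t: "torsion D (\<Phi> x) (\<Phi> y) = \<Phi> (nb x y - nb y x - br x y)" for x y
        by (simp only: torsion_def \<Phi>_simps D_\<Phi> \<Phi>_br)
      show ?thesis using torsion_skew[of a b c] unfolding S_def t g_\<Phi> by (simp add: fun_eq_iff)
    qed
  qed (use assms add2 scale2 in auto)
  then show ?thesis by (simp add: S_def eq_neg_iff_add_eq_0)
qed

definition R where "R X Y Z = D X (D Y Z) - D Y (D X Z) - D (lie_bracket X Y) Z"

lemma R_vf: "X \<in> VF \<Longrightarrow> Y \<in> VF \<Longrightarrow> Z \<in> VF \<Longrightarrow> R X Y Z \<in> VF"
  unfolding R_def by (intro vector_fields_diff D_vf vector_fields_bracket)

lemma D_minus_left: "X \<in> VF \<Longrightarrow> Y \<in> VF \<Longrightarrow> D (- X) Y = - D X Y"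
  using D_add_left[OF _ vector_fields_uminus, of X X Y] D_add_left[of 0 0 Y] vector_fields_zero
  by (simp add: eq_neg_iff_add_eq_0 add.commute)

lemma R_alt: "X \<in> VF \<Longrightarrow> Y \<in> VF \<Longrightarrow> Z \<in> VF \<Longrightarrow> R X Y Z = - R Y X Z"
  using bracket_skew[of X Y] D_minus_left[of "lie_bracket Y X" Z] vector_fields_bracket by (simp add: R_def)

lemma R_add: "X \<in> VF \<Longrightarrow> X' \<in> VF \<Longrightarrow> Y \<in> VF \<Longrightarrow> Z \<in> VF \<Longrightarrow> R (X + X') Y Z = R X Y Z + R X' Y Z"
  by (simp only: R_def D_add_left D_add_right bracket_add_left D_vf vector_fields_bracket) (simp only: algebra_simps)

lemma R_fscale:
  assumes f: "f \<in> SF" and X: "X \<in> VF" and Y: "Y \<in> VF" and Z: "Z \<in> VF"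
  shows "R (fscale f X) Y Z = fscale f (R X Y Z)"
proof -
  have "D (fscale f (lie_bracket X Y) - fscale (Y f) X) Z = D (fscale f (lie_bracket X Y) + fscale (- Y f) X) Z"
    by (rule arg_cong[of _ _ "\<lambda>V. D V Z"]) (simp add: fscale_def fun_eq_iff)
  also have "\<dots> = fscale f (D (lie_bracket X Y) Z) + fscale (- Y f) (D X Z)"
    using assms smooth_functions_uminus[OF vector_field_smooth[OF Y f]]
    by (simp only: D_add_left D_fscale_left vector_fields_fscale vector_fields_bracket)
  also have "fscale (- Y f) (D X Z) = - fscale (Y f) (D X Z)" by (simp add: fscale_def fun_eq_iff)
  finally have b: "D (lie_bracket (fscale f X) Y) Z = fscale f (D (lie_bracket X Y) Z) - fscale (Y f) (D X Z)"
    by (simp only: bracket_fscale_left[OF f X Y] add_uminus_conv_diff)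
  have "R (fscale f X) Y Z = fscale f (D X (D Y Z)) - (fscale (Y f) (D X Z) + fscale f (D Y (D X Z)))
      - (fscale f (D (lie_bracket X Y) Z) - fscale (Y f) (D X Z))"
    unfolding R_def b using assms by (simp only: D_fscale_left D_fscale_right D_vf)
  then show ?thesis by (simp only: R_def fscale_simps(5)) (simp only: algebra_simps)
qed

lemma R_add3: "X \<in> VF \<Longrightarrow> Y \<in> VF \<Longrightarrow> Z \<in> VF \<Longrightarrow> Z' \<in> VF \<Longrightarrow> R X Y (Z + Z') = R X Y Z + R X Y Z'"
  by (simp only: R_def D_add_right D_vf vector_fields_bracket) (simp only: algebra_simps)

lemma R_fscale3:
  assumes f: "f \<in> SF" and X: "X \<in> VF" and Y: "Y \<in> VF" and Z: "Z \<in> VF"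
  shows "R X Y (fscale f Z) = fscale f (R X Y Z)"
proof -
  have 1: "D X (D Y (fscale f Z)) = (fscale (X (Y f)) Z + fscale (Y f) (D X Z)) + (fscale (X f) (D Y Z) + fscale f (D X (D Y Z)))"
    if "X \<in> VF" "Y \<in> VF" for X Y
    using that f Z by (simp only: D_fscale_right D_add_right D_vf vector_fields_fscale vector_field_smooth)
  have 2: "D (lie_bracket X Y) (fscale f Z) = fscale (X (Y f) - Y (X f)) Z + fscale f (D (lie_bracket X Y) Z)"
    using D_fscale_right[OF f vector_fields_bracket[OF X Y] Z] by (simp only: lie_bracket_def)
  have 3: "fscale (a - b) Z = fscale a Z - fscale b Z" for a b by (simp add: fscale_def fun_eq_iff algebra_simps)
  show ?thesis
    unfolding R_def 1[OF X Y] 1[OF Y X] 2 3 fscale_simps(5) by (simp only: algebra_simps)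
qed

text \<open>
The cyclic sum of the curvature is tensorial, and vanishes on left invariant fields by assumption.
\<close>
lemma R_bianchi:
  assumes "X \<in> VF" "Y \<in> VF" "Z \<in> VF" "V \<in> VF"
  shows "g (R X Y Z) V + g (R Y Z X) V + g (R Z X Y) V = 0"
proof -
  define b where "b X Y Z = g (R X Y Z) V + g (R Y Z X) V + g (R Z X Y) V" for X Y Z
  note V = assms(4)
  have gz: "g 0 W = 0" if "W \<in> VF" for W
    using g_add_left[OF vector_fields_zero vector_fields_zero that] by simp
  have "b X Y Z = 0"
  proof (rule tensorial_cyclic_eq_0[of b, OF _ _ _ _ assms(1-3)])
    fix X X' Y Z assume v: "X \<in> VF" "X' \<in> VF" "Y \<in> VF" "Z \<in> VF"
    have "R Z (X + X') Y = R Z X Y + R Z X' Y"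
      using R_add[OF v(1,2,4,3)] R_alt[OF v(4) vector_fields_add[OF v(1,2)] v(3)] R_alt[OF v(4,1,3)] R_alt[OF v(4,2,3)] by simp
    then show "b (X + X') Y Z = b X Y Z + b X' Y Z"
      unfolding b_def R_add[OF v] R_add3[OF v(3,4,1,2)]
      using v V by (simp only: g_add_left R_vf) (simp only: algebra_simps)
  next
    fix f X Y Z assume f: "f \<in> SF" and v: "X \<in> VF" "Y \<in> VF" "Z \<in> VF"
    have "R Z (fscale f X) Y = fscale f (R Z X Y)"
      using R_fscale[OF f v(1,3,2)] R_alt[OF v(3) vector_fields_fscale[OF v(1) f] v(2)] R_alt[OF v(3,1,2)]
      by (simp add: fscale_simps(4))
    then show "b (fscale f X) Y Z = f * b X Y Z"
      unfolding b_def R_fscale[OF f v] R_fscale3[OF f v(2,3,1)]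
      using v f V by (simp only: g_fscale_left R_vf) (simp only: algebra_simps)
  next
    show "b X Y Z = b Y Z X" for X Y Z by (simp only: b_def add_ac)
    fix x y z
    have R\<Phi>: "R (\<Phi> x) (\<Phi> y) (\<Phi> z) = \<Phi> (nb x (nb y z) - nb y (nb x z) - nb (br x y) z)" for x y z
      by (simp only: R_def D_\<Phi> \<Phi>_br[symmetric] \<Phi>_simps)
    have "R (\<Phi> x) (\<Phi> y) (\<Phi> z) + R (\<Phi> y) (\<Phi> z) (\<Phi> x) + R (\<Phi> z) (\<Phi> x) (\<Phi> y) = \<Phi> 0"
      unfolding R\<Phi> \<Phi>_simps(1)[symmetric] bianchi ..
    then have "R (\<Phi> x) (\<Phi> y) (\<Phi> z) + R (\<Phi> y) (\<Phi> z) (\<Phi> x) + R (\<Phi> z) (\<Phi> x) (\<Phi> y) = 0" by (simp only: \<Phi>_simps)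
    then show "b (\<Phi> x) (\<Phi> y) (\<Phi> z) = 0"
      using gz[OF V] unfolding b_def
      by (simp only: g_add_left[symmetric] R_vf \<Phi>_vf V vector_fields_add)
  qed
  then show ?thesis by (simp only: b_def)
qed

theorem strominger_kahler_like: "strominger_kahler_like A J g"
proof -
  have mc: "metric_connection A g D"
    unfolding metric_connection_def using D_connection D_metric by blast
  have "strominger_connection A J g D"
    unfolding strominger_connection_def using mc D_J D_torsion_skew by blast
  moreover have "kahler_like A J g D"
  proof -
    have curv: "curvature g D X Y Z W = g (R X Y Z) W" for X Y Z W
      by (simp only: curvature_def R_def)
    have RJ: "R X Y (J Z) = J (R X Y Z)" if "X \<in> VF" "Y \<in> VF" "Z \<in> VF" for X Y Z
    proof -
      have J_diff: "J (V - W) = J V - J W" if "V \<in> VF" "W \<in> VF" for V W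
        using J_add[OF that(1) vector_fields_uminus[OF that(2)]] J_scaleR[OF that(2), of "-1"] by simp
      show ?thesis
        using that by (simp only: R_def D_J D_vf vector_fields_bracket J_diff vector_fields_diff)
    qed
    show ?thesis
      unfolding kahler_like_def curv using mc R_bianchi RJ g_J R_vf by simp
  qed
  ultimately show ?thesis unfolding strominger_kahler_like_def by blast
qed

end

section \<open>The characterisation\<close>

context lie_hermitian_manifold
begin

lemma span_\<Phi>_image: "span (\<Phi> ` S) = \<Phi> ` span S"
  by (rule span_linear_image[OF linear_\<Phi>])

lemma two_step_iff: "at_most_2_step_nilpotent L \<longleftrightarrow> (\<forall>x y z. br x (br y z) = 0)"
proof -
  have two: "2 = Suc (Suc 0)" by simp
  have "at_most_2_step_nilpotent L \<longleftrightarrow> \<Phi> ` descending_series br 2 = \<Phi> ` {0}"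
    by (simp only: at_most_2_step_nilpotent_def lower_central_\<Phi> image_insert image_empty \<Phi>_simps)
  also have "\<dots> \<longleftrightarrow> descending_series br 2 = {0}" by (rule inj_image_eq_iff[OF inj_\<Phi>])
  also have "\<dots> \<longleftrightarrow> (\<forall>x y z. br x (br y z) = 0)"
  proof
    assume 0: "descending_series br 2 = {0}"
    have "br x (br y z) \<in> descending_series br 2" for x y z
      unfolding two by (intro H.descending_series_step) simp
    then show "\<forall>x y z. br x (br y z) = 0" using 0 by simp
  next
    assume 0: "\<forall>x y z. br x (br y z) = 0"
    have "br x y = 0" if "y \<in> descending_series br (Suc 0)" for x y
    proof -
      have "y \<in> span {br a b |a b. True}" using that by (simp add: descending_series.simps(2))
      then show ?thesis by (induction rule: span_induct_alt) (use 0 in \<open>auto simp: H.br_simps\<close>)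
    qed
    then have "{br x y |x y. y \<in> descending_series br (Suc 0)} \<subseteq> {0}" by auto
    then have "descending_series br 2 \<subseteq> span {0}"
      unfolding two descending_series.simps(2)[of br "Suc 0"] by (rule span_mono)
    then show "descending_series br 2 = {0}"
      using subspace_0[OF H.subspace_descending_series, of 2] by auto
  qed
  finally show ?thesis .
qed

text \<open>
The isometry \<open>\<Phi>\<close> respects every ingredient of the normal form: orthonormal bases, spans, \<open>J\<close> and brackets.
\<close>
lemma skl_nilpotent_type_transport:
  assumes X: "\<And>i. i \<in> {1..s} \<Longrightarrow> X' i = \<Phi> (X i)" and \<epsilon>: "\<And>i. i \<in> {1..2 * n} \<Longrightarrow> \<epsilon>' i = \<Phi> (\<epsilon> i)"
  shows "skl_nilpotent_type n L J g r s X' \<epsilon>' l \<longleftrightarrow> H.skl_type n r s X \<epsilon> l"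
proof -
  have onb: "orthonormal_basis g m b (\<Phi> ` S) \<longleftrightarrow>
      (\<forall>i\<in>{1..m}. \<forall>k\<in>{1..m}. c i \<bullet> c k = (if i = k then 1 else 0)) \<and> span (c ` {1..m}) = S"
    if bc: "\<And>i. i \<in> {1..m} \<Longrightarrow> b i = \<Phi> (c i)" for m b c S
  proof -
    have "b ` {1..m} = \<Phi> ` c ` {1..m}" using bc by (auto simp: image_image)
    then have sp: "span (b ` {1..m}) = \<Phi> ` S \<longleftrightarrow> span (c ` {1..m}) = S"
      by (simp only: span_\<Phi>_image inj_image_eq_iff[OF inj_\<Phi>])
    have pt: "g (b i) (b k) = (\<lambda>_. if i = k then 1 else 0) \<longleftrightarrow> c i \<bullet> c k = (if i = k then 1 else 0)"
      if "i \<in> {1..m}" "k \<in> {1..m}" for i k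
      unfolding bc[OF that(1)] bc[OF that(2)] g_\<Phi> by (simp only: fun_eq_iff simp_thms)
    have gr: "(\<forall>i\<in>{1..m}. \<forall>k\<in>{1..m}. g (b i) (b k) = (\<lambda>_. if i = k then 1 else 0)) \<longleftrightarrow>
        (\<forall>i\<in>{1..m}. \<forall>k\<in>{1..m}. c i \<bullet> c k = (if i = k then 1 else 0))"
      by (intro ball_cong refl) (rule pt)
    show ?thesis unfolding orthonormal_basis_def gr sp ..
  qed
  have 1: "orthonormal_basis g s X' (bracket_space L L) \<longleftrightarrow>
      (\<forall>i\<in>{1..s}. \<forall>k\<in>{1..s}. X i \<bullet> X k = (if i = k then 1 else 0)) \<and> span (X ` {1..s}) = H.derived"
    unfolding derived_\<Phi> by (rule onb[OF X])
  have 2: "orthonormal_basis g (2 * n) \<epsilon>' L \<longleftrightarrow>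
      (\<forall>i\<in>{1..2 * n}. \<forall>k\<in>{1..2 * n}. \<epsilon> i \<bullet> \<epsilon> k = (if i = k then 1 else 0)) \<and> span (\<epsilon> ` {1..2 * n}) = UNIV"
    unfolding range_\<Phi>[symmetric] by (rule onb[OF \<epsilon>])
  have "J (\<epsilon>' i) = \<epsilon>' (n + i) \<longleftrightarrow> j (\<epsilon> i) = \<epsilon> (n + i)" if "i \<in> {1..n}" for i
    using that \<epsilon>[of i] \<epsilon>[of "n + i"] by (simp add: \<Phi>_j[symmetric] \<Phi>_eq_iff)
  then have 3: "(\<forall>i\<in>{1..n}. J (\<epsilon>' i) = \<epsilon>' (n + i)) \<longleftrightarrow> (\<forall>i\<in>{1..n}. j (\<epsilon> i) = \<epsilon> (n + i))"
    by blast
  have 4: "{Y + J Z |Y Z. Y \<in> bracket_space L L \<and> Z \<in> bracket_space L L} =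
       span (\<epsilon>' ` ({r + 1..n} \<union> {n + r + 1..2 * n})) \<longleftrightarrow>
     {x + j y |x y. x \<in> H.derived \<and> y \<in> H.derived} = span (\<epsilon> ` ({r + 1..n} \<union> {n + r + 1..2 * n}))"
  proof -
    have "\<epsilon>' ` ({r + 1..n} \<union> {n + r + 1..2 * n}) = \<Phi> ` \<epsilon> ` ({r + 1..n} \<union> {n + r + 1..2 * n})"
      unfolding image_image by (rule image_cong[OF refl]) (use \<epsilon> in auto)
    moreover have "{Y + J Z |Y Z. Y \<in> bracket_space L L \<and> Z \<in> bracket_space L L}
        = \<Phi> ` {x + j y |x y. x \<in> H.derived \<and> y \<in> H.derived}"
    proof (intro equalityI subsetI)
      fix v assume "v \<in> {Y + J Z |Y Z. Y \<in> bracket_space L L \<and> Z \<in> bracket_space L L}"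
      then obtain x y where "x \<in> H.derived" "y \<in> H.derived" "v = \<Phi> x + J (\<Phi> y)" unfolding derived_\<Phi> by blast
      then have "v = \<Phi> (x + j y)" "x \<in> H.derived" "y \<in> H.derived" by (simp_all only: \<Phi>_simps \<Phi>_j)
      then show "v \<in> \<Phi> ` {x + j y |x y. x \<in> H.derived \<and> y \<in> H.derived}" by blast
    next
      fix v assume "v \<in> \<Phi> ` {x + j y |x y. x \<in> H.derived \<and> y \<in> H.derived}"
      then obtain x y where "x \<in> H.derived" "y \<in> H.derived" "v = \<Phi> (x + j y)" by blast
      then have "v = \<Phi> x + J (\<Phi> y)" "x \<in> H.derived" "y \<in> H.derived" by (simp_all only: \<Phi>_simps \<Phi>_j)
      then show "v \<in> {Y + J Z |Y Z. Y \<in> bracket_space L L \<and> Z \<in> bracket_space L L}"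
        unfolding derived_\<Phi> by blast
    qed
    ultimately show ?thesis by (simp only: span_\<Phi>_image inj_image_eq_iff[OF inj_\<Phi>])
  qed
  have "lie_bracket (\<epsilon>' i) (\<epsilon>' k) = (if i \<le> s \<and> k = n + i then l i *\<^sub>R X' i else 0) \<longleftrightarrow>
      br (\<epsilon> i) (\<epsilon> k) = (if i \<le> s \<and> k = n + i then l i *\<^sub>R X i else 0)"
    if ik: "i \<in> {1..2 * n}" "k \<in> {1..2 * n}" for i k
  proof -
    have "(if i \<le> s \<and> k = n + i then l i *\<^sub>R X' i else 0) = \<Phi> (if i \<le> s \<and> k = n + i then l i *\<^sub>R X i else 0)"
      using ik X[of i] by (simp add: \<Phi>_simps)
    then show ?thesis unfolding \<epsilon>[OF ik(1)] \<epsilon>[OF ik(2)] \<Phi>_br[symmetric] by (simp only: \<Phi>_eq_iff)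
  qed
  then have 5: "(\<forall>i\<in>{1..2 * n}. \<forall>k\<in>{1..2 * n}. i < k \<longrightarrow>
        lie_bracket (\<epsilon>' i) (\<epsilon>' k) = (if i \<le> s \<and> k = n + i then l i *\<^sub>R X' i else 0)) \<longleftrightarrow>
      (\<forall>i\<in>{1..2 * n}. \<forall>k\<in>{1..2 * n}. i < k \<longrightarrow>
        br (\<epsilon> i) (\<epsilon> k) = (if i \<le> s \<and> k = n + i then l i *\<^sub>R X i else 0))"
    by blast
  show ?thesis
    unfolding skl_nilpotent_type_def H.skl_type_def two_step_iff 1 2 3 4 5 conj_assoc ..
qed

text \<open>
The basis is read off from \<open>structure_theorem\<close>, shifted to indices starting at 1; the weights \<open>\<kappa>\<close> become
\<open>\<lambda>\<^sub>i X\<^sub>i\<close> with \<open>\<lambda>\<^sub>i\<close> their lengths.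
\<close>
lemma skl_type_if_skl:
  assumes "nilpotent_lie_group A mul" "strominger_kahler_like A J g"
  shows "\<exists>r s X \<epsilon> l. H.skl_type n r s X \<epsilon> l"
proof -
  obtain nb where "nilpotent_skl_algebra br j nb" using skl_algebra_exists[OF assms] by blast
  then interpret S: nilpotent_skl_algebra br j nb .
  obtain m r s f \<kappa> where f: "H.unitary_basis m f UNIV" and sr: "s \<le> r" "r \<le> m"
    and N: "{x + j y |x y. x \<in> H.derived \<and> y \<in> H.derived} = span (f ` {r..<m} \<union> (\<lambda>i. j (f i)) ` {r..<m})"
    and der: "H.derived = span (\<kappa> ` {..<s})" and \<kappa>0: "\<And>i. i < s \<Longrightarrow> \<kappa> i \<noteq> 0"
    and orth: "\<And>i k. i < s \<Longrightarrow> k < s \<Longrightarrow> i \<noteq> k \<Longrightarrow> \<kappa> i \<bullet> \<kappa> k = 0"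
    and b1: "\<And>i k. i < m \<Longrightarrow> k < m \<Longrightarrow> br (f i) (f k) = 0"
    and b2: "\<And>i k. i < m \<Longrightarrow> k < m \<Longrightarrow> br (j (f i)) (j (f k)) = 0"
    and b3: "\<And>i k. i < m \<Longrightarrow> k < m \<Longrightarrow> br (f i) (j (f k)) = (if i = k \<and> i < s then \<kappa> i else 0)"
    by (rule S.structure_theorem) blast
  have m: "m = n"
    using H.unitary_basis_UNIV_dim[OF f] lie_hermitian by (simp add: lie_hermitian_def)
  \<comment> \<open>the basis f is indexed from 0, the normal form from 1\<close>
  define \<epsilon> where "\<epsilon> i = (if i \<le> n then f (i - 1) else j (f (i - n - 1)))" for i
  define X where "X i = (1 / norm (\<kappa> (i - 1))) *\<^sub>R \<kappa> (i - 1)" for i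
  define l where "l i = norm (\<kappa> (i - 1))" for i
  have lX: "l i *\<^sub>R X i = \<kappa> (i - 1)" "l i > 0" if "i \<in> {1..s}" for i
  proof -
    have "\<kappa> (i - 1) \<noteq> 0" using that by (intro \<kappa>0) auto
    then show "l i *\<^sub>R X i = \<kappa> (i - 1)" "l i > 0" by (auto simp: l_def X_def)
  qed
  have o: "f i \<bullet> f k = (if i = k then 1 else 0)" "f i \<bullet> j (f k) = 0" "j (f k) \<bullet> f i = 0" if "i < n" "k < n" for i k
  proof -
    show 1: "f i \<bullet> f k = (if i = k then 1 else 0)" "f i \<bullet> j (f k) = 0"
      using f that by (auto simp: H.unitary_basis_def m)
    then show "j (f k) \<bullet> f i = 0" by (simp only: inner_commute)
  qed
  have img: "\<epsilon> ` ({a + 1..n} \<union> {n + a + 1..2 * n}) = f ` {a..<n} \<union> (\<lambda>i. j (f i)) ` {a..<n}" for a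
  proof (intro equalityI subsetI)
    fix v assume "v \<in> \<epsilon> ` ({a + 1..n} \<union> {n + a + 1..2 * n})"
    then obtain i where i: "v = \<epsilon> i" "i \<in> {a + 1..n} \<or> i \<in> {n + a + 1..2 * n}" by blast
    show "v \<in> f ` {a..<n} \<union> (\<lambda>i. j (f i)) ` {a..<n}"
    proof (cases "i \<le> n")
      case True
      then have "v = f (i - 1)" "i - 1 \<in> {a..<n}" using i by (auto simp: \<epsilon>_def)
      then show ?thesis by blast
    next
      case False
      then have "v = j (f (i - n - 1))" "i - n - 1 \<in> {a..<n}" using i by (auto simp: \<epsilon>_def)
      then show ?thesis by blast
    qed
  next
    fix v assume "v \<in> f ` {a..<n} \<union> (\<lambda>i. j (f i)) ` {a..<n}"
    then consider i where "i \<in> {a..<n}" "v = f i" | i where "i \<in> {a..<n}" "v = j (f i)" by blast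
    then show "v \<in> \<epsilon> ` ({a + 1..n} \<union> {n + a + 1..2 * n})"
    proof cases
      case (1 i)
      then have "v = \<epsilon> (i + 1)" "i + 1 \<in> {a + 1..n}" by (auto simp: \<epsilon>_def)
      then show ?thesis by blast
    next
      case (2 i)
      then have "v = \<epsilon> (n + i + 1)" "n + i + 1 \<in> {n + a + 1..2 * n}" by (auto simp: \<epsilon>_def)
      then show ?thesis by blast
    qed
  qed
  have "H.skl_type n r s X \<epsilon> l"
    unfolding H.skl_type_def
  proof (intro conjI allI ballI impI)
    show "br x (br y z) = 0" for x y z using S.two_step[of y z] by simp
    show "r \<le> n" using sr m by simp
    show "X i \<bullet> X k = (if i = k then 1 else 0)" if "i \<in> {1..s}" "k \<in> {1..s}" for i k
    proof (cases "i = k")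
      case True
      have "\<kappa> (k - 1) \<noteq> 0" using that by (intro \<kappa>0) auto
      with True show ?thesis
        by (simp add: X_def dot_square_norm power2_eq_square)
    next
      case False
      then have "\<kappa> (i - 1) \<bullet> \<kappa> (k - 1) = 0" using that by (intro orth) auto
      with False show ?thesis by (simp add: X_def)
    qed
    show "span (X ` {1..s}) = H.derived"
    proof -
      have im: "{1..s} = Suc ` {..<s}" by (simp add: image_Suc_lessThan)
      have "span (X ` {1..s}) = span (\<kappa> ` {..<s})"
      proof (rule span_eq[THEN iffD2], intro conjI subsetI)
        fix v assume "v \<in> X ` {1..s}"
        then obtain i where "i \<in> {1..s}" "v = X i" by blast
        then have "v = (1 / norm (\<kappa> (i - 1))) *\<^sub>R \<kappa> (i - 1)" "i - 1 \<in> {..<s}" by (auto simp: X_def)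
        then show "v \<in> span (\<kappa> ` {..<s})" by (simp only: span_scale span_base imageI)
      next
        fix v assume "v \<in> \<kappa> ` {..<s}"
        then obtain i where "i < s" "v = \<kappa> i" by auto
        then have "v = l (Suc i) *\<^sub>R X (Suc i)" "Suc i \<in> {1..s}" using lX(1)[of "Suc i"] by auto
        then show "v \<in> span (X ` {1..s})" by (simp only: span_scale span_base imageI)
      qed
      then show ?thesis using der by simp
    qed
    show "\<epsilon> i \<bullet> \<epsilon> k = (if i = k then 1 else 0)" if "i \<in> {1..2 * n}" "k \<in> {1..2 * n}" for i k
    proof -
      have ik: "i \<le> n \<Longrightarrow> i - 1 < n" "k \<le> n \<Longrightarrow> k - 1 < n" "\<not> i \<le> n \<Longrightarrow> i - n - 1 < n" "\<not> k \<le> n \<Longrightarrow> k - n - 1 < n"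
        using that by auto
      show ?thesis
        by (cases "i \<le> n"; cases "k \<le> n")
          (use ik o that in \<open>auto simp: \<epsilon>_def H.J_isometry\<close>)
    qed
    show "span (\<epsilon> ` {1..2 * n}) = UNIV"
    proof -
      have "{1..2 * n} = {0 + 1..n} \<union> {n + 0 + 1..2 * n}" by auto
      then have "\<epsilon> ` {1..2 * n} = f ` {0..<n} \<union> (\<lambda>i. j (f i)) ` {0..<n}" using img[of 0] by simp
      then show ?thesis using f by (simp add: H.unitary_basis_def m atLeast0LessThan)
    qed
    show "j (\<epsilon> i) = \<epsilon> (n + i)" if "i \<in> {1..n}" for i using that by (simp add: \<epsilon>_def)
    show "{x + j y |x y. x \<in> H.derived \<and> y \<in> H.derived} = span (\<epsilon> ` ({r + 1..n} \<union> {n + r + 1..2 * n}))"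
      unfolding img N m ..
    show "l i > 0" if "i \<in> {1..s}" for i using lX(2)[OF that] .
    show "br (\<epsilon> i) (\<epsilon> k) = (if i \<le> s \<and> k = n + i then l i *\<^sub>R X i else 0)"
      if ik: "i \<in> {1..2 * n}" "k \<in> {1..2 * n}" "i < k" for i k
    proof -
      consider "i \<le> n" "k \<le> n" | "i \<le> n" "n < k" | "n < i" "n < k" using ik(3) by linarith
      then show ?thesis
      proof cases
        case 1
        then show ?thesis using b1[of "i - 1" "k - 1"] ik by (auto simp: \<epsilon>_def m)
      next
        case 2
        then have lt: "i - 1 < n" "k - n - 1 < n" using ik by auto
        have "br (\<epsilon> i) (\<epsilon> k) = (if i - 1 = k - n - 1 \<and> i - 1 < s then \<kappa> (i - 1) else 0)"
          using b3[of "i - 1" "k - n - 1"] lt 2 by (simp add: \<epsilon>_def m)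
        also have "(i - 1 = k - n - 1 \<and> i - 1 < s) \<longleftrightarrow> (i \<le> s \<and> k = n + i)" using 2 ik by auto
        finally show ?thesis using lX(1)[of i] ik by auto
      next
        case 3
        then have "i - n - 1 < n" "k - n - 1 < n" "\<not> i \<le> s" using ik sr m by auto
        then show ?thesis using b2[of "i - n - 1" "k - n - 1"] 3 by (simp add: \<epsilon>_def m)
      qed
    qed
  qed
  then show ?thesis by blast
qed

lemma skl_if_skl_type:
  assumes "H.skl_type n r s X \<epsilon> l"
  shows "strominger_kahler_like A J g"
proof -
  interpret T: skl_type_algebra br j n r s X \<epsilon> l
    by (intro skl_type_algebra.intro H.hermitian_lie_algebra_axioms skl_type_algebra_axioms.intro assms)
  interpret C: left_invariant_connection A mul one ginv J g n T.nb
    by unfold_locales (fact T.nb_bilinear T.nb_skew T.nb_J T.nb_torsion_skew T.nb_bianchi)+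
  show ?thesis by (rule C.strominger_kahler_like)
qed

lemma skl_type_consequences:
  assumes "H.skl_type n r s X \<epsilon> l"
  shows "n - r \<le> s \<and> s \<le> min r (2 * (n - r)) \<and> abelian_complex_structure L J \<and> (kahler A J g \<longleftrightarrow> s = 0 \<and> r = n)"
proof -
  interpret T: skl_type_algebra br j n r s X \<epsilon> l
    by (intro skl_type_algebra.intro H.hermitian_lie_algebra_axioms skl_type_algebra_axioms.intro assms)
  have "lie_bracket (J (\<Phi> x)) (J (\<Phi> y)) = lie_bracket (\<Phi> x) (\<Phi> y)" for x y
    unfolding \<Phi>_j[symmetric] \<Phi>_br[symmetric] T.abelian ..
  then have "abelian_complex_structure L J"
    unfolding abelian_complex_structure_def range_\<Phi>[symmetric] by blast
  then show ?thesis
    using T.dimension_bounds kahler_iff_left_invariant T.kahler_iff by simp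
qed

lemma skl_nilpotent_typeD:
  assumes "skl_nilpotent_type n L J g r s X \<epsilon> l"
  shows "H.skl_type n r s (\<lambda>i. \<Psi> (X i)) (\<lambda>i. \<Psi> (\<epsilon> i)) l"
proof -
  have "orthonormal_basis g s X (bracket_space L L)" "orthonormal_basis g (2 * n) \<epsilon> L"
    using assms by (simp_all add: skl_nilpotent_type_def)
  then have span: "span (X ` {1..s}) = bracket_space L L" "span (\<epsilon> ` {1..2 * n}) = L"
    by (simp_all add: orthonormal_basis_def)
  have "bracket_space L L \<subseteq> L" unfolding derived_\<Phi> using \<Phi>_L by blast
  then have "X i \<in> L" if "i \<in> {1..s}" for i
    using that span(1) span_base[of "X i" "X ` {1..s}"] by blast
  moreover have "\<epsilon> i \<in> L" if "i \<in> {1..2 * n}" for i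
    using that span(2) span_base[of "\<epsilon> i" "\<epsilon> ` {1..2 * n}"] by blast
  ultimately have "X i = \<Phi> (\<Psi> (X i))" "k \<in> {1..2 * n} \<Longrightarrow> \<epsilon> k = \<Phi> (\<Psi> (\<epsilon> k))" if "i \<in> {1..s}" for i k
    using \<Phi>_\<Psi> that by simp_all
  then show ?thesis
    using skl_nilpotent_type_transport[of s X "\<lambda>i. \<Psi> (X i)" \<epsilon> "\<lambda>i. \<Psi> (\<epsilon> i)" r l] assms
      \<Phi>_\<Psi> \<open>\<And>i. i \<in> {1..2 * n} \<Longrightarrow> \<epsilon> i \<in> L\<close> by simp
qed

end

theorem theorem1:
  fixes A :: "('m::{t2_space, second_countable_topology}, 'e::euclidean_space) chart set"
    and mul :: "'m \<Rightarrow> 'm \<Rightarrow> 'm" and one :: 'm and ginv :: "'m \<Rightarrow> 'm"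
    and J :: "'m vfield \<Rightarrow> 'm vfield"
    and g :: "'m vfield \<Rightarrow> 'm vfield \<Rightarrow> 'm \<Rightarrow> real"
    and n :: nat
  assumes "lie_hermitian n A mul one ginv J g"
    and "nilpotent_lie_group A mul"
  shows "(strominger_kahler_like A J g \<longleftrightarrow>
            (\<exists>r s X \<epsilon> l. skl_nilpotent_type n (lie_algebra A mul) J g r s X \<epsilon> l)) \<and>
         (\<forall>r s X \<epsilon> l. skl_nilpotent_type n (lie_algebra A mul) J g r s X \<epsilon> l \<longrightarrow>
            n - r \<le> s \<and> s \<le> min r (2 * (n - r)) \<and>
            abelian_complex_structure (lie_algebra A mul) J \<and>
            (kahler A J g \<longleftrightarrow> s = 0 \<and> r = n))"
proof -
  interpret lie_hermitian_manifold A mul one ginv J g n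
    by unfold_locales (use assms(1) in \<open>simp_all add: lie_hermitian_def lie_group_def\<close>)
  have "\<exists>r s X \<epsilon> l. skl_nilpotent_type n (lie_algebra A mul) J g r s X \<epsilon> l" if skl: "strominger_kahler_like A J g"
  proof -
    obtain r s X \<epsilon> l where "H.skl_type n r s X \<epsilon> l" using skl_type_if_skl[OF assms(2) skl] by blast
    then have "skl_nilpotent_type n (lie_algebra A mul) J g r s (\<lambda>i. \<Phi> (X i)) (\<lambda>i. \<Phi> (\<epsilon> i)) l"
      by (subst skl_nilpotent_type_transport[where X = X and \<epsilon> = \<epsilon>]) simp_all
    then show ?thesis by blast
  qed
  then show ?thesis
    using skl_if_skl_type[OF skl_nilpotent_typeD] skl_type_consequences[OF skl_nilpotent_typeD] by blast
qed

end
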